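(* Let $X_1,\dots,X_m$ be based connected CW-complexes and let $N=\max\{N\mathcal{E}(X_1),\dots,N\mathcal{E}(X_m)\}$. If $\mathcal{A}_\sharp^{N}(X_1\times\cdots\times X_m)$ is reducible, then $\mathcal{A}_\sharp^{N}(X_1\times\cdots\times X_m)=\mathcal{E}(X_1\times\cdots\times X_m)$, and hence $N=N\mathcal{E}(X_1\times\cdots\times X_m)$.
   Context: All spaces have the homotopy type of connected based CW-complexes; all maps are base-point-preserving and are identified with their based homotopy classes. $[X,X]$ is the monoid of based homotopy classes of self-maps of $X$, and $\mathcal{E}(X)\subseteq[X,X]$ is the group of homotopy classes of self-homotopy equivalences. For $n\in\{0,1,2,\dots\}\cup\{\infty\}$, $\mathcal{A}_\sharp^{n}(X)=\{f\in[X,X]:\pi_k(f)\in\mathrm{Aut}(\pi_k(X))\text{ for all } k\le n\}$ (all $k$ if $n=\infty$), so $\mathcal{A}_\sharp^{0}(X)=[X,X]$ and $\mathcal{A}_\sharp^{\infty}(X)=\mathcal{E}(X)$. The self-closeness number is $N\mathcal{E}(X)=\min\{n:\mathcal{A}_\sharp^{n}(X)=\mathcal{E}(X)\}$. Let $m\ge 2$. Write $p_k\colon X_1\times\cdots\times X_m\to X_k$ for the canonical projections, and write a self-map $f$ of $X_1\times\cdots\times X_m$ as $f=(f_1,\dots,f_m)$ with $f_k=p_k\circ f$. The monoid $\mathcal{A}_\sharp^{n}(X_1\times\cdots\times X_m)$ is called reducible if, whenever $f=(f_1,\dots,f_m)$ belongs to it, so do the self-maps obtained from $(f_1,\dots,f_m)$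 by replacing one component (and hence any number of components) $f_k$ by $p_k$, $k=1,\dots,m$. *)

theory Defs
  imports "HOL-Analysis.Analysis" "HOL-Algebra.Group"
begin

section \<open>Cubes\<close>

text \<open>
  The pair formed by the k-cube and its boundary serves both as domain of the representatives of
  elements of homotopy groups and, being homeomorphic to the pair formed by the closed k-ball and
  its bounding sphere, as the model of a closed k-cell. The 0-cube is a single point and has empty
  boundary.
\<close>

definition cube :: "nat \<Rightarrow> (nat \<Rightarrow> real) topology" where
  "cube k = product_topology (\<lambda>i. top_of_set {0..1}) {..<k}"

definition cube_boundary :: "nat \<Rightarrow> (nat \<Rightarrow> real) set" where
  "cube_boundary k = {t \<in> topspace (cube k). \<exists>i<k. t i = 0 \<or> t i = 1}"

definition cube_interior :: "nat \<Rightarrow> (nat \<Rightarrow> real) set" where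
  "cube_interior k = topspace (cube k) - cube_boundary k"


section \<open>CW-complexes\<close>

text \<open>
  A CW-structure is given by its characteristic maps: \<open>C n\<close> is the set of characteristic maps of
  the n-cells, and the open cell belonging to \<open>\<phi> \<in> C n\<close> is \<open>\<phi> ` cube_interior n\<close>.
  The last two conjuncts are closure finiteness and the weak topology.
\<close>

definition CW_structure :: "'a topology \<Rightarrow> (nat \<Rightarrow> ((nat \<Rightarrow> real) \<Rightarrow> 'a) set) \<Rightarrow> bool" where
  "CW_structure X C \<longleftrightarrow>
     Hausdorff_space X \<and>
     (\<forall>n. \<forall>\<phi>\<in>C n. continuous_map (cube n) X \<phi> \<and>
        homeomorphic_map (subtopology (cube n) (cube_interior n))
                         (subtopology X (\<phi> ` cube_interior n)) \<phi>) \<and>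
     (\<Union>n. \<Union>\<phi>\<in>C n. \<phi> ` cube_interior n) = topspace X \<and>
     (\<forall>n n'. \<forall>\<phi>\<in>C n. \<forall>\<psi>\<in>C n'. (n, \<phi>) \<noteq> (n', \<psi>) \<longrightarrow>
        \<phi> ` cube_interior n \<inter> \<psi> ` cube_interior n' = {}) \<and>
     (\<forall>n. \<forall>\<phi>\<in>C n. \<exists>F. finite F \<and> F \<subseteq> Sigma {..<n} C \<and>
        \<phi> ` cube_boundary n \<subseteq> (\<Union>(n', \<psi>)\<in>F. \<psi> ` cube_interior n')) \<and>
     (\<forall>A. A \<subseteq> topspace X \<longrightarrow>
        (closedin X A \<longleftrightarrow>
         (\<forall>n. \<forall>\<phi>\<in>C n. closedin (cube n) {t \<in> topspace (cube n). \<phi> t \<in> A})))"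

text \<open>The base point of a based CW-complex is a vertex.\<close>

definition connected_based_CW_complex :: "'a topology \<Rightarrow> 'a \<Rightarrow> bool" where
  "connected_based_CW_complex X x \<longleftrightarrow>
     connected_space X \<and> (\<exists>C. CW_structure X C \<and> x \<in> (\<Union>\<phi>\<in>C 0. \<phi> ` topspace (cube 0)))"


section \<open>Based homotopy classes\<close>

definition based_maps :: "'a topology \<Rightarrow> 'a \<Rightarrow> 'b topology \<Rightarrow> 'b \<Rightarrow> ('a \<Rightarrow> 'b) set" where
  "based_maps X x Y y = {f. continuous_map X Y f \<and> f x = y}"

definition based_homotopic ::
    "'a topology \<Rightarrow> 'a \<Rightarrow> 'b topology \<Rightarrow> 'b \<Rightarrow> ('a \<Rightarrow> 'b) \<Rightarrow> ('a \<Rightarrow> 'b) \<Rightarrow> bool" where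
  "based_homotopic X x Y y = homotopic_with (\<lambda>h. h x = y) X Y"

text \<open>
  Functions that agree on \<open>topspace X\<close> are homotopic, so the values of a representative outside
  the space do not matter.
\<close>

definition based_class ::
    "'a topology \<Rightarrow> 'a \<Rightarrow> 'b topology \<Rightarrow> 'b \<Rightarrow> ('a \<Rightarrow> 'b) \<Rightarrow> ('a \<Rightarrow> 'b) set" where
  "based_class X x Y y f = {g. based_homotopic X x Y y f g}"

definition based_classes ::
    "'a topology \<Rightarrow> 'a \<Rightarrow> 'b topology \<Rightarrow> 'b \<Rightarrow> ('a \<Rightarrow> 'b) set set" where
  "based_classes X x Y y = based_class X x Y y ` based_maps X x Y y"

definition based_homotopy_equivalence ::
    "'a topology \<Rightarrow> 'a \<Rightarrow> 'b topology \<Rightarrow> 'b \<Rightarrow> ('a \<Rightarrow> 'b) \<Rightarrow> bool" where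
  "based_homotopy_equivalence X x Y y f \<longleftrightarrow>
     f \<in> based_maps X x Y y \<and>
     (\<exists>g \<in> based_maps Y y X x.
        based_homotopic X x X x (g \<circ> f) id \<and> based_homotopic Y y Y y (f \<circ> g) id)"

definition self_equivalences :: "'a topology \<Rightarrow> 'a \<Rightarrow> ('a \<Rightarrow> 'a) set set" where
  "self_equivalences X x =
     {based_class X x X x f |f. based_homotopy_equivalence X x X x f}"


section \<open>Homotopy groups\<close>

definition loops :: "nat \<Rightarrow> 'a topology \<Rightarrow> 'a \<Rightarrow> ((nat \<Rightarrow> real) \<Rightarrow> 'a) set" where
  "loops k X x = {a. continuous_map (cube k) X a \<and> (\<forall>t\<in>cube_boundary k. a t = x)}"

definition loop_class ::
    "nat \<Rightarrow> 'a topology \<Rightarrow> 'a \<Rightarrow> ((nat \<Rightarrow> real) \<Rightarrow> 'a) \<Rightarrow> ((nat \<Rightarrow> real) \<Rightarrow> 'a) set" where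
  "loop_class k X x a = {b. homotopic_with (\<lambda>h. \<forall>t\<in>cube_boundary k. h t = x) (cube k) X a b}"

definition loop_concat ::
    "((nat \<Rightarrow> real) \<Rightarrow> 'a) \<Rightarrow> ((nat \<Rightarrow> real) \<Rightarrow> 'a) \<Rightarrow> (nat \<Rightarrow> real) \<Rightarrow> 'a" where
  "loop_concat a b =
     (\<lambda>t. if t 0 \<le> 1/2 then a (t(0 := 2 * t 0)) else b (t(0 := 2 * t 0 - 1)))"

text \<open>
  For \<open>k = 0\<close> only the carrier is meaningful: it is the set of path components.
\<close>

definition homotopy_group :: "nat \<Rightarrow> 'a topology \<Rightarrow> 'a \<Rightarrow> ((nat \<Rightarrow> real) \<Rightarrow> 'a) set monoid" where
  "homotopy_group k X x =
     \<lparr>carrier = loop_class k X x ` loops k X x,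
      mult = (\<lambda>A B. \<Union>a\<in>A. \<Union>b\<in>B. loop_class k X x (loop_concat a b)),
      one = loop_class k X x (\<lambda>t. x)\<rparr>"

text \<open>The map induced by a homotopy class \<open>c\<close> of based maps to \<open>(Y, y)\<close>.\<close>

definition induced_map ::
    "nat \<Rightarrow> 'b topology \<Rightarrow> 'b \<Rightarrow> ('a \<Rightarrow> 'b) set \<Rightarrow>
     ((nat \<Rightarrow> real) \<Rightarrow> 'a) set \<Rightarrow> ((nat \<Rightarrow> real) \<Rightarrow> 'b) set" where
  "induced_map k Y y c A = (\<Union>f\<in>c. \<Union>a\<in>A. loop_class k Y y (f \<circ> a))"

definition homotopy_group_automorphisms ::
    "nat \<Rightarrow> 'a topology \<Rightarrow> 'a \<Rightarrow>
     (((nat \<Rightarrow> real) \<Rightarrow> 'a) set \<Rightarrow> ((nat \<Rightarrow> real) \<Rightarrow> 'a) set) set" where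
  "homotopy_group_automorphisms k X x =
     (if k = 0
      then {h. bij_betw h (carrier (homotopy_group 0 X x)) (carrier (homotopy_group 0 X x))}
      else iso (homotopy_group k X x) (homotopy_group k X x))"


section \<open>Self-closeness numbers\<close>

definition A_sharp :: "enat \<Rightarrow> 'a topology \<Rightarrow> 'a \<Rightarrow> ('a \<Rightarrow> 'a) set set" where
  "A_sharp n X x =
     {c \<in> based_classes X x X x.
        \<forall>k. enat k \<le> n \<longrightarrow> induced_map k X x c \<in> homotopy_group_automorphisms k X x}"

text \<open>
  By the Whitehead theorem the minimum exists if X has the based homotopy type of a connected
  CW-complex.
\<close>

definition self_closeness :: "'a topology \<Rightarrow> 'a \<Rightarrow> enat" where
  "self_closeness X x = (LEAST n. A_sharp n X x = self_equivalences X x)"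


section \<open>Self-maps of products\<close>

text \<open>
  The product of \<open>X 1, \<dots>, X m\<close> carries the product topology; its points are the functions
  that are extensional on \<open>{1..m}\<close>.
\<close>

definition prod_space :: "nat \<Rightarrow> (nat \<Rightarrow> 'a topology) \<Rightarrow> (nat \<Rightarrow> 'a) topology" where
  "prod_space m X = product_topology X {1..m}"

definition prod_point :: "nat \<Rightarrow> (nat \<Rightarrow> 'a) \<Rightarrow> nat \<Rightarrow> 'a" where
  "prod_point m x = (\<lambda>k\<in>{1..m}. x k)"

definition proj :: "nat \<Rightarrow> (nat \<Rightarrow> 'a) \<Rightarrow> 'a" where
  "proj k z = z k"

definition tuple_map :: "nat \<Rightarrow> (nat \<Rightarrow> 'c \<Rightarrow> 'a) \<Rightarrow> 'c \<Rightarrow> nat \<Rightarrow> 'a" where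
  "tuple_map m g = (\<lambda>z. \<lambda>k\<in>{1..m}. g k z)"

definition replace_component ::
    "nat \<Rightarrow> nat \<Rightarrow> ((nat \<Rightarrow> 'a) \<Rightarrow> nat \<Rightarrow> 'a) \<Rightarrow> (nat \<Rightarrow> 'a) \<Rightarrow> nat \<Rightarrow> 'a" where
  "replace_component m k f = tuple_map m ((\<lambda>j. proj j \<circ> f)(k := proj k))"

definition reducible ::
    "nat \<Rightarrow> (nat \<Rightarrow> 'a topology) \<Rightarrow> (nat \<Rightarrow> 'a) \<Rightarrow> ((nat \<Rightarrow> 'a) \<Rightarrow> nat \<Rightarrow> 'a) set set \<Rightarrow> bool" where
  "reducible m X x A \<longleftrightarrow>
     (let P = prod_space m X; p = prod_point m x in
      \<forall>f \<in> based_maps P p P p. based_class P p P p f \<in> A \<longrightarrow>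
        (\<forall>k\<in>{1..m}. based_class P p P p (replace_component m k f) \<in> A))"

end

theory Submission
  imports Defs
begin

text \<open>
  Let \<open>f\<close> induce automorphisms of the homotopy groups up to dimension \<open>N\<close>. If all components of \<open>f\<close>
  but the k-th are projections, then \<open>f\<close> restricted to the k-th factor is in \<open>A_sharp N (X k) (x k)\<close>,
  hence an equivalence. Now \<open>f\<close> is a fibrewise map over the product of the other factors that
  is an equivalence on one fibre; since the base is connected and of CW type, a fibrewise right
  inverse can be constructed cell by cell, and two such constructions show that \<open>f\<close> is an
  equivalence. In general reducibility supplies, for the last component of \<open>f\<close> that is not yet a
  projection, a map of this kind; composing \<open>f\<close> with its inverse turns that component into a
  projection, and the claim follows by induction. Restriction of \<open>f \<times> id\<close> to a factor gives the
  inequality \<open>N \<le> self_closeness\<close>. Whitehead's theorem for a single CW-complex guarantees that the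
  minimum defining the self-closeness number is attained.

  The product topology need not be the CW topology of the product complex. Instead of comparing
  the two, maps on a complex times a space are precomposed with a self-map of the complex that is
  homotopic to the identity and locally takes values in finite unions of closed cells. The same
  cell-by-cell construction gives Whitehead's theorem.
\<close>

text \<open>Both cell-by-cell constructions are instances of \<open>lifting\<close>: for
  \<open>\<gamma>\<close> on \<open>X\<close> times \<open>W\<close> and \<open>u\<close> on
  \<open>X\<close> times \<open>L\<close> it finds \<open>v\<close> with
  \<open>\<gamma> (x, v (x, l))\<close> homotopic to \<open>u (x, l)\<close>. For
  \<open>W = L = F\<close> and \<open>u\<close> the projection to \<open>F\<close>, \<open>v\<close>
  is a fibrewise right inverse; for \<open>L\<close> a point and \<open>u\<close> the identity of
  \<open>X\<close>, it is a right inverse of a map that is bijective on homotopy groups. Cells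
  decompose only the base. The fibre \<open>F\<close>, a product of the remaining factors, is not
  given a cell structure, so the obstruction over a cell is removed by composing families of
  self-maps of \<open>F\<close> and not by computing in its homotopy groups. The recursion over
  skeleta needs strict equality on cell boundaries, while the homotopy over a new cell is a
  concatenation and therefore needs time that the homotopy on the boundary does not occupy. All
  homotopies are hence kept constant near both ends, for a time \<open>a n\<close> that shrinks with
  the dimension.\<close>

abbreviation unit_interval :: "real topology" where
  "unit_interval \<equiv> top_of_set {0..1}"

text \<open>Used as \<open>(rule cmi)+\<close>, since \<open>intro\<close> does not instantiate the unknown factors of products.\<close>

named_theorems cmi

section \<open>Continuity rules for products, subspaces and the unit interval\<close>

lemma cm_id [cmi]: "continuous_map X X (\<lambda>x. x)"
  by (rule continuous_map_id [unfolded id_def])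

lemma cm_id_subt [cmi]: "continuous_map (subtopology X S) X (\<lambda>x. x)"
  by (rule continuous_map_id_subt [unfolded id_def])

lemma cm_fst [cmi]:
  "continuous_map Z (prod_topology X Y) f \<Longrightarrow> continuous_map Z X (\<lambda>z. fst (f z))"
  using continuous_map_fst_of by (force simp: o_def)

lemma cm_snd [cmi]:
  "continuous_map Z (prod_topology X Y) f \<Longrightarrow> continuous_map Z Y (\<lambda>z. snd (f z))"
  using continuous_map_snd_of by (force simp: o_def)

lemma cm_pair [cmi]:
  "\<lbrakk>continuous_map Z X f; continuous_map Z Y g\<rbrakk>
   \<Longrightarrow> continuous_map Z (prod_topology X Y) (\<lambda>z. (f z, g z))"
  by (rule continuous_map_pairedI)

lemma cm_comp:
  "\<lbrakk>continuous_map Y Z h; continuous_map X Y f\<rbrakk> \<Longrightarrow> continuous_map X Z (\<lambda>x. h (f x))"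
  using continuous_map_compose by (force simp: o_def)

lemma cm_subt:
  "\<lbrakk>continuous_map Z X f; \<And>z. z \<in> topspace Z \<Longrightarrow> f z \<in> S\<rbrakk>
   \<Longrightarrow> continuous_map Z (subtopology X S) f"
  by (auto simp: continuous_map_in_subtopology)

lemma cm_unit:
  "\<lbrakk>continuous_map Z euclideanreal f; \<And>z. z \<in> topspace Z \<Longrightarrow> 0 \<le> f z \<and> f z \<le> 1\<rbrakk>
   \<Longrightarrow> continuous_map Z unit_interval f"
  by (auto simp: continuous_map_in_subtopology)

lemma cm_real:
  "continuous_map Z unit_interval f \<Longrightarrow> continuous_map Z euclideanreal f"
  by (rule continuous_map_into_fulltopology)

lemma cm_range:
  "\<lbrakk>continuous_map Z Y f; z \<in> topspace Z\<rbrakk> \<Longrightarrow> f z \<in> topspace Y"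
  by (auto simp: continuous_map_def)

lemma cm_unit_range:
  "\<lbrakk>continuous_map Z unit_interval f; z \<in> topspace Z\<rbrakk> \<Longrightarrow> 0 \<le> f z \<and> f z \<le> 1"
  using cm_range by fastforce

lemma cm_product:
  "\<lbrakk>\<And>z. z \<in> topspace Z \<Longrightarrow> f z \<in> extensional I;
    \<And>i. i \<in> I \<Longrightarrow> continuous_map Z (X i) (\<lambda>z. f z i)\<rbrakk>
   \<Longrightarrow> continuous_map Z (product_topology X I) f"
  by (auto simp: continuous_map_componentwise)

lemma cm_coord:
  "\<lbrakk>continuous_map Z (product_topology X I) f; i \<in> I\<rbrakk> \<Longrightarrow> continuous_map Z (X i) (\<lambda>z. f z i)"
  by (auto simp: continuous_map_componentwise)

lemma cm_cases_le:
  assumes "continuous_map X euclideanreal p" "continuous_map X euclideanreal q"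
    and "continuous_map (subtopology X {x \<in> topspace X. p x \<le> q x}) Y f"
    and "continuous_map (subtopology X {x \<in> topspace X. q x \<le> p x}) Y g"
    and "\<And>x. \<lbrakk>x \<in> topspace X; p x = q x\<rbrakk> \<Longrightarrow> f x = g x"
  shows "continuous_map X Y (\<lambda>x. if p x \<le> q x then f x else g x)"
  using assms by (rule continuous_map_cases_le)

text \<open>\<open>homotopic_with\<close> fixes the ends of a homotopy as functions on the whole
  type. The last premise makes \<open>P\<close> blind to values off the space, so that the ends need
  to be compared on \<open>topspace X\<close> only.\<close>

lemma homotopic_withI:
  assumes "continuous_map (prod_topology unit_interval X) Y h"
    and "\<And>x. x \<in> topspace X \<Longrightarrow> h (0, x) = p x"
    and "\<And>x. x \<in> topspace X \<Longrightarrow> h (1, x) = q x"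
    and "\<And>t. 0 \<le> t \<Longrightarrow> t \<le> 1 \<Longrightarrow> P (\<lambda>x. h (t, x))"
    and "\<And>h k. (\<And>x. x \<in> topspace X \<Longrightarrow> h x = k x) \<Longrightarrow> P h \<longleftrightarrow> P k"
  shows "homotopic_with P X Y p q"
proof -
  have "homotopic_with P X Y p q \<longleftrightarrow>
          (\<exists>h. continuous_map (prod_topology unit_interval X) Y h \<and>
             (\<forall>x \<in> topspace X. h(0,x) = p x) \<and>
             (\<forall>x \<in> topspace X. h(1,x) = q x) \<and>
             (\<forall>t \<in> {0..1}. P(\<lambda>x. h(t, x))))"
    by (rule homotopic_with) (rule assms(5))
  moreover have "\<forall>t \<in> {0..1}. P(\<lambda>x. h(t, x))"
    using assms(4) by simp
  ultimately show ?thesis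
    using assms(1-3) by blast
qed

section \<open>Radial coordinates on the cube\<close>

lemma topspace_cube: "topspace (cube n) = (\<Pi>\<^sub>E i\<in>{..<n}. {0..1})"
  by (simp add: cube_def)

lemma cube_bounds: "\<lbrakk>t \<in> topspace (cube n); i < n\<rbrakk> \<Longrightarrow> 0 \<le> t i \<and> t i \<le> 1"
  by (force simp: topspace_cube)

lemma cm_cube_coord: "i < n \<Longrightarrow> continuous_map Z (cube n) f \<Longrightarrow> continuous_map Z euclideanreal (\<lambda>z. f z i)"
  unfolding cube_def using cm_coord[of Z "\<lambda>i. unit_interval" "{..<n}" f i] cm_real by auto

lemma cm_into_cube:
  assumes "\<And>i. i < n \<Longrightarrow> continuous_map Z euclideanreal (\<lambda>z. f z i)"
    and "\<And>z. z \<in> topspace Z \<Longrightarrow> f z \<in> topspace (cube n)"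
  shows "continuous_map Z (cube n) f"
  unfolding cube_def
proof (rule cm_product)
  show "f z \<in> extensional {..<n}" if "z \<in> topspace Z" for z
    using assms(2)[OF that] by (auto simp: topspace_cube PiE_def)
  show "continuous_map Z unit_interval (\<lambda>z. f z i)" if "i \<in> {..<n}" for i
    using that assms(1) cube_bounds[OF assms(2)] by (intro cm_unit) auto
qed

lemma compact_cube: "compact_space (cube n)"
  by (simp add: cube_def compact_space_product_topology compact_space_subtopology)

lemma topspace_cube_0: "topspace (cube 0) = {\<lambda>_. undefined}"
  by (simp add: topspace_cube)

lemma cube_boundary_0: "cube_boundary 0 = {}"
  by (simp add: cube_boundary_def)

lemma cube_boundary_subset: "cube_boundary n \<subseteq> topspace (cube n)"
  by (auto simp: cube_boundary_def)

lemma cube_interior_subset: "cube_interior n \<subseteq> topspace (cube n)"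
  by (auto simp: cube_interior_def)

text \<open>The maximum norm in coordinates centred at the midpoint of the cube and scaled by 2: the
  cube becomes the closed unit ball and its boundary the points of norm 1.\<close>

primrec cnorm :: "nat \<Rightarrow> (nat \<Rightarrow> real) \<Rightarrow> real" where
  "cnorm 0 t = 0"
| "cnorm (Suc n) t = max (cnorm n t) \<bar>2 * t n - 1\<bar>"

lemma cnorm_nonneg: "0 \<le> cnorm n t"
  by (induction n) auto

lemma cnorm_le_iff: "0 \<le> c \<Longrightarrow> cnorm n t \<le> c \<longleftrightarrow> (\<forall>i<n. \<bar>2 * t i - 1\<bar> \<le> c)"
  by (induction n) (auto simp: less_Suc_eq)

lemma cnorm_ge_coord: "i < n \<Longrightarrow> \<bar>2 * t i - 1\<bar> \<le> cnorm n t"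
  using cnorm_le_iff cnorm_nonneg by blast

lemma cnorm_attained: "0 < cnorm n t \<Longrightarrow> \<exists>i<n. cnorm n t = \<bar>2 * t i - 1\<bar>"
proof (induction n)
  case (Suc n)
  show ?case
  proof (cases "cnorm n t \<le> \<bar>2 * t n - 1\<bar>")
    case True
    then show ?thesis by (auto simp: max_def)
  next
    case False
    then have "cnorm (Suc n) t = cnorm n t" by simp
    then show ?thesis using Suc less_SucI by metis
  qed
qed simp

lemma cnorm_le_1: "t \<in> topspace (cube n) \<Longrightarrow> cnorm n t \<le> 1"
  by (subst cnorm_le_iff) (use cube_bounds in \<open>force+\<close>)

lemma cube_boundary_cnorm: "t \<in> cube_boundary n \<longleftrightarrow> t \<in> topspace (cube n) \<and> cnorm n t = 1"
proof (intro iffI conjI)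
  assume t: "t \<in> cube_boundary n"
  then show "t \<in> topspace (cube n)" using cube_boundary_subset by blast
  from t obtain i where "i < n" "t i = 0 \<or> t i = 1" by (auto simp: cube_boundary_def)
  then have "1 \<le> cnorm n t" using cnorm_ge_coord[of i n t] by auto
  then show "cnorm n t = 1" using cnorm_le_1 \<open>t \<in> topspace (cube n)\<close> by force
next
  assume t: "t \<in> topspace (cube n) \<and> cnorm n t = 1"
  then obtain i where "i < n" "1 = \<bar>2 * t i - 1\<bar>" using cnorm_attained[of n t] by auto
  then have "t i = 0 \<or> t i = 1" by auto
  then show "t \<in> cube_boundary n" using t \<open>i < n\<close> by (auto simp: cube_boundary_def)
qed

lemma cube_interior_cnorm: "t \<in> cube_interior n \<longleftrightarrow> t \<in> topspace (cube n) \<and> cnorm n t < 1"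
  using cnorm_le_1[of t n] by (auto simp: cube_interior_def cube_boundary_cnorm)

lemma cm_cnorm: "continuous_map Z (cube n) f \<Longrightarrow> continuous_map Z euclideanreal (\<lambda>z. cnorm n (f z))"
proof -
  assume f: "continuous_map Z (cube n) f"
  have "k \<le> n \<Longrightarrow> continuous_map Z euclideanreal (\<lambda>z. cnorm k (f z))" for k
  proof (induction k)
    case (Suc k)
    then have "continuous_map Z euclideanreal (\<lambda>z. f z k)" by (intro cm_cube_coord[OF _ f]) auto
    then show ?case using Suc by (auto intro!: continuous_intros)
  qed simp
  then show ?thesis by blast
qed

text \<open>The homothety of ratio \<open>q\<close> about the midpoint; the restriction keeps values
  extensional, as points of \<open>cube n\<close> have to be.\<close>

definition dilate :: "nat \<Rightarrow> real \<Rightarrow> (nat \<Rightarrow> real) \<Rightarrow> nat \<Rightarrow> real" where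
  "dilate n q t = (\<lambda>i\<in>{..<n}. 1/2 + (t i - 1/2) * q)"

lemma cnorm_cong: "(\<And>i. i < n \<Longrightarrow> t i = u i) \<Longrightarrow> cnorm n t = cnorm n u"
  by (induction n) auto

lemma cnorm_dilate: "0 \<le> q \<Longrightarrow> cnorm n (dilate n q t) = q * cnorm n t"
proof -
  assume q: "0 \<le> q"
  have "cnorm k (\<lambda>i. 1/2 + (t i - 1/2) * q) = q * cnorm k t" for k
  proof (induction k)
    case (Suc k)
    have *: "2 * (1/2 + (t k - 1/2) * q) - 1 = q * (2 * t k - 1)" by (simp add: algebra_simps)
    show ?case unfolding cnorm.simps * Suc abs_mult
      using q by (simp add: max_mult_distrib_left)
  qed simp
  moreover have "cnorm n (dilate n q t) = cnorm n (\<lambda>i. 1/2 + (t i - 1/2) * q)"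
    by (rule cnorm_cong) (simp add: dilate_def)
  ultimately show ?thesis by simp
qed

lemma cube_iff_cnorm: "t \<in> topspace (cube n) \<longleftrightarrow> t \<in> extensional {..<n} \<and> cnorm n t \<le> 1"
  by (auto simp: cnorm_le_iff topspace_cube PiE_iff abs_le_iff field_simps)

lemma dilate_in_cube: "\<lbrakk>0 \<le> q; q * cnorm n t \<le> 1\<rbrakk> \<Longrightarrow> dilate n q t \<in> topspace (cube n)"
  by (subst cube_iff_cnorm) (simp add: cnorm_dilate, simp add: dilate_def)

lemma dilate_1: "t \<in> topspace (cube n) \<Longrightarrow> dilate n 1 t = t"
  by (auto simp: dilate_def topspace_cube fun_eq_iff PiE_def extensional_def restrict_def)

text \<open>The homothety of ratio \<open>1 + s\<close> about the midpoint, except that points which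
  would leave the cube stop on the boundary. In particular \<open>stretch n 1\<close> retracts the
  collar where \<open>cnorm\<close> is at least 1/2 radially onto the boundary.\<close>

definition stretch :: "nat \<Rightarrow> real \<Rightarrow> (nat \<Rightarrow> real) \<Rightarrow> nat \<Rightarrow> real" where
  "stretch n s t = dilate n ((1 + s) / max 1 ((1 + s) * cnorm n t)) t"

lemma cnorm_stretch: "0 \<le> s \<Longrightarrow> cnorm n (stretch n s t) = min 1 ((1 + s) * cnorm n t)"
  unfolding stretch_def by (subst cnorm_dilate) (auto simp: max_def min_def)

lemma stretch_in_cube: "0 \<le> s \<Longrightarrow> stretch n s t \<in> topspace (cube n)"
  by (subst cube_iff_cnorm) (simp add: cnorm_stretch, simp add: stretch_def dilate_def)

lemma stretch_boundary: "\<lbrakk>0 \<le> s; 1 \<le> (1 + s) * cnorm n t\<rbrakk> \<Longrightarrow> stretch n s t \<in> cube_boundary n"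
  by (simp add: cube_boundary_cnorm stretch_in_cube cnorm_stretch)

lemma stretch_0: "t \<in> topspace (cube n) \<Longrightarrow> stretch n 0 t = t"
  using cnorm_le_1[of t n] by (simp add: stretch_def dilate_1)

lemma stretch_on_boundary: "\<lbrakk>0 \<le> s; t \<in> cube_boundary n\<rbrakk> \<Longrightarrow> stretch n s t = t"
  by (simp add: stretch_def cube_boundary_cnorm dilate_1)

lemma cm_dilate:
  assumes "continuous_map Z (cube n) f" "continuous_map Z euclideanreal q"
    "\<And>z. z \<in> topspace Z \<Longrightarrow> 0 \<le> q z" "\<And>z. z \<in> topspace Z \<Longrightarrow> q z * cnorm n (f z) \<le> 1"
  shows "continuous_map Z (cube n) (\<lambda>z. dilate n (q z) (f z))"
proof (rule cm_into_cube)
  show "continuous_map Z euclideanreal (\<lambda>z. dilate n (q z) (f z) i)" if "i < n" for i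
    using that cm_cube_coord[OF that assms(1)] assms(2)
    by (auto simp: dilate_def intro!: continuous_intros)
qed (use assms in \<open>auto intro: dilate_in_cube\<close>)

lemma cm_stretch:
  assumes f: "continuous_map Z (cube n) f" and s: "continuous_map Z euclideanreal s"
    and pos: "\<And>z. z \<in> topspace Z \<Longrightarrow> 0 \<le> s z"
  shows "continuous_map Z (cube n) (\<lambda>z. stretch n (s z) (f z))"
  unfolding stretch_def
proof (rule cm_dilate[OF f])
  show "continuous_map Z euclideanreal (\<lambda>z. (1 + s z) / max 1 ((1 + s z) * cnorm n (f z)))"
    by (intro continuous_intros s cm_cnorm[OF f]) auto
qed (use pos in \<open>auto simp: max_def field_simps\<close>)

section \<open>Homotopy extension for the cube and its boundary\<close>

definition cube_bd :: "nat \<Rightarrow> (nat \<Rightarrow> real) topology" where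
  "cube_bd n = subtopology (cube n) (cube_boundary n)"

lemma topspace_cube_bd [simp]: "topspace (cube_bd n) = cube_boundary n"
  using cube_boundary_subset by (auto simp: cube_bd_def)

lemma cm_cube_bd: "continuous_map Z (cube_bd n) f \<Longrightarrow> continuous_map Z (cube n) f"
  unfolding cube_bd_def by (rule continuous_map_into_fulltopology)

text \<open>The last conclusion makes the end of the homotopy constant along the rays of a collar; it
  gives the points of lower cells large neighbourhoods in \<open>cell_compression\<close>.\<close>

lemma cube_homotopy_extension:
  fixes L :: "'l topology"
  assumes f: "continuous_map (prod_topology (cube n) L) Z f"
    and h: "continuous_map (prod_topology unit_interval (prod_topology (cube_bd n) L)) Z h"
    and h0: "\<And>t l. \<lbrakk>t \<in> cube_boundary n; l \<in> topspace L\<rbrakk> \<Longrightarrow> h (0, t, l) = f (t, l)"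
  obtains F where "continuous_map (prod_topology unit_interval (prod_topology (cube n) L)) Z F"
    and "\<And>t l. t \<in> topspace (cube n) \<Longrightarrow> F (0, t, l) = f (t, l)"
    and "\<And>s t l. \<lbrakk>0 \<le> s; s \<le> 1; t \<in> cube_boundary n; l \<in> topspace L\<rbrakk> \<Longrightarrow> F (s, t, l) = h (s, t, l)"
    and "\<And>t l. 3/4 \<le> cnorm n t \<Longrightarrow> F (1, t, l) = h (1, stretch n 1 t, l)"
    and "\<And>s t l. \<lbrakk>0 \<le> s; s \<le> 1\<rbrakk> \<Longrightarrow>
           F (s, t, l) \<in> f ` (topspace (cube n) \<times> {l}) \<union> h ` ({0..1} \<times> cube_boundary n \<times> {l})"
proof -
  define T where "T = prod_topology unit_interval (prod_topology (cube n) L)"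
  define N where "N z = (1 + fst z) * cnorm n (fst (snd z))" for z :: "real \<times> (nat \<Rightarrow> real) \<times> 'l"
  define S where "S z = stretch n (fst z) (fst (snd z))" for z :: "real \<times> (nat \<Rightarrow> real) \<times> 'l"
  \<comment> \<open>\<open>N\<close> is the norm before clipping. A point with \<open>N > 1\<close>
    has reached the boundary, and its excess, counted at speed 2, is the time for which
    \<open>h\<close> is run there, capped at the current time \<open>s\<close>. On the boundary
    \<open>N = 1 + s\<close>, so the cap gives time exactly \<open>s\<close>; at
    \<open>s = 1\<close> the excess amounts to full time as soon as \<open>cnorm\<close> is 3/4,
    which is the origin of that constant.\<close>
  define \<theta> where "\<theta> z = min (fst z) (2 * (N z - 1))" for z :: "real \<times> (nat \<Rightarrow> real) \<times> 'l"
  define F where "F z = (if N z \<le> 1 then f (S z, snd (snd z)) else h (\<theta> z, S z, snd (snd z)))" for z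
  have cfst: "continuous_map T euclideanreal fst"
    unfolding T_def by (rule cm_real, (rule cmi)+)
  have ct: "continuous_map T (cube n) (\<lambda>z. fst (snd z))"
    and cl: "continuous_map T L (\<lambda>z. snd (snd z))"
    unfolding T_def by (rule cmi)+
  have top: "0 \<le> fst z \<and> fst z \<le> 1 \<and> fst (snd z) \<in> topspace (cube n) \<and> snd (snd z) \<in> topspace L"
    if "z \<in> topspace T" for z
    using that by (auto simp: T_def)
  have cN: "continuous_map T euclideanreal N"
    unfolding N_def by (intro continuous_intros cfst cm_cnorm[OF ct])
  have cS: "continuous_map T (cube n) S"
    unfolding S_def by (rule cm_stretch[OF ct cfst]) (use top in blast)
  have c\<theta>: "continuous_map T euclideanreal \<theta>"
    unfolding \<theta>_def by (intro continuous_intros cfst cN)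
  have "continuous_map T Z F"
    unfolding F_def
  proof (rule cm_cases_le[OF cN])
    show "continuous_map (subtopology T {x \<in> topspace T. N x \<le> 1}) Z (\<lambda>x. f (S x, snd (snd x)))"
      by (intro cm_comp[OF f] cm_pair continuous_map_from_subtopology cS cl)
    show "continuous_map (subtopology T {x \<in> topspace T. 1 \<le> N x}) Z (\<lambda>x. h (\<theta> x, S x, snd (snd x)))"
    proof (rule cm_comp[OF h], intro cm_pair)
      show "continuous_map (subtopology T {x \<in> topspace T. 1 \<le> N x}) L (\<lambda>x. snd (snd x))"
        by (rule continuous_map_from_subtopology[OF cl])
      show "continuous_map (subtopology T {x \<in> topspace T. 1 \<le> N x}) unit_interval \<theta>"
        by (rule cm_unit[OF continuous_map_from_subtopology[OF c\<theta>]])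
          (use top in \<open>force simp: \<theta>_def min_le_iff_disj\<close>)
      show "continuous_map (subtopology T {x \<in> topspace T. 1 \<le> N x}) (cube_bd n) S"
        unfolding cube_bd_def
        by (rule cm_subt[OF continuous_map_from_subtopology[OF cS]])
          (use top stretch_boundary in \<open>fastforce simp: S_def N_def\<close>)
    qed
    show "f (S x, snd (snd x)) = h (\<theta> x, S x, snd (snd x))" if "x \<in> topspace T" "N x = 1" for x
    proof -
      have "S x \<in> cube_boundary n" 
        using top[OF that(1)] that(2) by (auto simp: S_def N_def intro: stretch_boundary)
      moreover have "\<theta> x = 0" using top[OF that(1)] that(2) by (auto simp: \<theta>_def)
      ultimately show ?thesis using h0 top[OF that(1)] by simp
    qed
  qed simp
  moreover have "F (0, t, l) = f (t, l)" if "t \<in> topspace (cube n)" for t l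
    using that cnorm_le_1[OF that] by (simp add: F_def N_def S_def stretch_0)
  moreover have "F (s, t, l) = h (s, t, l)"
    if "0 \<le> s" "s \<le> 1" "t \<in> cube_boundary n" "l \<in> topspace L" for s t l
    using that h0[OF that(3,4)]
    by (auto simp: F_def N_def S_def \<theta>_def stretch_on_boundary cube_boundary_cnorm)
  moreover have "F (1, t, l) = h (1, stretch n 1 t, l)" if "3/4 \<le> cnorm n t" for t l
    using that by (simp add: F_def N_def S_def \<theta>_def)
  moreover have "F (s, t, l) \<in> f ` (topspace (cube n) \<times> {l}) \<union> h ` ({0..1} \<times> cube_boundary n \<times> {l})"
    if s: "0 \<le> s" "s \<le> 1" for s t l
  proof (cases "N (s, t, l) \<le> 1")
    case True
    then show ?thesis using stretch_in_cube[OF s(1)] by (auto simp: F_def S_def)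
  next
    case False
    then have "S (s, t, l) \<in> cube_boundary n" "0 \<le> \<theta> (s, t, l)" "\<theta> (s, t, l) \<le> 1"
      using s by (auto simp: S_def N_def \<theta>_def intro!: stretch_boundary)
    then show ?thesis using False by (auto simp: F_def)
  qed
  ultimately show ?thesis using that unfolding T_def by blast
qed

section \<open>CW-complexes: recursion over the skeleta\<close>

locale cw_complex =
  fixes X :: "'a topology" and C :: "nat \<Rightarrow> ((nat \<Rightarrow> real) \<Rightarrow> 'a) set"
  assumes CW: "CW_structure X C"
begin

lemma Hausdorff: "Hausdorff_space X"
  using CW unfolding CW_structure_def by (elim conjE)

lemma CW_char:
  "\<forall>n. \<forall>\<phi>\<in>C n. continuous_map (cube n) X \<phi> \<and>
     homeomorphic_map (subtopology (cube n) (cube_interior n))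
                      (subtopology X (\<phi> ` cube_interior n)) \<phi>"
  using CW unfolding CW_structure_def by (elim conjE)

lemma cm_char: "\<phi> \<in> C n \<Longrightarrow> continuous_map (cube n) X \<phi>"
  using CW_char by blast

lemma char_in: "\<phi> \<in> C n \<Longrightarrow> t \<in> topspace (cube n) \<Longrightarrow> \<phi> t \<in> topspace X"
  using cm_char cm_range by metis

lemma inj_on_char: assumes "\<phi> \<in> C n" shows "inj_on \<phi> (cube_interior n)"
proof -
  have "homeomorphic_map (subtopology (cube n) (cube_interior n))
                         (subtopology X (\<phi> ` cube_interior n)) \<phi>"
    using CW_char assms by blast
  then have "inj_on \<phi> (topspace (subtopology (cube n) (cube_interior n)))"
    by (rule homeomorphic_imp_injective_map)
  then show ?thesis
    using cube_interior_subset[of n] by (simp add: Int_absorb1)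
qed

lemma in_open_cell: "x \<in> topspace X \<Longrightarrow> \<exists>n \<phi> t. \<phi> \<in> C n \<and> t \<in> cube_interior n \<and> \<phi> t = x"
proof -
  assume "x \<in> topspace X"
  moreover have "(\<Union>n. \<Union>\<phi>\<in>C n. \<phi> ` cube_interior n) = topspace X"
    using CW unfolding CW_structure_def by (elim conjE)
  ultimately have "x \<in> (\<Union>n. \<Union>\<phi>\<in>C n. \<phi> ` cube_interior n)" by simp
  then show ?thesis by blast
qed

lemma open_cells_disjoint:
  assumes "\<phi> \<in> C n" "\<psi> \<in> C n'" "t \<in> cube_interior n" "t' \<in> cube_interior n'" "\<phi> t = \<psi> t'"
  shows "n = n' \<and> \<phi> = \<psi> \<and> t = t'"
proof -
  have "\<forall>n n'. \<forall>\<phi>\<in>C n. \<forall>\<psi>\<in>C n'. (n, \<phi>) \<noteq> (n', \<psi>) \<longrightarrow>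
        \<phi> ` cube_interior n \<inter> \<psi> ` cube_interior n' = {}"
    using CW unfolding CW_structure_def by (elim conjE)
  then have "(n, \<phi>) = (n', \<psi>)" using assms by blast
  then show ?thesis using assms inj_on_char[OF assms(1)] by (auto dest: inj_onD)
qed

lemma closure_finite:
  assumes "\<phi> \<in> C n"
  obtains F where "finite F" "F \<subseteq> Sigma {..<n} C"
    "\<phi> ` cube_boundary n \<subseteq> (\<Union>(n', \<psi>)\<in>F. \<psi> ` cube_interior n')"
proof -
  have "\<forall>n. \<forall>\<phi>\<in>C n. \<exists>F. finite F \<and> F \<subseteq> Sigma {..<n} C \<and>
        \<phi> ` cube_boundary n \<subseteq> (\<Union>(n', \<psi>)\<in>F. \<psi> ` cube_interior n')"
    using CW unfolding CW_structure_def by (elim conjE)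
  then show ?thesis using assms that by meson
qed

lemma closedin_iff_cells:
  assumes "A \<subseteq> topspace X"
  shows "closedin X A \<longleftrightarrow> (\<forall>n. \<forall>\<phi>\<in>C n. closedin (cube n) {t \<in> topspace (cube n). \<phi> t \<in> A})"
proof -
  have "\<forall>A. A \<subseteq> topspace X \<longrightarrow> (closedin X A \<longleftrightarrow>
         (\<forall>n. \<forall>\<phi>\<in>C n. closedin (cube n) {t \<in> topspace (cube n). \<phi> t \<in> A}))"
    using CW unfolding CW_structure_def by (elim conjE)
  then show ?thesis using assms by blast
qed

text \<open>The choice is forced: the open cells partition the space and characteristic maps are
  injective on interiors, see \<open>cell_index_char\<close>.\<close>

definition cell_index :: "'a \<Rightarrow> nat \<times> ((nat \<Rightarrow> real) \<Rightarrow> 'a) \<times> (nat \<Rightarrow> real)" where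
  "cell_index x = (SOME (n, \<phi>, t). \<phi> \<in> C n \<and> t \<in> cube_interior n \<and> \<phi> t = x)"

definition cdim :: "'a \<Rightarrow> nat" where "cdim x = fst (cell_index x)"
definition cchar :: "'a \<Rightarrow> (nat \<Rightarrow> real) \<Rightarrow> 'a" where "cchar x = fst (snd (cell_index x))"
definition cpoint :: "'a \<Rightarrow> nat \<Rightarrow> real" where "cpoint x = snd (snd (cell_index x))"

lemma cell_index:
  assumes "x \<in> topspace X"
  shows "cchar x \<in> C (cdim x)" "cpoint x \<in> cube_interior (cdim x)" "cchar x (cpoint x) = x"
proof -
  have "\<exists>p. case p of (n, \<phi>, t) \<Rightarrow> \<phi> \<in> C n \<and> t \<in> cube_interior n \<and> \<phi> t = x"
    using in_open_cell[OF assms] by auto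
  then have "case cell_index x of (n, \<phi>, t) \<Rightarrow> \<phi> \<in> C n \<and> t \<in> cube_interior n \<and> \<phi> t = x"
    unfolding cell_index_def by (rule someI_ex)
  then show "cchar x \<in> C (cdim x)" "cpoint x \<in> cube_interior (cdim x)" "cchar x (cpoint x) = x"
    by (auto simp: cdim_def cchar_def cpoint_def split: prod.splits)
qed

lemma cell_index_char:
  assumes "\<phi> \<in> C n" "t \<in> cube_interior n"
  shows "cdim (\<phi> t) = n" "cchar (\<phi> t) = \<phi>" "cpoint (\<phi> t) = t"
proof -
  have x: "\<phi> t \<in> topspace X" using assms char_in cube_interior_subset by blast
  note * = open_cells_disjoint[OF cell_index(1)[OF x] assms(1) cell_index(2)[OF x] assms(2) cell_index(3)[OF x]]
  then show "cdim (\<phi> t) = n" "cchar (\<phi> t) = \<phi>" "cpoint (\<phi> t) = t" by auto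
qed

text \<open>Closure finiteness covers the boundary by open cells of smaller dimension. This makes
  recursion on the dimension of the cell of a point well-founded.\<close>

lemma cdim_boundary:
  assumes "\<phi> \<in> C n" "t \<in> cube_boundary n"
  shows "cdim (\<phi> t) < n"
proof -
  obtain F where "F \<subseteq> Sigma {..<n} C"
    "\<phi> ` cube_boundary n \<subseteq> (\<Union>(n', \<psi>)\<in>F. \<psi> ` cube_interior n')"
    using closure_finite[OF assms(1)] by metis
  then obtain n' \<psi> s where "n' < n" "\<psi> \<in> C n'" "s \<in> cube_interior n'" "\<phi> t = \<psi> s"
    using assms(2) by blast
  then show ?thesis using cell_index_char(1) by metis
qed

lemma cdim_le: "\<lbrakk>\<phi> \<in> C n; t \<in> topspace (cube n)\<rbrakk> \<Longrightarrow> cdim (\<phi> t) \<le> n"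
  using cdim_boundary[of \<phi> n t] cell_index_char(1)[of \<phi> n t]
  by (cases "t \<in> cube_boundary n") (auto simp: cube_interior_def)

text \<open>\<open>Good n \<phi> \<eta>\<close> is a condition on the values \<open>\<eta>\<close> along the closed cell of \<open>\<phi>\<close>.\<close>

lemma skeleton_recursion:
  fixes Good :: "nat \<Rightarrow> ((nat \<Rightarrow> real) \<Rightarrow> 'a) \<Rightarrow> ((nat \<Rightarrow> real) \<Rightarrow> 'd) \<Rightarrow> bool"
  assumes cong: "\<And>n \<phi> \<eta> \<eta>'. \<lbrakk>\<phi> \<in> C n; \<And>t. t \<in> topspace (cube n) \<Longrightarrow> \<eta> t = \<eta>' t; Good n \<phi> \<eta>\<rbrakk> \<Longrightarrow> Good n \<phi> \<eta>'"
    and ext: "\<And>n \<phi> \<xi>. \<lbrakk>\<phi> \<in> C n; \<And>i \<psi>. i < n \<Longrightarrow> \<psi> \<in> C i \<Longrightarrow> Good i \<psi> (\<xi> \<circ> \<psi>)\<rbrakk>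
        \<Longrightarrow> \<exists>\<eta>. (\<forall>t\<in>cube_boundary n. \<eta> t = \<xi> (\<phi> t)) \<and> Good n \<phi> \<eta>"
  obtains \<xi> where "\<And>n \<phi>. \<phi> \<in> C n \<Longrightarrow> Good n \<phi> (\<xi> \<circ> \<phi>)"
proof -
  define step where "step n \<phi> \<xi> = (SOME \<eta>. (\<forall>t\<in>cube_boundary n. \<eta> t = \<xi> (\<phi> t)) \<and> Good n \<phi> \<eta>)"
    for n \<phi> and \<xi> :: "'a \<Rightarrow> 'd"
  \<comment> \<open>Stage \<open>\<Xi> n\<close> is meaningful at points of dimension below
    \<open>n\<close>, so its start value is arbitrary. A point receives its value at the one stage
    given by its dimension and keeps it, whence the stages agree with \<open>\<xi>\<close> wherever
    they are meaningful.\<close>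
  define \<Xi> where "\<Xi> = rec_nat (\<lambda>x. undefined)
    (\<lambda>n \<xi> x. if cdim x = n then step n (cchar x) \<xi> (cpoint x) else \<xi> x)"
  have \<Xi>_Suc: "\<Xi> (Suc n) x = (if cdim x = n then step n (cchar x) (\<Xi> n) (cpoint x) else \<Xi> n x)" for n x
    by (simp add: \<Xi>_def)
  define \<xi> where "\<xi> x = \<Xi> (Suc (cdim x)) x" for x
  have stable: "\<Xi> n x = \<xi> x" if "cdim x < n" for n x
    using that by (induction n) (auto simp: \<Xi>_Suc \<xi>_def less_Suc_eq)
  have "Good n \<phi> (\<xi> \<circ> \<phi>)" if "\<phi> \<in> C n" for n \<phi>
    using that
  proof (induction n arbitrary: \<phi> rule: less_induct)
    case (less n)
    have "Good i \<psi> (\<Xi> n \<circ> \<psi>)" if "i < n" "\<psi> \<in> C i" for i \<psi>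
    proof (rule cong[OF that(2) _ less.IH[OF that]])
      show "(\<xi> \<circ> \<psi>) t = (\<Xi> n \<circ> \<psi>) t" if "t \<in> topspace (cube i)" for t
        using stable[of "\<psi> t" n] cdim_le[OF \<open>\<psi> \<in> C i\<close> that] \<open>i < n\<close> by simp
    qed
    then have "\<exists>\<eta>. (\<forall>t\<in>cube_boundary n. \<eta> t = \<Xi> n (\<phi> t)) \<and> Good n \<phi> \<eta>"
      by (rule ext[OF less.prems])
    then have step: "(\<forall>t\<in>cube_boundary n. step n \<phi> (\<Xi> n) t = \<Xi> n (\<phi> t)) \<and> Good n \<phi> (step n \<phi> (\<Xi> n))"
      unfolding step_def by (rule someI_ex)
    show ?case
    proof (rule cong[OF less.prems _ step[THEN conjunct2]])
      fix t assume t: "t \<in> topspace (cube n)"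
      show "step n \<phi> (\<Xi> n) t = (\<xi> \<circ> \<phi>) t"
      proof (cases "t \<in> cube_boundary n")
        case True
        then show ?thesis using step stable cdim_boundary[OF less.prems True] by simp
      next
        case False
        then have "t \<in> cube_interior n" using t by (simp add: cube_interior_def)
        then show ?thesis by (simp add: \<xi>_def \<Xi>_Suc cell_index_char[OF less.prems])
      qed
    qed
  qed
  then show ?thesis using that by blast
qed

section \<open>Continuity tested on closed cells\<close>

definition cells :: "(nat \<times> ((nat \<Rightarrow> real) \<Rightarrow> 'a)) set \<Rightarrow> 'a set" where
  "cells F = (\<Union>(n, \<psi>)\<in>F. \<psi> ` topspace (cube n))"

text \<open>A characteristic map goes from a compact to a Hausdorff space and is therefore proper;
  products of proper maps are proper, hence closed. This holds for every \<open>L\<close>, without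
  any compactness of \<open>L\<close>.\<close>

lemma closed_map_char:
  assumes "\<phi> \<in> C n"
  shows "closed_map (prod_topology (cube n) L) (prod_topology X L) (\<lambda>(t, l). (\<phi> t, l))"
proof (rule proper_imp_closed_map)
  have "proper_map (cube n) X \<phi>"
    using assms compact_cube cm_char Hausdorff Hausdorff_imp_kc_space continuous_imp_proper_map by blast
  moreover have "proper_map L L (\<lambda>l. l)"
    using proper_map_id[of L] by (simp add: id_def)
  ultimately show "proper_map (prod_topology (cube n) L) (prod_topology X L) (\<lambda>(t, l). (\<phi> t, l))"
    using proper_map_prod[of "cube n" L X L \<phi> "\<lambda>l. l"] by blast
qed

text \<open>The preimage of a closed set is a union of images of closed sets under the maps of
  \<open>closed_map_char\<close>, one for each cell of \<open>F\<close>. Finiteness of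
  \<open>F\<close> is what makes this union closed; for infinitely many cells the product with
  \<open>L\<close> may fail to have the corresponding weak topology.\<close>

lemma continuous_on_cells:
  assumes F: "finite F" "F \<subseteq> Sigma UNIV C"
    and v: "\<And>n \<psi>. (n, \<psi>) \<in> F \<Longrightarrow> continuous_map (prod_topology (cube n) L) W (\<lambda>z. v (\<psi> (fst z), snd z))"
  shows "continuous_map (prod_topology (subtopology X (cells F)) L) W v"
proof -
  have sub: "cells F \<subseteq> topspace X"
    using F char_in by (force simp: cells_def)
  define T where "T = prod_topology (subtopology X (cells F)) L"
  have T: "topspace T = cells F \<times> topspace L" using sub by (auto simp: T_def)
  have "closedin T {x \<in> topspace T. v x \<in> B}" if B: "closedin W B" for B
  proof -
    define P where "P p = (\<lambda>(t, l). (snd p t, l)) ` {z \<in> topspace (prod_topology (cube (fst p)) L). v (snd p (fst z), snd z) \<in> B}" for p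
    have "closedin (prod_topology X L) (P p)" if "p \<in> F" for p
    proof -
      obtain n \<psi> where p: "p = (n, \<psi>)" by (cases p)
      then have "\<psi> \<in> C n" using F that by auto
      moreover have "closedin (prod_topology (cube n) L) {z \<in> topspace (prod_topology (cube n) L). v (\<psi> (fst z), snd z) \<in> B}"
        using v[of n \<psi>] that p B by (auto simp: continuous_map_closedin)
      ultimately show ?thesis
        using closed_map_char unfolding P_def p closed_map_def by fastforce
    qed
    then have "closedin (prod_topology X L) (\<Union>p\<in>F. P p)" using F by (intro closedin_Union) auto
    moreover have "{x \<in> topspace T. v x \<in> B} = (\<Union>p\<in>F. P p)"
    proof (intro equalityI subsetI)
      fix x assume x: "x \<in> {x \<in> topspace T. v x \<in> B}"
      then obtain n \<psi> t where "(n, \<psi>) \<in> F" "t \<in> topspace (cube n)" "fst x = \<psi> t" "snd x \<in> topspace L"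
        by (auto simp: T cells_def)
      then have "x = (\<psi> t, snd x)" by (simp add: prod_eq_iff)
      then have "x \<in> P (n, \<psi>)"
        using x \<open>t \<in> _\<close> \<open>snd x \<in> _\<close> unfolding P_def by (intro image_eqI[of _ _ "(t, snd x)"]) auto
      then show "x \<in> (\<Union>p\<in>F. P p)" using \<open>(n, \<psi>) \<in> F\<close> by blast
    next
      fix x assume "x \<in> (\<Union>p\<in>F. P p)"
      then show "x \<in> {x \<in> topspace T. v x \<in> B}"
        by (fastforce simp: P_def T cells_def)
    qed
    moreover have "(\<Union>p\<in>F. P p) \<subseteq> cells F \<times> topspace L"
      by (fastforce simp: P_def cells_def)
    ultimately show ?thesis
      by (simp add: T_def prod_topology_subtopology closedin_subset_topspace)
  qed
  moreover have "v x \<in> topspace W" if "x \<in> topspace T" for x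
  proof -
    obtain n \<psi> t where "(n, \<psi>) \<in> F" "t \<in> topspace (cube n)" "fst x = \<psi> t" "snd x \<in> topspace L"
      using \<open>x \<in> topspace T\<close> by (auto simp: T cells_def)
    moreover from this have "x = (\<psi> t, snd x)" by (simp add: prod_eq_iff)
    ultimately show ?thesis
      using cm_range[OF v, of n \<psi> "(t, snd x)"] by simp
  qed
  ultimately show ?thesis
    by (auto simp: continuous_map_closedin T_def[symmetric])
qed

text \<open>A finite union of compact images. The point is that closedness is asked on the cells of
  \<open>F\<close> only, which suits inductions where nothing is known yet about higher
  cells.\<close>

lemma closedin_Int_cells:
  assumes F: "finite F" "F \<subseteq> Sigma UNIV C" and "A \<subseteq> topspace X"
    and A: "\<And>n \<psi>. (n, \<psi>) \<in> F \<Longrightarrow> closedin (cube n) {t \<in> topspace (cube n). \<psi> t \<in> A}"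
  shows "closedin X (A \<inter> cells F)"
proof -
  have "closedin X (\<psi> ` {t \<in> topspace (cube n). \<psi> t \<in> A})" if "(n, \<psi>) \<in> F" for n \<psi>
  proof -
    have "continuous_map (cube n) X \<psi>" using F that cm_char by auto
    then have "closed_map (cube n) X \<psi>"
      using compact_cube Hausdorff continuous_imp_closed_map by blast
    then show ?thesis using A[OF that] by (simp add: closed_map_def)
  qed
  then have "closedin X (\<Union>p\<in>F. snd p ` {t \<in> topspace (cube (fst p)). snd p t \<in> A})"
    using F by (intro closedin_Union) auto
  moreover have "A \<inter> cells F = (\<Union>p\<in>F. snd p ` {t \<in> topspace (cube (fst p)). snd p t \<in> A})"
    by (force simp: cells_def)
  ultimately show ?thesis by simp
qed

lemma boundary_in_cells:
  assumes "\<phi> \<in> C n"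
  obtains F where "finite F" "F \<subseteq> Sigma {..<n} C" "\<phi> ` cube_boundary n \<subseteq> cells F"
proof -
  obtain F where F: "finite F" "F \<subseteq> Sigma {..<n} C"
    "\<phi> ` cube_boundary n \<subseteq> (\<Union>(n', \<psi>)\<in>F. \<psi> ` cube_interior n')"
    using closure_finite[OF assms] by metis
  note F(3)
  also have "(\<Union>(n', \<psi>)\<in>F. \<psi> ` cube_interior n') \<subseteq> cells F"
    unfolding cells_def by (intro UN_mono) (auto simp: cube_interior_def)
  finally show ?thesis by (rule that[OF F(1,2)])
qed

text \<open>The boundary of a cell lies in finitely many closed cells of smaller dimension, so
  \<open>continuous_on_cells\<close> applies.\<close>

lemma continuous_on_cell_boundary:
  assumes \<phi>: "\<phi> \<in> C n"
    and v: "\<And>i \<psi>. i < n \<Longrightarrow> \<psi> \<in> C i \<Longrightarrow>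
      continuous_map (prod_topology (cube i) L) W (\<lambda>z. v (\<psi> (fst z), snd z))"
  shows "continuous_map (prod_topology (cube_bd n) L) W (\<lambda>z. v (\<phi> (fst z), snd z))"
proof -
  obtain F where F: "finite F" "F \<subseteq> Sigma {..<n} C" "\<phi> ` cube_boundary n \<subseteq> cells F"
    using boundary_in_cells[OF \<phi>] by metis
  have c: "continuous_map (prod_topology (subtopology X (cells F)) L) W v"
    by (rule continuous_on_cells[OF F(1)]) (use F(2) v in auto)
  have "continuous_map (prod_topology (cube_bd n) L) (subtopology X (cells F)) (\<lambda>z. \<phi> (fst z))"
  proof (rule cm_subt)
    show "continuous_map (prod_topology (cube_bd n) L) X (\<lambda>z. \<phi> (fst z))"
      by (rule cm_comp[OF cm_char[OF \<phi>]], rule cm_cube_bd, (rule cmi)+)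
    show "\<phi> (fst z) \<in> cells F" if "z \<in> topspace (prod_topology (cube_bd n) L)" for z
      using that F(3) by auto
  qed
  moreover have "continuous_map (prod_topology (cube_bd n) L) L snd"
    by (rule continuous_map_snd)
  ultimately show ?thesis
    by (intro cm_comp[OF c] cm_pair)
qed

text \<open>Unlike an arbitrary factor, the compact unit interval preserves the weak topology: for a
  compact set \<open>J\<close> of times, the points that leave \<open>U\<close> during
  \<open>J\<close> form, in each cell, the projection of a closed set along a compact factor, which
  is closed.\<close>

lemma continuous_homotopy:
  assumes h: "\<And>n \<phi>. \<phi> \<in> C n \<Longrightarrow> continuous_map (prod_topology unit_interval (cube n)) Z (\<lambda>z. h (fst z, \<phi> (snd z)))"
  shows "continuous_map (prod_topology unit_interval X) Z h"
proof -
  let ?T = "prod_topology unit_interval X"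
  have "openin ?T {z \<in> topspace ?T. h z \<in> U}" if U: "openin Z U" for U
  proof (subst openin_prod_topology_alt, intro allI impI)
    fix r0 x0 assume z: "(r0, x0) \<in> {z \<in> topspace ?T. h z \<in> U}"
    then have r0: "r0 \<in> {0..1}" and x0: "x0 \<in> topspace X" and hU: "h (r0, x0) \<in> U" by auto
    obtain n \<phi> t where \<phi>: "\<phi> \<in> C n" "t \<in> topspace (cube n)" "\<phi> t = x0"
      using in_open_cell[OF x0] cube_interior_subset by blast
    have "continuous_map unit_interval Z (\<lambda>r. h (fst (r, t), \<phi> (snd (r, t))))"
      by (rule cm_comp[OF h[OF \<phi>(1)]]) (use \<phi> in \<open>auto intro!: cm_pair cmi\<close>)
    then have "openin unit_interval {r \<in> {0..1}. h (r, x0) \<in> U}"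
      using U \<phi>(3) unfolding continuous_map_def by force
    then obtain e where e: "e > 0" "\<And>r. \<lbrakk>r \<in> {0..1}; dist r r0 < e\<rbrakk> \<Longrightarrow> h (r, x0) \<in> U"
      using r0 hU unfolding openin_euclidean_subtopology_iff by blast
    \<comment> \<open>Half the radius, so that this compact set of times stays inside the ball on
      which \<open>x0\<close> is known to be mapped into \<open>U\<close>.\<close>
    define J where "J = {0..1} \<inter> cball r0 (e/2)"
    define V where "V = {x \<in> topspace X. \<forall>r\<in>J. h (r, x) \<in> U}"
    have "closedin X (topspace X - V)"
    proof (subst closedin_iff_cells, blast, intro allI ballI)
      fix k \<psi> assume \<psi>: "\<psi> \<in> C k"
      let ?I = "prod_topology unit_interval (cube k)"
      have "closedin ?I ({z \<in> topspace ?I. fst z \<in> J} \<inter> {z \<in> topspace ?I. h (fst z, \<psi> (snd z)) \<in> topspace Z - U})"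
      proof (intro closedin_Int closedin_continuous_map_preimage[OF h[OF \<psi>]] closedin_continuous_map_preimage[of ?I unit_interval fst])
        show "closedin unit_interval J" unfolding J_def by (simp add: closedin_closed_Int)
        show "closedin Z (topspace Z - U)" using U by blast
      qed (rule cmi)+
      then have "closedin (cube k) (snd ` ({z \<in> topspace ?I. fst z \<in> J} \<inter> {z \<in> topspace ?I. h (fst z, \<psi> (snd z)) \<in> topspace Z - U}))"
        using closed_map_snd[of unit_interval "cube k"] by (auto simp: closed_map_def compact_space_subtopology)
      moreover have "snd ` ({z \<in> topspace ?I. fst z \<in> J} \<inter> {z \<in> topspace ?I. h (fst z, \<psi> (snd z)) \<in> topspace Z - U})
          = {t \<in> topspace (cube k). \<psi> t \<in> topspace X - V}" (is "?A = ?B")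
      proof (intro equalityI subsetI)
        show "t \<in> ?B" if "t \<in> ?A" for t
          using that char_in[OF \<psi>] by (auto simp: V_def)
        show "t \<in> ?A" if "t \<in> ?B" for t
        proof -
          obtain r where r: "r \<in> J" "h (r, \<psi> t) \<notin> U" and t: "t \<in> topspace (cube k)"
            using \<open>t \<in> ?B\<close> by (auto simp: V_def)
          moreover have "(r, t) \<in> topspace ?I" using r t by (auto simp: J_def)
          moreover have "h (r, \<psi> t) \<in> topspace Z"
            using cm_range[OF h[OF \<psi>] \<open>(r, t) \<in> topspace ?I\<close>] by simp
          ultimately show ?thesis by (force simp: image_iff)
        qed
      qed
      ultimately show "closedin (cube k) {t \<in> topspace (cube k). \<psi> t \<in> topspace X - V}" by simp
    qed
    then have "openin X V"
      by (metis (no_types, lifting) V_def mem_Collect_eq openin_closedin_eq subsetI)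
    moreover have "openin unit_interval ({0..1} \<inter> ball r0 (e/2))" by (simp add: openin_open_Int)
    moreover have "x0 \<in> V" using x0 e by (auto simp: V_def J_def dist_commute)
    moreover have "({0..1} \<inter> ball r0 (e/2)) \<times> V \<subseteq> {z \<in> topspace ?T. h z \<in> U}"
      by (auto simp: V_def J_def)
    ultimately show "\<exists>A B. openin unit_interval A \<and> openin X B \<and> r0 \<in> A \<and> x0 \<in> B \<and> A \<times> B \<subseteq> {z \<in> topspace ?T. h z \<in> U}"
      using r0 e(1) by (intro exI[of _ "{0..1} \<inter> ball r0 (e/2)"] exI[of _ V]) auto
  qed
  moreover have "h z \<in> topspace Z" if "z \<in> topspace ?T" for z
  proof -
    have x: "snd z \<in> topspace X" "fst z \<in> {0..1}" using that by auto
    obtain n \<phi> t where \<phi>: "\<phi> \<in> C n" "t \<in> topspace (cube n)" "\<phi> t = snd z"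
      using in_open_cell[OF x(1)] cube_interior_subset by blast
    then show ?thesis using cm_range[OF h[OF \<phi>(1)], of "(fst z, t)"] x by simp
  qed
  ultimately show ?thesis by (auto simp: continuous_map_def)
qed

end

section \<open>Path components, neighbourhoods of cells, and compression\<close>

context cw_complex
begin

text \<open>A property of points that is invariant under path components is constant on each closed
  cell, so it defines a closed set. Applied to the path component of \<open>x\<close> and to its
  complement this shows that the component is clopen.\<close>

lemma path_connected_if_connected:
  assumes "connected_space X"
  shows "path_connected_space X"
proof -
  have path: "path_component_of X (\<phi> s) (\<phi> t)"
    if "\<phi> \<in> C n" "s \<in> topspace (cube n)" "t \<in> topspace (cube n)" for n \<phi> s t
  proof -
    have "path_connected_space (cube n)"
      by (simp add: cube_def path_connected_space_product_topology)
    then have "path_connectedin X (\<phi> ` topspace (cube n))"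
      by (intro path_connectedin_continuous_map_image[OF cm_char[OF that(1)]])
        (simp add: path_connectedin_topspace)
    then show ?thesis
      using that unfolding path_component_of by (meson imageI path_connectedin)
  qed
  show ?thesis
    unfolding path_connected_space_iff_path_component
  proof (intro ballI)
    fix x y assume x: "x \<in> topspace X" and y: "y \<in> topspace X"
    let ?A = "{z \<in> topspace X. path_component_of X x z}"
    have all_or_none: "{t \<in> topspace (cube n). P (\<phi> t)} = {} \<or> {t \<in> topspace (cube n). P (\<phi> t)} = topspace (cube n)"
      if "\<phi> \<in> C n" "\<And>z w. path_component_of X z w \<Longrightarrow> P z \<longleftrightarrow> P w" for n \<phi> P
      using path[OF that(1)] that(2) by blast
    have eqv: "path_component_of X x z \<longleftrightarrow> path_component_of X x w" if "path_component_of X z w" for z w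
      using that by (meson path_component_of_sym path_component_of_trans)
    have *: "closedin X {z \<in> topspace X. P z}" if eq: "\<And>z w. path_component_of X z w \<Longrightarrow> P z \<longleftrightarrow> P w" for P
    proof (subst closedin_iff_cells, blast, intro allI ballI)
      fix n \<phi> assume \<phi>: "\<phi> \<in> C n"
      then have "{t \<in> topspace (cube n). \<phi> t \<in> {z \<in> topspace X. P z}} = {t \<in> topspace (cube n). P (\<phi> t)}"
        using char_in by auto
      moreover have "closedin (cube n) {t \<in> topspace (cube n). P (\<phi> t)}"
      proof (rule disjE[OF all_or_none[OF \<phi>, of P]])
        show "P z \<longleftrightarrow> P w" if "path_component_of X z w" for z w
          using that by (rule eq)
      next
        assume "{t \<in> topspace (cube n). P (\<phi> t)} = {}"
        then show ?thesis by (simp only: closedin_empty)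
      next
        assume "{t \<in> topspace (cube n). P (\<phi> t)} = topspace (cube n)"
        then show ?thesis by (simp only: closedin_topspace)
      qed
      ultimately show "closedin (cube n) {t \<in> topspace (cube n). \<phi> t \<in> {z \<in> topspace X. P z}}" by simp
    qed
    have 1: "closedin X ?A" by (rule *) (rule eqv)
    have "closedin X {z \<in> topspace X. \<not> path_component_of X x z}"
      by (rule *) (simp add: eqv)
    moreover have "{z \<in> topspace X. \<not> path_component_of X x z} = topspace X - ?A" by blast
    ultimately have "closedin X (topspace X - ?A)" by simp
    then have "openin X ?A" by (simp add: openin_closedin_eq)
    with 1 have "?A = {} \<or> ?A = topspace X"
      using assms connected_space_clopen_in by blast
    moreover have "x \<in> ?A" using x by (simp add: path_component_of_refl)
    ultimately show "path_component_of X x y" using y by blast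
  qed
qed

text \<open>The points that reach the open cell of \<open>\<phi>0\<close> by repeated radial
  projection from collars of higher cells to their boundaries. The collar is the one on which the
  end of an extended homotopy is constant along rays, so this end does not change along such a
  descent.\<close>

inductive_set cell_nbhd :: "nat \<Rightarrow> ((nat \<Rightarrow> real) \<Rightarrow> 'a) \<Rightarrow> 'a set" for n0 \<phi>0 where
  base: "t \<in> cube_interior n0 \<Longrightarrow> \<phi>0 t \<in> cell_nbhd n0 \<phi>0"
| step: "\<lbrakk>\<phi> \<in> C k; n0 < k; t \<in> cube_interior k; 3/4 < cnorm k t; \<phi> (stretch k 1 t) \<in> cell_nbhd n0 \<phi>0\<rbrakk>
    \<Longrightarrow> \<phi> t \<in> cell_nbhd n0 \<phi>0"

text \<open>Inversion of the two rules: the open cell of a point is unique, so \<open>cdim x\<close>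
  decides which rule produced it and with which data.\<close>

lemma cell_nbhd_dim:
  assumes "\<phi>0 \<in> C n0" "x \<in> cell_nbhd n0 \<phi>0"
  shows "x \<in> topspace X" "n0 \<le> cdim x" "cdim x = n0 \<Longrightarrow> x \<in> \<phi>0 ` cube_interior n0"
    "n0 < cdim x \<Longrightarrow> 3/4 < cnorm (cdim x) (cpoint x) \<and> cchar x (stretch (cdim x) 1 (cpoint x)) \<in> cell_nbhd n0 \<phi>0"
proof -
  have "x \<in> topspace X \<and> n0 \<le> cdim x \<and> (cdim x = n0 \<longrightarrow> x \<in> \<phi>0 ` cube_interior n0) \<and>
    (n0 < cdim x \<longrightarrow> 3/4 < cnorm (cdim x) (cpoint x) \<and> cchar x (stretch (cdim x) 1 (cpoint x)) \<in> cell_nbhd n0 \<phi>0)"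
    using assms(2)
  proof cases
    case (base t)
    then show ?thesis
      using cell_index_char(1)[OF assms(1)] char_in[OF assms(1)] cube_interior_subset by auto
  next
    case (step \<phi> k t)
    then show ?thesis
      using cell_index_char[OF step(2,4)] char_in[OF step(2)] cube_interior_subset by auto
  qed
  then show "x \<in> topspace X" "n0 \<le> cdim x" "cdim x = n0 \<Longrightarrow> x \<in> \<phi>0 ` cube_interior n0"
    "n0 < cdim x \<Longrightarrow> 3/4 < cnorm (cdim x) (cpoint x) \<and> cchar x (stretch (cdim x) 1 (cpoint x)) \<in> cell_nbhd n0 \<phi>0"
    by blast+
qed

text \<open>Induction on the dimension \<open>k\<close> of the testing cell. Below \<open>n0\<close>
  the preimage is empty; at \<open>n0\<close> it is the open cube or empty; above, it is the
  preimage, under the radial projection of the collar, of a subset of the boundary that is open by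
  the induction hypothesis for lower cells.\<close>

lemma openin_cell_nbhd_preimage:
  assumes \<phi>0: "\<phi>0 \<in> C n0"
  shows "\<psi> \<in> C k \<Longrightarrow> openin (cube k) {t \<in> topspace (cube k). \<psi> t \<in> cell_nbhd n0 \<phi>0}"
proof (induction k arbitrary: \<psi> rule: less_induct)
  case (less k)
  let ?U = "cell_nbhd n0 \<phi>0"
  let ?S = "{t \<in> topspace (cube k). \<psi> t \<in> ?U}"
  note dims = cell_nbhd_dim[OF \<phi>0]
  have norm_open: "openin (cube k) {t \<in> topspace (cube k). cnorm k t \<in> V}" if "open V" for V
    using that openin_continuous_map_preimage[OF cm_cnorm[OF cm_id]] by auto
  consider "k < n0" | "k = n0" | "n0 < k" by linarith
  then show ?case
  proof cases
    case 1
    then have "?S = {}" using dims(2) cdim_le[OF less.prems] by fastforce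
    then show ?thesis by (simp only: openin_empty)
  next
    case 2
    have int: "openin (cube k) (cube_interior k)"
    proof -
      have "cube_interior k = {t \<in> topspace (cube k). cnorm k t \<in> {..<1}}"
        by (auto simp: cube_interior_cnorm)
      then show ?thesis using norm_open[of "{..<1}"] by simp
    qed
    have "?S = (if \<psi> = \<phi>0 then cube_interior k else {})"
    proof -
      have a: "t \<in> cube_interior k \<and> \<psi> = \<phi>0" if t: "t \<in> ?S" for t
      proof -
        have "\<not> cdim (\<psi> t) < n0" using t dims(2) by fastforce
        then have ti: "t \<in> cube_interior k"
          using t cdim_boundary[OF less.prems] 2 by (auto simp: cube_interior_def)
        then have "cdim (\<psi> t) = n0" using cell_index_char(1)[OF less.prems] 2 by simp
        then obtain s where "s \<in> cube_interior n0" "\<psi> t = \<phi>0 s" using t dims(3) by blast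
        then show ?thesis using ti open_cells_disjoint[OF less.prems \<phi>0] by blast
      qed
      have b: "t \<in> ?S" if "t \<in> cube_interior k" "\<psi> = \<phi>0" for t
        using that 2 cube_interior_subset[of k] cell_nbhd.base[of t n0 \<phi>0] by blast
      show ?thesis
      proof (cases "\<psi> = \<phi>0")
        case True
        have "?S = cube_interior k" 
        proof (intro equalityI subsetI)
          fix t assume "t \<in> ?S"
          then show "t \<in> cube_interior k" by (rule a[THEN conjunct1])
        next
          fix t assume "t \<in> cube_interior k"
          then show "t \<in> ?S" using True by (rule b)
        qed
        then show ?thesis using True by simp
      next
        case False
        have "?S = {}" 
        proof (rule equals0I)
          fix t assume "t \<in> ?S"
          then show False using False by (metis a)
        qed
        then show ?thesis using False by simp
      qed
    qed
    then show ?thesis using int by simp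
  next
    case 3
    obtain F where F: "finite F" "F \<subseteq> Sigma {..<k} C" "\<psi> ` cube_boundary k \<subseteq> cells F"
      using boundary_in_cells[OF less.prems] by metis
    define A where "A = topspace X - ?U"
    \<comment> \<open>The induction hypothesis covers only cells of dimension below
      \<open>k\<close>; finitely many of them contain the image of the boundary, and inside their
      union the complement is closed.\<close>
    have "closedin X (A \<inter> cells F)"
    proof (rule closedin_Int_cells[OF F(1)])
      show "closedin (cube n) {t \<in> topspace (cube n). \<kappa> t \<in> A}" if "(n, \<kappa>) \<in> F" for n \<kappa>
      proof -
        have \<kappa>: "\<kappa> \<in> C n" "n < k" using that F(2) by auto
        have "closedin (cube n) (topspace (cube n) - {t \<in> topspace (cube n). \<kappa> t \<in> ?U})"
          using less.IH[OF \<kappa>(2,1)] by blast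
        moreover have "topspace (cube n) - {t \<in> topspace (cube n). \<kappa> t \<in> ?U} = {t \<in> topspace (cube n). \<kappa> t \<in> A}"
          using char_in[OF \<kappa>(1)] by (auto simp: A_def)
        ultimately show ?thesis by simp
      qed
    qed (use F(2) A_def in auto)
    moreover have c: "continuous_map (cube_bd k) X \<psi>"
      unfolding cube_bd_def by (intro continuous_map_from_subtopology cm_char less.prems)
    ultimately have "closedin (cube_bd k) {t \<in> topspace (cube_bd k). \<psi> t \<in> A \<inter> cells F}"
      by (rule closedin_continuous_map_preimage[rotated])
    then have "openin (cube_bd k) (topspace (cube_bd k) - {t \<in> topspace (cube_bd k). \<psi> t \<in> A \<inter> cells F})" by blast
    moreover have "topspace (cube_bd k) - {t \<in> topspace (cube_bd k). \<psi> t \<in> A \<inter> cells F} = {t \<in> cube_boundary k. \<psi> t \<in> ?U}"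
      using F(3) char_in[OF less.prems] cube_boundary_subset[of k] by (auto simp: A_def)
    ultimately have bd: "openin (cube_bd k) {t \<in> cube_boundary k. \<psi> t \<in> ?U}" by simp
    let ?N = "{t \<in> topspace (cube k). cnorm k t \<in> {3/4<..}}"
    have cs: "continuous_map (subtopology (cube k) ?N) (cube_bd k) (stretch k 1)"
      unfolding cube_bd_def
    proof (rule cm_subt)
      show "continuous_map (subtopology (cube k) ?N) (cube k) (stretch k 1)"
        by (rule cm_stretch[OF cm_id_subt]) auto
      show "stretch k 1 z \<in> cube_boundary k" if "z \<in> topspace (subtopology (cube k) ?N)" for z
        using that by (intro stretch_boundary) auto
    qed
    have "openin (subtopology (cube k) ?N) {t \<in> topspace (subtopology (cube k) ?N). stretch k 1 t \<in> {t \<in> cube_boundary k. \<psi> t \<in> ?U}}"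
      by (rule openin_continuous_map_preimage[OF cs bd])
    then have "openin (cube k) {t \<in> topspace (subtopology (cube k) ?N). stretch k 1 t \<in> {t \<in> cube_boundary k. \<psi> t \<in> ?U}}"
      by (rule openin_trans_full) (rule norm_open, simp)
    moreover have "{t \<in> topspace (subtopology (cube k) ?N). stretch k 1 t \<in> {t \<in> cube_boundary k. \<psi> t \<in> ?U}} = ?S" (is "?L = ?S")
    proof (intro equalityI subsetI)
      fix t assume t: "t \<in> ?L"
      show "t \<in> ?S"
      proof (cases "t \<in> cube_boundary k")
        case True
        then show ?thesis using t by (auto simp: stretch_on_boundary)
      next
        case False
        then have "t \<in> cube_interior k" using t by (auto simp: cube_interior_def)
        then show ?thesis using t cell_nbhd.step[OF less.prems 3] by auto
      qed
    next
      fix t assume t: "t \<in> ?S"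
      show "t \<in> ?L"
      proof (cases "t \<in> cube_boundary k")
        case True
        then show ?thesis using t by (auto simp: stretch_on_boundary cube_boundary_cnorm)
      next
        case False
        then have ti: "t \<in> cube_interior k" using t by (auto simp: cube_interior_def)
        have "3/4 < cnorm k t \<and> \<psi> (stretch k 1 t) \<in> ?U"
          using dims(4)[of "\<psi> t"] t 3 cell_index_char[OF less.prems ti] by simp
        then show ?thesis using t by (auto intro: stretch_boundary)
      qed
    qed
    ultimately show ?thesis by simp
  qed
qed

lemma openin_cell_nbhd:
  assumes \<phi>0: "\<phi>0 \<in> C n0"
  shows "openin X (cell_nbhd n0 \<phi>0)"
proof -
  have sub: "cell_nbhd n0 \<phi>0 \<subseteq> topspace X" using cell_nbhd_dim(1)[OF \<phi>0] by blast
  have "closedin X (topspace X - cell_nbhd n0 \<phi>0)"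
  proof (subst closedin_iff_cells, blast, intro allI ballI)
    fix n \<phi> assume \<phi>: "\<phi> \<in> C n"
    have "closedin (cube n) (topspace (cube n) - {t \<in> topspace (cube n). \<phi> t \<in> cell_nbhd n0 \<phi>0})"
      using openin_cell_nbhd_preimage[OF \<phi>0 \<phi>] by blast
    moreover have "topspace (cube n) - {t \<in> topspace (cube n). \<phi> t \<in> cell_nbhd n0 \<phi>0}
        = {t \<in> topspace (cube n). \<phi> t \<in> topspace X - cell_nbhd n0 \<phi>0}"
      using char_in[OF \<phi>] by auto
    ultimately show "closedin (cube n) {t \<in> topspace (cube n). \<phi> t \<in> topspace X - cell_nbhd n0 \<phi>0}" by simp
  qed
  then show ?thesis using sub by (simp add: openin_closedin_eq)
qed

text \<open>The end of the homotopy is locally compact-valued; composing with it turns a map that is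
  continuous on each closed cell times a factor into one that is continuous for the product
  topology.\<close>

lemma cell_compression:
  obtains H where "continuous_map (prod_topology unit_interval X) X H"
    and "\<And>x. x \<in> topspace X \<Longrightarrow> H (0, x) = x"
    and "\<And>r x. x \<in> topspace X \<Longrightarrow> cdim x = 0 \<Longrightarrow> H (r, x) = x"
    and "\<And>x. x \<in> topspace X \<Longrightarrow> \<exists>U F. openin X U \<and> x \<in> U \<and> finite F \<and> F \<subseteq> Sigma UNIV C \<and> (\<lambda>x. H (1, x)) ` U \<subseteq> cells F"
proof -
  \<comment> \<open>\<open>\<eta> t r\<close> is the position at time \<open>r\<close> of the point
    \<open>t\<close> of the cell. The collar clause makes the end position invariant under the
    descent that defines \<open>cell_nbhd\<close>; the last clause keeps the whole track of a closed
    cell within finitely many closed cells.\<close>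
  define Good where "Good n \<phi> \<eta> \<longleftrightarrow>
      continuous_map (prod_topology unit_interval (cube n)) X (\<lambda>z. \<eta> (snd z) (fst z)) \<and>
      (\<forall>t\<in>topspace (cube n). \<eta> t 0 = \<phi> t) \<and>
      (n = 0 \<longrightarrow> (\<forall>t\<in>topspace (cube n). \<forall>r. \<eta> t r = \<phi> t)) \<and>
      (\<forall>t\<in>topspace (cube n). 3/4 \<le> cnorm n t \<longrightarrow> \<eta> t 1 = \<eta> (stretch n 1 t) 1) \<and>
      (\<exists>F. finite F \<and> F \<subseteq> Sigma UNIV C \<and> (\<forall>t\<in>topspace (cube n). \<forall>r\<in>{0..1}. \<eta> t r \<in> cells F))"
    for n :: nat and \<phi> :: "(nat \<Rightarrow> real) \<Rightarrow> 'a" and \<eta> :: "(nat \<Rightarrow> real) \<Rightarrow> real \<Rightarrow> 'a"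
  obtain \<xi> :: "'a \<Rightarrow> real \<Rightarrow> 'a" where \<xi>: "\<And>n \<phi>. \<phi> \<in> C n \<Longrightarrow> Good n \<phi> (\<xi> \<circ> \<phi>)"
  proof (rule skeleton_recursion[of Good])
    fix n \<phi> and \<eta> \<eta>' :: "(nat \<Rightarrow> real) \<Rightarrow> real \<Rightarrow> 'a"
    assume eq: "\<And>t. t \<in> topspace (cube n) \<Longrightarrow> \<eta> t = \<eta>' t" and "Good n \<phi> \<eta>"
    moreover from this have "continuous_map (prod_topology unit_interval (cube n)) X (\<lambda>z. \<eta>' (snd z) (fst z))"
      unfolding Good_def by (elim conjE) (erule continuous_map_eq, auto simp: eq)
    ultimately show "Good n \<phi> \<eta>'"
      unfolding Good_def using stretch_in_cube[of 1 n] by simp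
  next
    fix n \<phi> and \<xi> :: "'a \<Rightarrow> real \<Rightarrow> 'a"
    assume \<phi>: "\<phi> \<in> C n" and IH: "\<And>i \<psi>. i < n \<Longrightarrow> \<psi> \<in> C i \<Longrightarrow> Good i \<psi> (\<xi> \<circ> \<psi>)"
    \<comment> \<open>A one-point parameter space, as the homotopy extension here involves no
      parameter.\<close>
    let ?L = "discrete_topology {()}"
    show "\<exists>\<eta>. (\<forall>t\<in>cube_boundary n. \<eta> t = \<xi> (\<phi> t)) \<and> Good n \<phi> \<eta>"
    proof (cases "n = 0")
      case True
      have "\<exists>F. finite F \<and> F \<subseteq> Sigma UNIV C \<and> (\<forall>t\<in>topspace (cube n). \<forall>r\<in>{0..1::real}. \<phi> t \<in> cells F)"
        using \<phi> by (intro exI[of _ "{(n, \<phi>)}"]) (auto simp: cells_def)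
      then have "Good n \<phi> (\<lambda>t r. \<phi> t)"
        unfolding Good_def using True
        by (auto simp: stretch_def dilate_def topspace_cube_0 intro!: cm_comp[OF cm_char[OF \<phi>]] cm_snd cm_id)
      then show ?thesis using True by (auto simp: cube_boundary_0)
    next
      case False
      have c: "continuous_map (prod_topology (cube_bd n) unit_interval) X (\<lambda>z. (\<lambda>p. \<xi> (fst p) (snd p)) (\<phi> (fst z), snd z))"
      proof (rule continuous_on_cell_boundary[OF \<phi>])
        fix i \<psi> assume i: "i < n" "\<psi> \<in> C i"
        have "continuous_map (prod_topology unit_interval (cube i)) X (\<lambda>z. (\<xi> \<circ> \<psi>) (snd z) (fst z))"
          using IH[OF i] by (simp add: Good_def)
        from cm_comp[OF this, of "prod_topology (cube i) unit_interval" "\<lambda>z. (snd z, fst z)"]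
        show "continuous_map (prod_topology (cube i) unit_interval) X (\<lambda>z. \<xi> (fst (\<psi> (fst z), snd z)) (snd (\<psi> (fst z), snd z)))"
          by (simp add: o_def cm_pair cm_fst cm_snd cm_id continuous_map_fst continuous_map_snd)
      qed
      obtain F where F: "continuous_map (prod_topology unit_interval (prod_topology (cube n) ?L)) X F"
        "\<And>t l. t \<in> topspace (cube n) \<Longrightarrow> F (0, t, l) = (\<lambda>p. \<phi> (fst p)) (t, l)"
        "\<And>s t l. \<lbrakk>0 \<le> s; s \<le> 1; t \<in> cube_boundary n; l \<in> topspace ?L\<rbrakk> \<Longrightarrow> F (s, t, l) = (\<lambda>p. \<xi> (\<phi> (fst (snd p))) (fst p)) (s, t, l)"
        "\<And>t l. 3/4 \<le> cnorm n t \<Longrightarrow> F (1, t, l) = (\<lambda>p. \<xi> (\<phi> (fst (snd p))) (fst p)) (1, stretch n 1 t, l)"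
        "\<And>s t l. \<lbrakk>0 \<le> s; s \<le> 1\<rbrakk> \<Longrightarrow> F (s, t, l) \<in> (\<lambda>p. \<phi> (fst p)) ` (topspace (cube n) \<times> {l}) \<union>
           (\<lambda>p. \<xi> (\<phi> (fst (snd p))) (fst p)) ` ({0..1} \<times> cube_boundary n \<times> {l})"
      proof (rule cube_homotopy_extension[of n ?L X "\<lambda>p. \<phi> (fst p)" "\<lambda>p. \<xi> (\<phi> (fst (snd p))) (fst p)"])
        show "continuous_map (prod_topology (cube n) ?L) X (\<lambda>p. \<phi> (fst p))"
          by (rule cm_comp[OF cm_char[OF \<phi>]], (rule cmi)+)
        have "continuous_map (prod_topology unit_interval (prod_topology (cube_bd n) ?L))
            (prod_topology (cube_bd n) unit_interval) (\<lambda>p. (fst (snd p), fst p))"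
          by (rule cmi)+
        from cm_comp[OF c this]
        show "continuous_map (prod_topology unit_interval (prod_topology (cube_bd n) ?L)) X (\<lambda>p. \<xi> (\<phi> (fst (snd p))) (fst p))"
          by simp
        show "\<xi> (\<phi> (fst (snd (0, t, l)))) (fst (0, t, l)) = \<phi> (fst (t, l))" if "t \<in> cube_boundary n" for t and l :: unit
        proof -
          have x: "\<phi> t \<in> topspace X" using that char_in[OF \<phi>] cube_boundary_subset by blast
          have "Good (cdim (\<phi> t)) (cchar (\<phi> t)) (\<xi> \<circ> cchar (\<phi> t))"
            by (intro IH cdim_boundary[OF \<phi> that] cell_index x)
          then show ?thesis
            using cell_index(2,3)[OF x] cube_interior_subset unfolding Good_def by fastforce
        qed
      qed blast
      \<comment> \<open>The recursion demands equality with the old values as functions of all real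
        \<open>r\<close>, whereas \<open>F\<close> is controlled for times in the unit interval
        only; hence the old function is reused on the boundary.\<close>
      define \<eta> where "\<eta> t = (if t \<in> cube_boundary n then \<xi> (\<phi> t) else (\<lambda>r. F (r, t, ())))" for t
      have \<eta>F: "\<eta> t r = F (r, t, ())" if "0 \<le> r" "r \<le> 1" for t r
        using F(3)[of r t "()"] that by (simp add: \<eta>_def)
      have fin: "\<exists>F. finite F \<and> F \<subseteq> Sigma UNIV C \<and> (\<forall>t\<in>topspace (cube n). \<forall>r\<in>{0..1}. \<eta> t r \<in> cells F)"
      proof -
        \<comment> \<open>The extended homotopy takes its values in the closed cell itself and in
          the tracks of the boundary. The latter are contained in the finite sets already attached
          to the finitely many lower cells that the boundary meets.\<close>
        obtain G where G: "finite G" "G \<subseteq> Sigma {..<n} C" "\<phi> ` cube_boundary n \<subseteq> cells G"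
          using boundary_in_cells[OF \<phi>] by metis
        have "\<forall>p\<in>G. \<exists>F. finite F \<and> F \<subseteq> Sigma UNIV C \<and>
            (\<forall>t\<in>topspace (cube (fst p)). \<forall>r\<in>{0..1}. \<xi> (snd p t) r \<in> cells F)"
        proof
          fix p assume "p \<in> G"
          then have "Good (fst p) (snd p) (\<xi> \<circ> snd p)" using G(2) IH by auto
          then show "\<exists>F. finite F \<and> F \<subseteq> Sigma UNIV C \<and>
              (\<forall>t\<in>topspace (cube (fst p)). \<forall>r\<in>{0..1}. \<xi> (snd p t) r \<in> cells F)"
            by (simp add: Good_def)
        qed
        then obtain E where E: "\<And>p. p \<in> G \<Longrightarrow> finite (E p) \<and> E p \<subseteq> Sigma UNIV C \<and>
            (\<forall>t\<in>topspace (cube (fst p)). \<forall>r\<in>{0..1}. \<xi> (snd p t) r \<in> cells (E p))"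
          by metis
        let ?F = "insert (n, \<phi>) (\<Union>p\<in>G. E p)"
        have "\<eta> t r \<in> cells ?F" if "t \<in> topspace (cube n)" "r \<in> {0..1}" for t r
        proof -
          have "\<eta> t r \<in> \<phi> ` topspace (cube n) \<or> (\<exists>r'\<in>{0..1}. \<exists>t'\<in>cube_boundary n. \<eta> t r = \<xi> (\<phi> t') r')"
            using F(5)[of r t "()"] that \<eta>F[of r t] by (auto; metis atLeastAtMost_iff)
          then show ?thesis
          proof (elim disjE bexE)
            fix r' t' assume r': "r' \<in> {0..1}" and "t' \<in> cube_boundary n" and eq: "\<eta> t r = \<xi> (\<phi> t') r'"
            then have "\<phi> t' \<in> cells G" using G(3) by blast
            then obtain p s where "p \<in> G" "s \<in> topspace (cube (fst p))" "\<phi> t' = snd p s"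
              by (auto simp: cells_def)
            then have "\<eta> t r \<in> cells (E p)" using E r' eq by simp
            moreover have "cells (E p) \<subseteq> cells ?F"
              unfolding cells_def using \<open>p \<in> G\<close> by (intro UN_mono) auto
            ultimately show ?thesis by (rule rev_subsetD)
          qed (auto simp: cells_def)
        qed
        moreover have "finite ?F" "?F \<subseteq> Sigma UNIV C" using G(1) E \<phi> by auto
        ultimately show ?thesis by blast
      qed
      have "Good n \<phi> \<eta>"
        unfolding Good_def
      proof (intro conjI ballI impI)
        have "continuous_map (prod_topology unit_interval (cube n)) X (\<lambda>z. F (fst z, snd z, ()))"
          by (rule cm_comp[OF F(1)]) (intro cm_pair continuous_map_fst continuous_map_snd, simp)
        then show "continuous_map (prod_topology unit_interval (cube n)) X (\<lambda>z. \<eta> (snd z) (fst z))"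
          by (rule continuous_map_eq) (auto simp: \<eta>F)
        show "\<eta> t 1 = \<eta> (stretch n 1 t) 1" if "3/4 \<le> cnorm n t" for t
          using F(4)[OF that, of "()"] that stretch_boundary[of 1 n t] by (simp add: \<eta>F) (simp add: \<eta>_def flip: \<eta>F)
      qed (use False F(2) \<eta>F fin in auto)
      then show ?thesis by (intro exI[of _ \<eta>]) (simp add: \<eta>_def)
    qed
  qed (rule that)
  define H where "H z = \<xi> (snd z) (fst z)" for z
  have at_cell: "Good (cdim x) (cchar x) (\<xi> \<circ> cchar x)" "cpoint x \<in> topspace (cube (cdim x))" "cchar x (cpoint x) = x"
    if "x \<in> topspace X" for x
    using \<xi> cell_index[OF that] cube_interior_subset by blast+
  show ?thesis
  proof (rule that)
    show "continuous_map (prod_topology unit_interval X) X H"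
      by (rule continuous_homotopy) (use \<xi> in \<open>simp add: Good_def H_def\<close>)
    show "H (0, x) = x" if "x \<in> topspace X" for x
      using at_cell[OF that] unfolding Good_def H_def by fastforce
    show "H (r, x) = x" if "x \<in> topspace X" "cdim x = 0" for x r
      using at_cell[OF that(1)] that(2) unfolding Good_def H_def by fastforce
    fix x assume x: "x \<in> topspace X"
    define n0 \<phi>0 where "n0 = cdim x" and "\<phi>0 = cchar x"
    have \<phi>0: "\<phi>0 \<in> C n0" using cell_index[OF x] by (simp add: n0_def \<phi>0_def)
    have "x \<in> cell_nbhd n0 \<phi>0"
      using cell_nbhd.base[of "cpoint x" n0 \<phi>0] cell_index[OF x] by (simp add: n0_def \<phi>0_def)
    \<comment> \<open>Each projection step of the descent leaves the end position unchanged, so the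
      whole neighbourhood is carried to where the single closed cell of \<open>\<phi>0\<close>
      goes.\<close>
    moreover have img: "H (1, y) \<in> (\<lambda>t. H (1, \<phi>0 t)) ` topspace (cube n0)" if "y \<in> cell_nbhd n0 \<phi>0" for y
      using that
    proof induction
      case (base t)
      then show ?case using cube_interior_subset by blast
    next
      case (step \<phi> k t)
      have "t \<in> topspace (cube k)" using step cube_interior_subset by blast
      then have "H (1, \<phi> t) = H (1, \<phi> (stretch k 1 t))"
        using \<xi>[OF step(1)] step(4) by (simp add: Good_def H_def)
      then show ?case using step by simp
    qed
    moreover have "\<exists>F. finite F \<and> F \<subseteq> Sigma UNIV C \<and> (\<lambda>t. H (1, \<phi>0 t)) ` topspace (cube n0) \<subseteq> cells F"
      using \<xi>[OF \<phi>0] by (fastforce simp: Good_def H_def)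
    ultimately show "\<exists>U F. openin X U \<and> x \<in> U \<and> finite F \<and> F \<subseteq> Sigma UNIV C \<and> (\<lambda>x. H (1, x)) ` U \<subseteq> cells F"
      using openin_cell_nbhd[OF \<phi>0] by (meson image_subsetI subsetD)
  qed
qed

end

section \<open>Lifting maps out of a CW-complex times a space\<close>

text \<open>
  The clamping \<open>max 0 (min 1 (3 * r - 1))\<close> leaves room before and after the given homotopy, so that
  homotopies may simply be concatenated to it.
\<close>

definition cell_lifting ::
    "nat \<Rightarrow> 'w topology \<Rightarrow> 'z topology \<Rightarrow> 'l topology \<Rightarrow>
     ((nat \<Rightarrow> real) \<times> 'w \<Rightarrow> 'z) \<Rightarrow> ((nat \<Rightarrow> real) \<times> 'l \<Rightarrow> 'z) \<Rightarrow> bool" where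
  "cell_lifting n W Z L \<gamma> u \<longleftrightarrow>
     (\<forall>v H. continuous_map (prod_topology (cube_bd n) L) W v \<longrightarrow>
        continuous_map (prod_topology unit_interval (prod_topology (cube_bd n) L)) Z H \<longrightarrow>
        (\<forall>t\<in>cube_boundary n. \<forall>l\<in>topspace L. H (0, t, l) = \<gamma> (t, v (t, l)) \<and> H (1, t, l) = u (t, l)) \<longrightarrow>
        (\<exists>v' E. continuous_map (prod_topology (cube n) L) W v' \<and>
           continuous_map (prod_topology unit_interval (prod_topology (cube n) L)) Z E \<and>
           (\<forall>t\<in>topspace (cube n). \<forall>l\<in>topspace L. E (0, t, l) = \<gamma> (t, v' (t, l)) \<and> E (1, t, l) = u (t, l)) \<and>
           (\<forall>t\<in>cube_boundary n. \<forall>l\<in>topspace L. v' (t, l) = v (t, l) \<and>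
              (\<forall>r\<in>{0..1}. E (r, t, l) = H (max 0 (min 1 (3 * r - 1)), t, l)))))"

lemma homotopic_with_pointI:
  assumes "x0 \<in> topspace X"
    and "continuous_map (prod_topology unit_interval X) Y h"
    and "\<And>x. x \<in> topspace X \<Longrightarrow> h (0, x) = p x"
    and "\<And>x. x \<in> topspace X \<Longrightarrow> h (1, x) = q x"
    and "\<And>t. 0 \<le> t \<Longrightarrow> t \<le> 1 \<Longrightarrow> h (t, x0) = y0"
  shows "homotopic_with (\<lambda>h. h x0 = y0) X Y p q"
  by (rule homotopic_withI[where h = h]) (use assms in simp_all)

lemma cm_local:
  assumes "\<And>x. x \<in> topspace X \<Longrightarrow> \<exists>U. openin X U \<and> x \<in> U \<and> continuous_map (subtopology X U) Y f"
  shows "continuous_map X Y f"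
proof -
  let ?I = "{U. openin X U \<and> continuous_map (subtopology X U) Y f}"
  show ?thesis
  proof (rule pasting_lemma[where I = ?I and T = "\<lambda>U. U" and f = "\<lambda>U. f"])
    show "\<exists>j. j \<in> ?I \<and> x \<in> j \<and> f x = f x" if "x \<in> topspace X" for x
      using assms[OF that] by blast
  qed auto
qed

text \<open>\<open>\<rho>\<close> climbs from 0 to 1/3 on [b, a], to 2/3 on [a, 1 - a], and to 1 on
  [1 - a, 1 - b]. Its middle third is thus the affine parametrization of the window [a, 1 - a], so a
  homotopy that replays given data in its middle third can be matched with one that is constant
  outside this window, with constant stretches of length \<open>b\<close> left over.\<close>

lemma window_reparametrization:
  fixes a b :: real
  assumes "0 < b" "b < a" "a < 1/2"
  obtains \<rho> where "continuous_on UNIV \<rho>" "\<And>r. 0 \<le> \<rho> r \<and> \<rho> r \<le> 1"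
    "\<And>r. r \<le> b \<Longrightarrow> \<rho> r = 0" "\<And>r. 1 - b \<le> r \<Longrightarrow> \<rho> r = 1"
    "\<And>r. max 0 (min 1 (3 * \<rho> r - 1)) = max 0 (min 1 ((r - a) / (1 - 2 * a)))"
proof -
  define c where "c r = max 0 (min 1 r)" for r :: real
  define \<rho> where "\<rho> r = (c ((r - b) / (a - b)) + c ((r - a) / (1 - 2 * a)) + c ((r - (1 - a)) / (a - b))) / 3" for r
  have pos: "0 < a - b" "0 < 1 - 2 * a" using assms by auto
  have c01: "0 \<le> c r" "c r \<le> 1" for r by (auto simp: c_def)
  have c0: "c (x / y) = 0" if "x \<le> 0" "0 < y" for x y
    using divide_nonpos_pos[OF that] by (simp add: c_def)
  have c1: "c (x / y) = 1" if "y \<le> x" "0 < y" for x y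
    using that by (auto simp: c_def max_def min_def field_simps)
  show ?thesis
  proof
    show "continuous_on UNIV \<rho>"
      unfolding \<rho>_def c_def using pos by (intro continuous_intros) auto
    show "0 \<le> \<rho> r \<and> \<rho> r \<le> 1" for r
      using c01[of "(r - b) / (a - b)"] c01[of "(r - a) / (1 - 2 * a)"] c01[of "(r - (1 - a)) / (a - b)"]
      by (auto simp: \<rho>_def)
    show "\<rho> r = 0" if "r \<le> b" for r
      using that assms pos by (simp add: \<rho>_def c0)
    show "\<rho> r = 1" if "1 - b \<le> r" for r
      using that assms pos by (simp add: \<rho>_def c1)
    show "max 0 (min 1 (3 * \<rho> r - 1)) = max 0 (min 1 ((r - a) / (1 - 2 * a)))" for r
    proof -
      consider "r \<le> a" | "a \<le> r" "r \<le> 1 - a" | "1 - a \<le> r" by linarith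
      then have "c (3 * \<rho> r - 1) = c ((r - a) / (1 - 2 * a))"
      proof cases
        case 1
        then have "3 * \<rho> r = c ((r - b) / (a - b))" using assms pos by (simp add: \<rho>_def c0)
        then have "3 * \<rho> r - 1 \<le> 0" using c01(2)[of "(r - b) / (a - b)"] by linarith
        then have "c (3 * \<rho> r - 1) = 0" by (simp add: c_def)
        then show ?thesis using 1 pos by (simp add: c0)
      next
        case 2
        then have "3 * \<rho> r = 1 + c ((r - a) / (1 - 2 * a))" using pos by (simp add: \<rho>_def c0 c1)
        then show ?thesis using c01 by (simp add: c_def)
      next
        case 3
        then have "3 * \<rho> r = 2 + c ((r - (1 - a)) / (a - b))" using assms pos by (simp add: \<rho>_def c1)
        then have "1 \<le> 3 * \<rho> r - 1" using c01(1)[of "(r - (1 - a)) / (a - b)"] by linarith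
        then have "c (3 * \<rho> r - 1) = 1" by (simp add: c_def)
        then show ?thesis using 3 pos by (simp add: c1)
      qed
      then show ?thesis by (simp add: c_def)
    qed
  qed
qed

context cw_complex
begin

text \<open>Near any point of \<open>X\<close> the compressed argument stays in finitely many closed
  cells, where continuity on each cell times \<open>L\<close> suffices. Continuity being local, no
  condition on \<open>L\<close> arises.\<close>

lemma compressed_continuous:
  assumes H: "continuous_map (prod_topology unit_interval X) X H"
    and loc: "\<And>x. x \<in> topspace X \<Longrightarrow> \<exists>U F. openin X U \<and> x \<in> U \<and> finite F \<and> F \<subseteq> Sigma UNIV C \<and> (\<lambda>x. H (1, x)) ` U \<subseteq> cells F"
    and v: "\<And>n \<phi>. \<phi> \<in> C n \<Longrightarrow> continuous_map (prod_topology (cube n) L) W (\<lambda>z. v (\<phi> (fst z), snd z))"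
  shows "continuous_map (prod_topology X L) W (\<lambda>p. v (H (1, fst p), snd p))"
proof (rule cm_local)
  fix p assume p: "p \<in> topspace (prod_topology X L)"
  then obtain U F where U: "openin X U" "fst p \<in> U" "finite F" "F \<subseteq> Sigma UNIV C" "(\<lambda>x. H (1, x)) ` U \<subseteq> cells F"
    using loc[of "fst p"] by auto
  have c: "continuous_map (prod_topology (subtopology X (cells F)) L) W v"
    by (rule continuous_on_cells[OF U(3,4)]) (use U(4) v in auto)
  let ?T = "prod_topology (subtopology X U) L"
  have 1: "continuous_map ?T (subtopology X (cells F)) (\<lambda>p. H (1, fst p))"
  proof (rule cm_subt)
    have "continuous_map ?T X fst"
      using continuous_map_into_fulltopology[OF continuous_map_fst] by blast
    then show "continuous_map ?T X (\<lambda>p. H (1, fst p))"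
      by (intro cm_comp[OF H] cm_pair) auto
    show "H (1, fst z) \<in> cells F" if "z \<in> topspace ?T" for z
      using that U(5) by auto
  qed
  have "continuous_map ?T W (\<lambda>p. v (H (1, fst p), snd p))"
    by (rule cm_comp[OF c cm_pair[OF 1 continuous_map_snd]])
  moreover have "?T = subtopology (prod_topology X L) (U \<times> topspace L)"
    by (simp add: prod_topology_subtopology)
  moreover have "openin (prod_topology X L) (U \<times> topspace L)"
    using U(1) by (simp add: openin_prod_Times_iff)
  ultimately show "\<exists>V. openin (prod_topology X L) V \<and> p \<in> V \<and>
      continuous_map (subtopology (prod_topology X L) V) W (\<lambda>p. v (H (1, fst p), snd p))"
    using U(2) p by (intro exI[of _ "U \<times> topspace L"]) auto
qed

text \<open>\<open>lift\<close> provides, over one cell, a partial solution together with its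
  homotopy to \<open>u\<close>, extending those on the boundary. The recursion glues them to
  functions that are continuous on each cell times \<open>L\<close>; evaluating these at compressed
  points yields continuity on the product.\<close>

theorem lifting:
  fixes \<gamma> :: "'a \<times> 'w \<Rightarrow> 'z" and u :: "'a \<times> 'l \<Rightarrow> 'z"
  assumes \<gamma>: "continuous_map (prod_topology X W) Z \<gamma>" and u: "continuous_map (prod_topology X L) Z u"
    and lift: "\<And>n \<phi>. \<phi> \<in> C n \<Longrightarrow>
      cell_lifting n W Z L (\<lambda>z. \<gamma> (\<phi> (fst z), snd z)) (\<lambda>z. u (\<phi> (fst z), snd z))"
    and x0: "x0 \<in> topspace X" "cdim x0 = 0" and l0: "l0 \<in> topspace L"
    and v0: "continuous_map L W v0"
    and H0: "continuous_map (prod_topology unit_interval L) Z H0"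
      "\<And>l. l \<in> topspace L \<Longrightarrow> H0 (0, l) = \<gamma> (x0, v0 l)"
      "\<And>l. l \<in> topspace L \<Longrightarrow> H0 (1, l) = u (x0, l)"
      "\<And>r. 0 \<le> r \<Longrightarrow> r \<le> 1 \<Longrightarrow> H0 (r, l0) = z0"
  obtains v where "continuous_map (prod_topology X L) W v"
    "\<And>l. l \<in> topspace L \<Longrightarrow> v (x0, l) = v0 l"
    "homotopic_with (\<lambda>h. h (x0, l0) = z0) (prod_topology X L) Z (\<lambda>p. \<gamma> (fst p, v p)) u"
proof -
  \<comment> \<open>The time during which homotopies over n-cells rest at either end. It strictly
    decreases with \<open>n\<close>, so the boundary of a cell rests longer than the cell itself has
    to; \<open>a 0 = 1/4\<close> leaves half of the interval for the motion over
    \<open>x0\<close>.\<close>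
  define a where "a n = 1 / (real n + 4)" for n
  have a: "0 < a n" "a n \<le> 1/4" for n by (auto simp: a_def field_simps)
  \<comment> \<open>\<open>\<eta> t l\<close> pairs the value of the lift with the track of the
    homotopy. The last clause keeps the prescribed data over \<open>x0\<close> and makes the final
    homotopy constant at the base point.\<close>
  define Good where "Good n \<phi> \<eta> \<longleftrightarrow>
      continuous_map (prod_topology (cube n) L) W (\<lambda>z. fst (\<eta> (fst z) (snd z))) \<and>
      continuous_map (prod_topology unit_interval (prod_topology (cube n) L)) Z
        (\<lambda>z. snd (\<eta> (fst (snd z)) (snd (snd z))) (fst z)) \<and>
      (\<forall>t\<in>topspace (cube n). \<forall>l\<in>topspace L.
         (\<forall>r. 0 \<le> r \<and> r \<le> a n \<longrightarrow> snd (\<eta> t l) r = \<gamma> (\<phi> t, fst (\<eta> t l))) \<and>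
         (\<forall>r. 1 - a n \<le> r \<and> r \<le> 1 \<longrightarrow> snd (\<eta> t l) r = u (\<phi> t, l))) \<and>
      (\<forall>t\<in>topspace (cube n). \<phi> t = x0 \<longrightarrow>
         (\<forall>l\<in>topspace L. fst (\<eta> t l) = v0 l) \<and> (\<forall>r\<in>{0..1}. snd (\<eta> t l0) r = z0))"
    for n :: nat and \<phi> :: "(nat \<Rightarrow> real) \<Rightarrow> 'a" and \<eta> :: "(nat \<Rightarrow> real) \<Rightarrow> 'l \<Rightarrow> 'w \<times> (real \<Rightarrow> 'z)"
  obtain \<xi> :: "'a \<Rightarrow> 'l \<Rightarrow> 'w \<times> (real \<Rightarrow> 'z)" where \<xi>: "\<And>n \<phi>. \<phi> \<in> C n \<Longrightarrow> Good n \<phi> (\<xi> \<circ> \<phi>)"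
  proof (rule skeleton_recursion[of Good])
    fix n \<phi> and \<eta> \<eta>' :: "(nat \<Rightarrow> real) \<Rightarrow> 'l \<Rightarrow> 'w \<times> (real \<Rightarrow> 'z)"
    assume eq: "\<And>t. t \<in> topspace (cube n) \<Longrightarrow> \<eta> t = \<eta>' t" and good: "Good n \<phi> \<eta>"
    have "continuous_map (prod_topology (cube n) L) W (\<lambda>z. fst (\<eta>' (fst z) (snd z)))"
      using good[unfolded Good_def, THEN conjunct1] by (rule continuous_map_eq) (auto simp: eq)
    moreover have "continuous_map (prod_topology unit_interval (prod_topology (cube n) L)) Z
        (\<lambda>z. snd (\<eta>' (fst (snd z)) (snd (snd z))) (fst z))"
      using good[unfolded Good_def, THEN conjunct2, THEN conjunct1] by (rule continuous_map_eq) (auto simp: eq)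
    ultimately show "Good n \<phi> \<eta>'"
      using good unfolding Good_def by (simp add: eq)
  next
    fix n \<phi> and \<xi> :: "'a \<Rightarrow> 'l \<Rightarrow> 'w \<times> (real \<Rightarrow> 'z)"
    assume \<phi>: "\<phi> \<in> C n" and IH: "\<And>i \<psi>. i < n \<Longrightarrow> \<psi> \<in> C i \<Longrightarrow> Good i \<psi> (\<xi> \<circ> \<psi>)"
    show "\<exists>\<eta>. (\<forall>t\<in>cube_boundary n. \<eta> t = \<xi> (\<phi> t)) \<and> Good n \<phi> \<eta>"
    proof (cases "n = 0 \<and> \<phi> (\<lambda>_. undefined) = x0")
      case True
      then have \<phi>x: "\<phi> t = x0" if "t \<in> topspace (cube n)" for t using that by (simp add: topspace_cube_0)
      \<comment> \<open>The affine map carries [1/4, 3/4] onto the unit interval, so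
        \<open>H0\<close> rests during the required times of length \<open>a n\<close>, at most
        1/4.\<close>
      define \<eta> where "\<eta> t l = (v0 l, \<lambda>r. H0 (max 0 (min 1 (2 * r - 1/2)), l))" for t :: "nat \<Rightarrow> real" and l
      have "Good n \<phi> \<eta>"
        unfolding Good_def
      proof (intro conjI ballI impI)
        show "continuous_map (prod_topology (cube n) L) W (\<lambda>z. fst (\<eta> (fst z) (snd z)))"
          by (simp add: \<eta>_def) (rule cm_comp[OF v0 continuous_map_snd])
        have "continuous_map (prod_topology unit_interval (prod_topology (cube n) L)) unit_interval (\<lambda>z. max 0 (min 1 (2 * fst z - 1/2)))"
          by (intro cm_unit continuous_intros cm_real[OF continuous_map_fst]) auto
        moreover have "continuous_map (prod_topology unit_interval (prod_topology (cube n) L)) L (\<lambda>z. snd (snd z))"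
          by (rule cmi)+
        ultimately show "continuous_map (prod_topology unit_interval (prod_topology (cube n) L)) Z
          (\<lambda>z. snd (\<eta> (fst (snd z)) (snd (snd z))) (fst z))"
          unfolding \<eta>_def snd_conv by (intro cm_comp[OF H0(1)] cm_pair)
        fix t l assume t: "t \<in> topspace (cube n)" and l: "l \<in> topspace L"
        show "\<forall>r. 0 \<le> r \<and> r \<le> a n \<longrightarrow> snd (\<eta> t l) r = \<gamma> (\<phi> t, fst (\<eta> t l))"
        proof (intro allI impI)
          fix r assume "0 \<le> r \<and> r \<le> a n"
          then have "max 0 (min 1 (2 * r - 1/2)) = 0" using a[of n] by simp
          then show "snd (\<eta> t l) r = \<gamma> (\<phi> t, fst (\<eta> t l))" using t l by (simp add: \<eta>_def H0 \<phi>x)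
        qed
        show "\<forall>r. 1 - a n \<le> r \<and> r \<le> 1 \<longrightarrow> snd (\<eta> t l) r = u (\<phi> t, l)"
        proof (intro allI impI)
          fix r assume "1 - a n \<le> r \<and> r \<le> 1"
          then have "max 0 (min 1 (2 * r - 1/2)) = 1" using a[of n] by simp
          then show "snd (\<eta> t l) r = u (\<phi> t, l)" using t l by (simp add: \<eta>_def H0 \<phi>x)
        qed
      qed (auto simp: \<eta>_def H0)
      then show ?thesis using True by (auto simp: cube_boundary_0)
    next
      case False
      \<comment> \<open>\<open>x0\<close> is a vertex, so every other cell can meet it in its
        boundary only; there the prescribed data have already been used.\<close>
      have inx0: "t \<in> cube_boundary n" if "t \<in> topspace (cube n)" "\<phi> t = x0" for t
      proof (rule ccontr)
        assume "t \<notin> cube_boundary n"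
        then have "t \<in> cube_interior n" using that by (simp add: cube_interior_def)
        then have "n = 0" using cell_index_char(1)[OF \<phi>] that x0 by metis
        then show False using that False by (simp add: topspace_cube_0)
      qed
      have at_bd: "\<exists>i \<psi> s. i < n \<and> \<psi> \<in> C i \<and> s \<in> topspace (cube i) \<and> \<phi> t = \<psi> s" if "t \<in> cube_boundary n" for t
      proof -
        have "\<phi> t \<in> topspace X" using that char_in[OF \<phi>] cube_boundary_subset by blast
        then show ?thesis
          using cdim_boundary[OF \<phi> that] cell_index cube_interior_subset by (metis subsetD)
      qed
      \<comment> \<open>The value of \<open>a\<close> in dimension \<open>n - 1\<close> when
        \<open>n\<close> is positive: the shortest resting time among the lower cells, still longer
        than \<open>a n\<close>.\<close>
      define A where "A = 1 / (real n + 3)"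
      have A: "a n < A" "A < 1/2" by (auto simp: A_def a_def field_simps)
      have aA: "A \<le> a i" if "i < n" for i using that by (auto simp: A_def a_def field_simps)
      obtain \<rho> where \<rho>: "continuous_on UNIV \<rho>" "\<And>r. 0 \<le> \<rho> r \<and> \<rho> r \<le> 1"
        "\<And>r. r \<le> a n \<Longrightarrow> \<rho> r = 0" "\<And>r. 1 - a n \<le> r \<Longrightarrow> \<rho> r = 1"
        "\<And>r. max 0 (min 1 (3 * \<rho> r - 1)) = max 0 (min 1 ((r - A) / (1 - 2 * A)))"
        using window_reparametrization[OF a(1) A] by metis
      define v where "v = (\<lambda>z. fst (\<xi> (\<phi> (fst z)) (snd z)))"
      \<comment> \<open>The boundary homotopy restricted to the window [A, 1 - A]; nothing moves
        outside it.\<close>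
      define H where "H = (\<lambda>z. snd (\<xi> (\<phi> (fst (snd z))) (snd (snd z))) (A + (1 - 2 * A) * fst z))"
      have IHc: "continuous_map (prod_topology (cube i) L) W (\<lambda>z. fst (\<xi> (\<psi> (fst z)) (snd z)))"
        "continuous_map (prod_topology unit_interval (prod_topology (cube i) L)) Z
           (\<lambda>z. snd (\<xi> (\<psi> (fst (snd z))) (snd (snd z))) (fst z))"
        if "i < n" "\<psi> \<in> C i" for i \<psi>
        using IH[OF that] by (simp_all add: Good_def)
      have cv: "continuous_map (prod_topology (cube_bd n) L) W v"
        using continuous_on_cell_boundary[OF \<phi>, of L W "\<lambda>p. fst (\<xi> (fst p) (snd p))"] IHc(1)
        by (simp add: v_def)
      have cH': "continuous_map (prod_topology (cube_bd n) (prod_topology unit_interval L)) Z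
          (\<lambda>z. (\<lambda>p. snd (\<xi> (fst p) (snd (snd p))) (fst (snd p))) (\<phi> (fst z), snd z))"
      proof (rule continuous_on_cell_boundary[OF \<phi>])
        fix i \<psi> assume i: "i < n" "\<psi> \<in> C i"
        have "continuous_map (prod_topology (cube i) (prod_topology unit_interval L))
           (prod_topology unit_interval (prod_topology (cube i) L)) (\<lambda>z. (fst (snd z), fst z, snd (snd z)))"
          by (rule cmi)+
        from cm_comp[OF IHc(2)[OF i] this]
        show "continuous_map (prod_topology (cube i) (prod_topology unit_interval L)) Z
          (\<lambda>z. (\<lambda>p. snd (\<xi> (fst p) (snd (snd p))) (fst (snd p))) (\<psi> (fst z), snd z))" by simp
      qed
      have affine: "continuous_map (prod_topology unit_interval (prod_topology (cube_bd n) L)) unit_interval (\<lambda>z. A + (1 - 2 * A) * fst z)"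
      proof (rule cm_unit)
        show "continuous_map (prod_topology unit_interval (prod_topology (cube_bd n) L)) euclideanreal (\<lambda>z. A + (1 - 2 * A) * fst z)"
          by (intro continuous_intros cm_real[OF continuous_map_fst])
        have "0 \<le> A + (1 - 2 * A) * r \<and> A + (1 - 2 * A) * r \<le> 1" if "0 \<le> r" "r \<le> 1" for r
        proof -
          have "0 \<le> A" by (simp add: A_def)
          then have "0 \<le> (1 - 2 * A) * r" "(1 - 2 * A) * r \<le> (1 - 2 * A) * 1"
            using A that by (auto intro!: mult_left_mono mult_nonneg_nonneg)
          then have "A + (1 - 2 * A) * r \<le> A + (1 - 2 * A) * 1" "0 \<le> A + (1 - 2 * A) * r"
            using \<open>0 \<le> A\<close> by linarith+
          moreover have "A + (1 - 2 * A) * 1 \<le> 1" using \<open>0 \<le> A\<close> by simp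
          ultimately show ?thesis by (meson order_trans)
        qed
        then show "\<And>z. z \<in> topspace (prod_topology unit_interval (prod_topology (cube_bd n) L)) \<Longrightarrow>
            0 \<le> A + (1 - 2 * A) * fst z \<and> A + (1 - 2 * A) * fst z \<le> 1" by auto
      qed
      have cH: "continuous_map (prod_topology unit_interval (prod_topology (cube_bd n) L)) Z H"
      proof -
        have "continuous_map (prod_topology unit_interval (prod_topology (cube_bd n) L))
          (prod_topology (cube_bd n) (prod_topology unit_interval L)) (\<lambda>z. (fst (snd z), A + (1 - 2 * A) * fst z, snd (snd z)))"
          by (intro cm_pair affine) ((rule cmi)+)
        from cm_comp[OF cH' this] show ?thesis by (simp add: H_def)
      qed
      have const: "snd (\<xi> (\<phi> t) l) r = \<gamma> (\<phi> t, v (t, l))" "snd (\<xi> (\<phi> t) l) (1 - r) = u (\<phi> t, l)"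
        if t: "t \<in> cube_boundary n" and l: "l \<in> topspace L" and r: "0 \<le> r" "r \<le> A" for t l r
      proof -
        obtain i \<psi> s where i: "i < n" "\<psi> \<in> C i" "s \<in> topspace (cube i)" "\<phi> t = \<psi> s" using at_bd[OF t] by blast
        then show "snd (\<xi> (\<phi> t) l) r = \<gamma> (\<phi> t, v (t, l))" "snd (\<xi> (\<phi> t) l) (1 - r) = u (\<phi> t, l)"
          using IH[OF i(1,2)] r aA[OF i(1)] l by (simp_all add: Good_def v_def)
      qed
      have A0: "0 \<le> A" by (simp add: A_def)
      have "\<forall>t\<in>cube_boundary n. \<forall>l\<in>topspace L. H (0, t, l) = (\<lambda>z. \<gamma> (\<phi> (fst z), snd z)) (t, v (t, l)) \<and>
          H (1, t, l) = (\<lambda>z. u (\<phi> (fst z), snd z)) (t, l)"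
        using const[OF _ _ A0 order_refl] by (simp add: H_def)
      with lift[OF \<phi>, unfolded cell_lifting_def, rule_format, OF cv cH]
      obtain v' E where v': "continuous_map (prod_topology (cube n) L) W v'"
        and E: "continuous_map (prod_topology unit_interval (prod_topology (cube n) L)) Z E"
        and ends: "\<And>t l. t \<in> topspace (cube n) \<Longrightarrow> l \<in> topspace L \<Longrightarrow> E (0, t, l) = \<gamma> (\<phi> t, v' (t, l)) \<and> E (1, t, l) = u (\<phi> t, l)"
        and bd: "\<And>t l. t \<in> cube_boundary n \<Longrightarrow> l \<in> topspace L \<Longrightarrow> v' (t, l) = v (t, l) \<and>
              (\<forall>r\<in>{0..1}. E (r, t, l) = H (max 0 (min 1 (3 * r - 1)), t, l))"
        by auto
      \<comment> \<open>On the boundary the old values are taken literally, since equality is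
        required for all real times and all \<open>l\<close>; on the relevant range the two branches
        coincide.\<close>
      define \<eta> where "\<eta> t l = (if t \<in> cube_boundary n then \<xi> (\<phi> t) l else (v' (t, l), \<lambda>r. E (\<rho> r, t, l)))" for t l
      have \<eta>: "fst (\<eta> t l) = v' (t, l)" "0 \<le> r \<Longrightarrow> r \<le> 1 \<Longrightarrow> snd (\<eta> t l) r = E (\<rho> r, t, l)"
        if "l \<in> topspace L" for t l r
      proof -
        show "fst (\<eta> t l) = v' (t, l)" using bd[of t l] that by (simp add: \<eta>_def v_def)
        assume r: "0 \<le> r" "r \<le> 1"
        show "snd (\<eta> t l) r = E (\<rho> r, t, l)"
        proof (cases "t \<in> cube_boundary n")
          case True
          \<comment> \<open>Over the boundary the middle third of \<open>E\<close> replays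
            \<open>H\<close>, and \<open>\<rho>\<close> spends exactly the window on that third;
            before and after it both sides rest.\<close>
          have "E (\<rho> r, t, l) = H (max 0 (min 1 ((r - A) / (1 - 2 * A))), t, l)"
            using bd[OF True that] \<rho>(2,5) by simp
          also have "\<dots> = snd (\<xi> (\<phi> t) l) r"
          proof -
            consider "r \<le> A" | "A \<le> r" "r \<le> 1 - A" | "1 - A \<le> r" by linarith
            then show ?thesis
            proof cases
              case 1
              then have "(r - A) / (1 - 2 * A) \<le> 0" using A by (intro divide_nonpos_pos) auto
              then have "max 0 (min 1 ((r - A) / (1 - 2 * A))) = 0" by simp
              then show ?thesis using 1 r const(1)[OF True that] A0 by (simp add: H_def)
            next
              case 2
              then have "max 0 (min 1 ((r - A) / (1 - 2 * A))) = (r - A) / (1 - 2 * A)" using A by (simp add: max_def min_def field_simps)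
              then show ?thesis using A by (simp add: H_def)
            next
              case 3
              then have "max 0 (min 1 ((r - A) / (1 - 2 * A))) = 1" using A by (simp add: max_def min_def field_simps)
              then show ?thesis using 3 r const(2)[OF True that, of A] const(2)[OF True that, of "1 - r"] A0 by (simp add: H_def)
            qed
          qed
          finally show ?thesis using True by (simp add: \<eta>_def)
        qed (simp add: \<eta>_def)
      qed
      have "Good n \<phi> \<eta>"
        unfolding Good_def
      proof (intro conjI ballI impI)
        show "continuous_map (prod_topology (cube n) L) W (\<lambda>z. fst (\<eta> (fst z) (snd z)))"
          using v' by (rule continuous_map_eq) (auto simp: \<eta>)
        have "continuous_map (prod_topology unit_interval (prod_topology (cube n) L)) unit_interval (\<lambda>z. \<rho> (fst z))"
          by (rule cm_unit, rule cm_comp[of euclideanreal _ \<rho>]) (use \<rho>(1,2) in \<open>auto intro: cm_real[OF continuous_map_fst]\<close>)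
        from cm_comp[OF E cm_pair[OF this continuous_map_snd]]
        show "continuous_map (prod_topology unit_interval (prod_topology (cube n) L)) Z
          (\<lambda>z. snd (\<eta> (fst (snd z)) (snd (snd z))) (fst z))"
          by (rule continuous_map_eq) (auto simp: \<eta>)
        fix t l assume t: "t \<in> topspace (cube n)" and l: "l \<in> topspace L"
        have "a n < 1/2" using A by simp
        then show "\<forall>r. 0 \<le> r \<and> r \<le> a n \<longrightarrow> snd (\<eta> t l) r = \<gamma> (\<phi> t, fst (\<eta> t l))"
          using \<eta> ends[OF t l] l \<rho>(3) by simp
        show "\<forall>r. 1 - a n \<le> r \<and> r \<le> 1 \<longrightarrow> snd (\<eta> t l) r = u (\<phi> t, l)"
          using \<open>a n < 1/2\<close> \<eta>(2)[OF l] ends[OF t l] \<rho>(4) by simp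
      next
        fix t l assume t: "t \<in> topspace (cube n)" and x: "\<phi> t = x0" and l: "l \<in> topspace L"
        have bt: "t \<in> cube_boundary n" using inx0[OF t x] .
        obtain i \<psi> s where i: "i < n" "\<psi> \<in> C i" and s: "s \<in> topspace (cube i)" "\<phi> t = \<psi> s"
          using at_bd[OF bt] by blast
        show "fst (\<eta> t l) = v0 l"
          using IH[OF i] s x l bt by (auto simp: Good_def \<eta>_def)
      next
        fix t r assume t: "t \<in> topspace (cube n)" and x: "\<phi> t = x0" and r: "r \<in> {0..1::real}"
        have bt: "t \<in> cube_boundary n" using inx0[OF t x] .
        obtain i \<psi> s where i: "i < n" "\<psi> \<in> C i" and s: "s \<in> topspace (cube i)" "\<phi> t = \<psi> s"
          using at_bd[OF bt] by blast
        show "snd (\<eta> t l0) r = z0"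
          using IH[OF i] s x r bt by (auto simp: Good_def \<eta>_def)
      qed
      then show ?thesis by (intro exI[of _ \<eta>]) (simp add: \<eta>_def fun_eq_iff)
    qed
  qed (rule that)
  obtain K where K: "continuous_map (prod_topology unit_interval X) X K"
    "\<And>x. x \<in> topspace X \<Longrightarrow> K (0, x) = x"
    "\<And>r x. x \<in> topspace X \<Longrightarrow> cdim x = 0 \<Longrightarrow> K (r, x) = x"
    "\<And>x. x \<in> topspace X \<Longrightarrow> \<exists>U F. openin X U \<and> x \<in> U \<and> finite F \<and> F \<subseteq> Sigma UNIV C \<and> (\<lambda>x. K (1, x)) ` U \<subseteq> cells F"
    using cell_compression by metis
  \<comment> \<open>The end of the compression. It fixes vertices, so passing to \<open>s x\<close>
    does not disturb the data over \<open>x0\<close>.\<close>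
  define s where "s x = K (1, x)" for x
  have cs: "continuous_map X X s"
    unfolding s_def by (intro cm_comp[OF K(1)] cm_pair cm_id) simp
  have s_in: "s x \<in> topspace X" if "x \<in> topspace X" for x using cm_range[OF cs that] .
  have s0: "s x0 = x0" using K(3)[OF x0] by (simp add: s_def)
  have at: "\<exists>n \<phi> t. Good n \<phi> (\<xi> \<circ> \<phi>) \<and> t \<in> topspace (cube n) \<and> \<phi> t = x" if "x \<in> topspace X" for x
    using \<xi> in_open_cell[OF that] cube_interior_subset by blast
  define v where "v p = fst (\<xi> (s (fst p)) (snd p))" for p
  have cv: "continuous_map (prod_topology X L) W v"
    using compressed_continuous[OF K(1,4), of L W "\<lambda>p. fst (\<xi> (fst p) (snd p))"] \<xi>
    by (simp add: v_def[abs_def] s_def Good_def o_def)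
  define H where "H z = snd (\<xi> (s (fst (snd z))) (snd (snd z))) (fst z)" for z
  have cH: "continuous_map (prod_topology unit_interval (prod_topology X L)) Z H"
  proof -
    have "continuous_map (prod_topology X (prod_topology unit_interval L)) Z
        (\<lambda>p. (\<lambda>p. snd (\<xi> (fst p) (snd (snd p))) (fst (snd p))) (K (1, fst p), snd p))"
    proof (rule compressed_continuous[OF K(1,4)])
      fix n \<phi> assume \<phi>: "\<phi> \<in> C n"
      have "continuous_map (prod_topology (cube n) (prod_topology unit_interval L))
           (prod_topology unit_interval (prod_topology (cube n) L)) (\<lambda>z. (fst (snd z), fst z, snd (snd z)))"
        by (rule cmi)+
      from cm_comp[OF \<xi>[OF \<phi>, unfolded Good_def, THEN conjunct2, THEN conjunct1] this]
      show "continuous_map (prod_topology (cube n) (prod_topology unit_interval L)) Z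
          (\<lambda>z. (\<lambda>p. snd (\<xi> (fst p) (snd (snd p))) (fst (snd p))) (\<phi> (fst z), snd z))" by simp
    qed
    moreover have "continuous_map (prod_topology unit_interval (prod_topology X L))
      (prod_topology X (prod_topology unit_interval L)) (\<lambda>z. (fst (snd z), fst z, snd (snd z)))"
      by (rule cmi)+
    ultimately have "continuous_map (prod_topology unit_interval (prod_topology X L)) Z
      (\<lambda>z. (\<lambda>q. (\<lambda>p. snd (\<xi> (fst p) (snd (snd p))) (fst (snd p))) (K (1, fst q), snd q)) (fst (snd z), fst z, snd (snd z)))"
      by (rule cm_comp)
    then show ?thesis by (simp add: H_def[abs_def] s_def)
  qed
  have v_x0: "v (x0, l) = v0 l" "0 \<le> r \<Longrightarrow> r \<le> 1 \<Longrightarrow> H (r, x0, l0) = z0" if l: "l \<in> topspace L" for l r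
    using at[OF x0(1)] l by (auto simp: v_def H_def s0 Good_def)
  let ?P = "\<lambda>h :: 'a \<times> 'l \<Rightarrow> 'z. h (x0, l0) = z0"
  have pt: "(x0, l0) \<in> topspace (prod_topology X L)" using x0 l0 by simp
  have base: "\<gamma> (x0, v0 l0) = z0" "u (x0, l0) = z0" using H0(2-4) l0 by force+
  let ?T = "prod_topology unit_interval (prod_topology X L)"
  \<comment> \<open>\<open>v\<close> lies over \<open>s x\<close> and not over \<open>x\<close>. The
    compression moves \<open>x\<close> to \<open>s x\<close> in the first argument of
    \<open>\<gamma>\<close>, \<open>H\<close> leads to \<open>u\<close> at \<open>s x\<close>, and
    the compression run backwards returns to \<open>u\<close> at \<open>x\<close>.\<close>
  have 1: "homotopic_with ?P (prod_topology X L) Z (\<lambda>p. \<gamma> (fst p, v p)) (\<lambda>p. \<gamma> (s (fst p), v p))"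
  proof (rule homotopic_with_pointI[OF pt, where h = "\<lambda>z. \<gamma> (K (fst z, fst (snd z)), v (snd z))"])
    have "continuous_map ?T X (\<lambda>z. K (fst z, fst (snd z)))"
      by (rule cm_comp[OF K(1)], (rule cmi)+)
    moreover have "continuous_map ?T W (\<lambda>z. v (snd z))"
      by (rule cm_comp[OF cv continuous_map_snd])
    ultimately show "continuous_map ?T Z (\<lambda>z. \<gamma> (K (fst z, fst (snd z)), v (snd z)))"
      by (intro cm_comp[OF \<gamma>] cm_pair)
  qed (use K(2,3) x0 l0 base v_x0(1) in \<open>auto simp: s_def\<close>)
  have 2: "homotopic_with ?P (prod_topology X L) Z (\<lambda>p. \<gamma> (s (fst p), v p)) (\<lambda>p. u (s (fst p), snd p))"
  proof (rule homotopic_with_pointI[OF pt cH])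
    fix p assume p: "p \<in> topspace (prod_topology X L)"
    have p': "fst p \<in> topspace X" "snd p \<in> topspace L" using p by auto
    obtain n \<phi> t where G: "Good n \<phi> (\<xi> \<circ> \<phi>)" and t: "t \<in> topspace (cube n)" "\<phi> t = s (fst p)"
      using at[OF s_in[OF p'(1)]] by blast
    note * = bspec[OF bspec[OF G[unfolded Good_def, THEN conjunct2, THEN conjunct2, THEN conjunct1] t(1)] p'(2)]
    show "H (0, p) = \<gamma> (s (fst p), v p)"
      using *[THEN conjunct1, THEN spec, of 0] a(1)[of n] t(2) by (simp add: H_def v_def)
    show "H (1, p) = u (s (fst p), snd p)"
      using *[THEN conjunct2, THEN spec, of 1] a(1)[of n] t(2) by (simp add: H_def)
  qed (use v_x0(2) l0 in simp)
  have 3: "homotopic_with ?P (prod_topology X L) Z u (\<lambda>p. u (s (fst p), snd p))"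
  proof (rule homotopic_with_pointI[OF pt, where h = "\<lambda>z. u (K (fst z, fst (snd z)), snd (snd z))"])
    have "continuous_map ?T X (\<lambda>z. K (fst z, fst (snd z)))"
      by (rule cm_comp[OF K(1)], (rule cmi)+)
    moreover have "continuous_map ?T L (\<lambda>z. snd (snd z))"
      by (rule cmi)+
    ultimately show "continuous_map ?T Z (\<lambda>z. u (K (fst z, fst (snd z)), snd (snd z)))"
      by (intro cm_comp[OF u] cm_pair)
  qed (use K(2,3) x0 l0 base in \<open>auto simp: s_def\<close>)
  show ?thesis
    using that[OF cv v_x0(1)] homotopic_with_trans[OF 1 homotopic_with_trans[OF 2 homotopic_with_symD[OF 3]]] by blast
qed

end

section \<open>Based homotopies and based equivalences\<close>

lemma based_mapsI: "\<lbrakk>continuous_map X Y f; f x = y\<rbrakk> \<Longrightarrow> f \<in> based_maps X x Y y"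
  by (simp add: based_maps_def)

lemma based_mapsD: "f \<in> based_maps X x Y y \<Longrightarrow> continuous_map X Y f" "f \<in> based_maps X x Y y \<Longrightarrow> f x = y"
  by (simp_all add: based_maps_def)

lemma based_maps_comp: "\<lbrakk>f \<in> based_maps X x Y y; g \<in> based_maps Y y Z z\<rbrakk> \<Longrightarrow> g \<circ> f \<in> based_maps X x Z z"
  by (auto simp: based_maps_def intro: continuous_map_compose)

lemma based_maps_id: "id \<in> based_maps X x X x"
  by (simp add: based_maps_def)

lemma based_homotopicI:
  assumes "x \<in> topspace X" "continuous_map (prod_topology unit_interval X) Y h"
    and "\<And>z. z \<in> topspace X \<Longrightarrow> h (0, z) = p z" "\<And>z. z \<in> topspace X \<Longrightarrow> h (1, z) = q z"
    and "\<And>t. 0 \<le> t \<Longrightarrow> t \<le> 1 \<Longrightarrow> h (t, x) = y"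
  shows "based_homotopic X x Y y p q"
  unfolding based_homotopic_def by (rule homotopic_with_pointI[OF assms])

lemma based_homotopicE:
  assumes "based_homotopic X x Y y p q"
  obtains h where "continuous_map (prod_topology unit_interval X) Y h"
    "\<And>z. h (0, z) = p z" "\<And>z. h (1, z) = q z" "\<And>t. 0 \<le> t \<Longrightarrow> t \<le> 1 \<Longrightarrow> h (t, x) = y"
  using assms unfolding based_homotopic_def homotopic_with_def by auto

lemma based_homotopic_refl: "f \<in> based_maps X x Y y \<Longrightarrow> based_homotopic X x Y y f f"
  by (simp add: based_homotopic_def based_maps_def)

lemma based_homotopic_sym: "based_homotopic X x Y y f g \<Longrightarrow> based_homotopic X x Y y g f"
  by (simp add: based_homotopic_def homotopic_with_sym)

lemma based_homotopic_trans [trans]: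
  "\<lbrakk>based_homotopic X x Y y f g; based_homotopic X x Y y g h\<rbrakk> \<Longrightarrow> based_homotopic X x Y y f h"
  unfolding based_homotopic_def by (rule homotopic_with_trans)

lemma based_homotopic_imp_maps:
  assumes "based_homotopic X x Y y f g"
  shows "f \<in> based_maps X x Y y \<and> g \<in> based_maps X x Y y"
  using homotopic_with_imp_continuous_maps[OF assms[unfolded based_homotopic_def]]
    homotopic_with_imp_property[OF assms[unfolded based_homotopic_def]]
  by (simp add: based_maps_def)

lemma based_homotopic_comp_left:
  "\<lbrakk>based_homotopic X x Y y f g; h \<in> based_maps Y y Z z\<rbrakk> \<Longrightarrow> based_homotopic X x Z z (h \<circ> f) (h \<circ> g)"
  unfolding based_homotopic_def
  by (rule homotopic_with_compose_continuous_map_left[where p = "\<lambda>h. h x = y"]) (auto simp: based_maps_def)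

lemma based_homotopic_comp_right:
  "\<lbrakk>based_homotopic Y y Z z f g; h \<in> based_maps X x Y y\<rbrakk> \<Longrightarrow> based_homotopic X x Z z (f \<circ> h) (g \<circ> h)"
  unfolding based_homotopic_def
  by (rule homotopic_with_compose_continuous_map_right[where p = "\<lambda>h. h y = z"]) (auto simp: based_maps_def)

lemma based_homotopic_eq:
  assumes "f \<in> based_maps X x Y y" "x \<in> topspace X" "\<And>z. z \<in> topspace X \<Longrightarrow> f z = g z"
  shows "based_homotopic X x Y y f g"
  unfolding based_homotopic_def
  by (rule homotopic_with_equal) (use assms in \<open>auto simp: based_maps_def\<close>)

lemma based_homotopy_equivalenceI:
  assumes "f \<in> based_maps X x Y y" "g \<in> based_maps Y y X x"
    "based_homotopic X x X x (g \<circ> f) id" "based_homotopic Y y Y y (f \<circ> g) id"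
  shows "based_homotopy_equivalence X x Y y f"
  using assms by (auto simp: based_homotopy_equivalence_def)

lemma based_homotopy_equivalenceE:
  assumes "based_homotopy_equivalence X x Y y f"
  obtains g where "f \<in> based_maps X x Y y" "g \<in> based_maps Y y X x"
    "based_homotopic X x X x (g \<circ> f) id" "based_homotopic Y y Y y (f \<circ> g) id"
    "based_homotopy_equivalence Y y X x g"
  using assms by (auto simp: based_homotopy_equivalence_def)

lemma based_homotopy_equivalence_homotopic:
  assumes f: "based_homotopy_equivalence X x Y y f" and fg: "based_homotopic X x Y y f g"
  shows "based_homotopy_equivalence X x Y y g"
proof -
  obtain h where h: "f \<in> based_maps X x Y y" "h \<in> based_maps Y y X x"
    "based_homotopic X x X x (h \<circ> f) id" "based_homotopic Y y Y y (f \<circ> h) id"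
    using f by (rule based_homotopy_equivalenceE)
  note gf = based_homotopic_sym[OF fg]
  show ?thesis
  proof (rule based_homotopy_equivalenceI[OF _ h(2)])
    show "g \<in> based_maps X x Y y" using based_homotopic_imp_maps[OF fg] ..
    show "based_homotopic X x X x (h \<circ> g) id"
      using based_homotopic_trans[OF based_homotopic_comp_left[OF gf h(2)] h(3)] .
    show "based_homotopic Y y Y y (g \<circ> h) id"
      using based_homotopic_trans[OF based_homotopic_comp_right[OF gf h(2)] h(4)] .
  qed
qed

lemma based_homotopy_equivalence_comp:
  assumes f: "based_homotopy_equivalence X x Y y f" and g: "based_homotopy_equivalence Y y Z z g"
  shows "based_homotopy_equivalence X x Z z (g \<circ> f)"
proof -
  obtain f' where f': "f \<in> based_maps X x Y y" "f' \<in> based_maps Y y X x"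
    "based_homotopic X x X x (f' \<circ> f) id" "based_homotopic Y y Y y (f \<circ> f') id"
    using f by (rule based_homotopy_equivalenceE)
  obtain g' where g': "g \<in> based_maps Y y Z z" "g' \<in> based_maps Z z Y y"
    "based_homotopic Y y Y y (g' \<circ> g) id" "based_homotopic Z z Z z (g \<circ> g') id"
    using g by (rule based_homotopy_equivalenceE)
  show ?thesis
  proof (rule based_homotopy_equivalenceI[of _ _ _ _ _ "f' \<circ> g'"])
    have "based_homotopic X x X x (f' \<circ> ((g' \<circ> g) \<circ> f)) (f' \<circ> (id \<circ> f))"
      by (intro based_homotopic_comp_left[OF _ f'(2)] based_homotopic_comp_right[OF _ f'(1)] g'(3))
    then show "based_homotopic X x X x ((f' \<circ> g') \<circ> (g \<circ> f)) id"
      using based_homotopic_trans[OF _ f'(3)] by (simp add: o_assoc)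
    have "based_homotopic Z z Z z (g \<circ> ((f \<circ> f') \<circ> g')) (g \<circ> (id \<circ> g'))"
      by (intro based_homotopic_comp_left[OF _ g'(1)] based_homotopic_comp_right[OF _ g'(2)] f'(4))
    then show "based_homotopic Z z Z z ((g \<circ> f) \<circ> (f' \<circ> g')) id"
      using based_homotopic_trans[OF _ g'(4)] by (simp add: o_assoc)
  qed (use f' g' based_maps_comp in metis)+
qed

text \<open>If \<open>g\<close> has left inverse \<open>f\<close> and right inverse
  \<open>h\<close>, these agree up to homotopy: g f = g f g h = g h = id. Hence a construction of
  right inverses that applies again to its own result gives two-sided inverses.\<close>

lemma based_homotopy_equivalence_right_inverses:
  assumes f: "f \<in> based_maps X x Y y" and g: "g \<in> based_maps Y y X x" and h: "h \<in> based_maps X x Y y"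
    and fg: "based_homotopic Y y Y y (f \<circ> g) id" and gh: "based_homotopic X x X x (g \<circ> h) id"
  shows "based_homotopy_equivalence X x Y y f"
proof (rule based_homotopy_equivalenceI[OF f g _ fg])
  have "based_homotopic X x X x ((g \<circ> f) \<circ> id) ((g \<circ> f) \<circ> (g \<circ> h))"
    by (intro based_homotopic_comp_left[OF based_homotopic_sym[OF gh]] based_maps_comp[OF f g])
  also have "based_homotopic X x X x ((g \<circ> f) \<circ> (g \<circ> h)) (g \<circ> (id \<circ> h))"
    using based_homotopic_comp_left[OF based_homotopic_comp_right[OF fg h] g] by (simp add: o_assoc)
  also have "based_homotopic X x X x (g \<circ> (id \<circ> h)) id" using gh by simp
  finally show "based_homotopic X x X x (g \<circ> f) id" by simp
qed

section \<open>Unbased homotopies\<close>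

lemma homotopic_withE:
  assumes "homotopic_with P X Y p q"
  obtains h where "continuous_map (prod_topology unit_interval X) Y h"
    "\<And>z. h (0, z) = p z" "\<And>z. h (1, z) = q z" "\<And>t. 0 \<le> t \<Longrightarrow> t \<le> 1 \<Longrightarrow> P (\<lambda>x. h (t, x))"
  using assms unfolding homotopic_with_def by auto

lemma homotopicE:
  assumes "homotopic_with (\<lambda>_. True) X Y p q"
  obtains h where "continuous_map (prod_topology unit_interval X) Y h"
    "\<And>z. h (0, z) = p z" "\<And>z. h (1, z) = q z"
  using assms unfolding homotopic_with_def by auto

lemma homotopicI:
  assumes "continuous_map (prod_topology unit_interval X) Y h"
    and "\<And>z. z \<in> topspace X \<Longrightarrow> h (0, z) = p z" "\<And>z. z \<in> topspace X \<Longrightarrow> h (1, z) = q z"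
  shows "homotopic_with (\<lambda>_. True) X Y p q"
  by (rule homotopic_withI) (use assms in auto)

lemma cm_scaled_coord:
  "continuous_map (prod_topology unit_interval X) unit_interval (\<lambda>z. 1 - fst z)"
  by (intro cm_unit continuous_intros cm_real[OF continuous_map_fst]) auto

lemma cm_clamp:
  "continuous_map Z euclideanreal f \<Longrightarrow> continuous_map Z unit_interval (\<lambda>z. max 0 (min 1 (f z)))"
  by (intro cm_unit continuous_intros) auto

text \<open>By homotopy extension, whether a map on the boundary extends over the cube depends only
  on its homotopy class.\<close>

lemma cube_extension_up_to_homotopy:
  assumes f: "continuous_map (prod_topology (cube n) L) Z f"
    and fg: "homotopic_with (\<lambda>_. True) (prod_topology (cube_bd n) L) Z f g"
  obtains f' where "continuous_map (prod_topology (cube n) L) Z f'"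
    "\<And>t l. t \<in> cube_boundary n \<Longrightarrow> l \<in> topspace L \<Longrightarrow> f' (t, l) = g (t, l)"
proof -
  obtain h where h: "continuous_map (prod_topology unit_interval (prod_topology (cube_bd n) L)) Z h"
    "\<And>z. h (0, z) = f z" "\<And>z. h (1, z) = g z"
    using fg by (rule homotopicE) auto
  obtain F where F: "continuous_map (prod_topology unit_interval (prod_topology (cube n) L)) Z F"
    "\<And>s t l. \<lbrakk>0 \<le> s; s \<le> 1; t \<in> cube_boundary n; l \<in> topspace L\<rbrakk> \<Longrightarrow> F (s, t, l) = h (s, t, l)"
    using cube_homotopy_extension[OF f h(1)] h(2) by metis
  show ?thesis
  proof (rule that[of "\<lambda>p. F (1, p)"])
    show "continuous_map (prod_topology (cube n) L) Z (\<lambda>p. F (1, p))"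
      by (intro cm_comp[OF F(1)] cm_pair cm_id) simp
  qed (simp add: F h)
qed

section \<open>Families of homotopy equivalences over a CW-complex\<close>

text \<open>The clamps keep every time in the unit interval, so each branch is continuous on the
  whole domain before it is restricted; the middle one has the form that \<open>cell_lifting\<close>
  prescribes.\<close>

definition concat3 :: "(real \<times> 'a \<Rightarrow> 'b) \<Rightarrow> (real \<times> 'a \<Rightarrow> 'b) \<Rightarrow> (real \<times> 'a \<Rightarrow> 'b) \<Rightarrow> real \<times> 'a \<Rightarrow> 'b" where
  "concat3 a b d z =
     (if fst z \<le> 1/3 then a (max 0 (min 1 (3 * fst z)), snd z)
      else if fst z \<le> 2/3 then b (max 0 (min 1 (3 * fst z - 1)), snd z)
      else d (max 0 (min 1 (3 * fst z - 2)), snd z))"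

lemma cm_concat3:
  assumes "continuous_map (prod_topology unit_interval X) Y a"
    "continuous_map (prod_topology unit_interval X) Y b"
    "continuous_map (prod_topology unit_interval X) Y d"
    and "\<And>x. x \<in> topspace X \<Longrightarrow> a (1, x) = b (0, x)" "\<And>x. x \<in> topspace X \<Longrightarrow> b (1, x) = d (0, x)"
  shows "continuous_map (prod_topology unit_interval X) Y (concat3 a b d)"
proof -
  let ?T = "prod_topology unit_interval X"
  have cfst: "continuous_map ?T euclideanreal fst"
    by (rule cm_real[OF continuous_map_fst])
  have cph: "continuous_map ?T ?T (\<lambda>z. (max 0 (min 1 (3 * fst z - k)), snd z))" for k
    by (intro cm_pair cm_clamp continuous_intros cfst)
  have ca: "continuous_map ?T Y (\<lambda>z. a (max 0 (min 1 (3 * fst z)), snd z))"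
    using cm_comp[OF assms(1) cph[of 0]] by simp
  have cb: "continuous_map ?T Y (\<lambda>z. b (max 0 (min 1 (3 * fst z - 1)), snd z))"
    by (rule cm_comp[OF assms(2) cph])
  have cd: "continuous_map ?T Y (\<lambda>z. d (max 0 (min 1 (3 * fst z - 2)), snd z))"
    by (rule cm_comp[OF assms(3) cph])
  show ?thesis
    unfolding concat3_def
  proof (rule cm_cases_le[OF cfst])
    show "continuous_map (subtopology ?T {x \<in> topspace ?T. 1/3 \<le> fst x}) Y
      (\<lambda>x. if fst x \<le> 2/3 then b (max 0 (min 1 (3 * fst x - 1)), snd x) else d (max 0 (min 1 (3 * fst x - 2)), snd x))"
    proof (rule continuous_map_from_subtopology, rule cm_cases_le[OF cfst])
      show "b (max 0 (min 1 (3 * fst x - 1)), snd x) = d (max 0 (min 1 (3 * fst x - 2)), snd x)"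
        if "x \<in> topspace ?T" "fst x = 2/3" for x
        using that assms(5) by auto
    qed (auto intro: continuous_map_from_subtopology cb cd)
    show "a (max 0 (min 1 (3 * fst x)), snd x) =
        (if fst x \<le> 2/3 then b (max 0 (min 1 (3 * fst x - 1)), snd x) else d (max 0 (min 1 (3 * fst x - 2)), snd x))"
      if "x \<in> topspace ?T" "fst x = 1/3" for x
      using that assms(4) by auto
  qed (auto intro: continuous_map_from_subtopology ca)
qed

text \<open>The first and third homotopies are relative to the boundary, so after concatenation the
  boundary rests in the outer thirds and sees \<open>H\<close> in the middle one.\<close>

lemma cell_liftingI:
  assumes "\<And>v H. \<lbrakk>continuous_map (prod_topology (cube_bd n) L) W v;
        continuous_map (prod_topology unit_interval (prod_topology (cube_bd n) L)) Z H;
        \<And>t l. t \<in> cube_boundary n \<Longrightarrow> l \<in> topspace L \<Longrightarrow> H (0, t, l) = \<gamma> (t, v (t, l));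
        \<And>t l. t \<in> cube_boundary n \<Longrightarrow> l \<in> topspace L \<Longrightarrow> H (1, t, l) = u (t, l)\<rbrakk> \<Longrightarrow>
      \<exists>v' f1 f2 B. continuous_map (prod_topology (cube n) L) W v' \<and>
        homotopic_with (\<lambda>h. \<forall>t\<in>cube_boundary n. \<forall>l\<in>topspace L. h (t, l) = H (0, t, l))
          (prod_topology (cube n) L) Z (\<lambda>(t, l). \<gamma> (t, v' (t, l))) f1 \<and>
        continuous_map (prod_topology unit_interval (prod_topology (cube n) L)) Z B \<and>
        (\<forall>t\<in>topspace (cube n). \<forall>l\<in>topspace L. B (0, t, l) = f1 (t, l) \<and> B (1, t, l) = f2 (t, l)) \<and>
        (\<forall>t\<in>cube_boundary n. \<forall>l\<in>topspace L. v' (t, l) = v (t, l) \<and> (\<forall>r\<in>{0..1}. B (r, t, l) = H (r, t, l))) \<and>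
        homotopic_with (\<lambda>h. \<forall>t\<in>cube_boundary n. \<forall>l\<in>topspace L. h (t, l) = H (1, t, l))
          (prod_topology (cube n) L) Z f2 u"
  shows "cell_lifting n W Z L \<gamma> u"
  unfolding cell_lifting_def
proof (intro allI impI)
  fix v H
  assume "continuous_map (prod_topology (cube_bd n) L) W v"
    and "continuous_map (prod_topology unit_interval (prod_topology (cube_bd n) L)) Z H"
    and "\<forall>t\<in>cube_boundary n. \<forall>l\<in>topspace L. H (0, t, l) = \<gamma> (t, v (t, l)) \<and> H (1, t, l) = u (t, l)"
  then obtain v' f1 f2 B where v': "continuous_map (prod_topology (cube n) L) W v'"
    and A: "homotopic_with (\<lambda>h. \<forall>t\<in>cube_boundary n. \<forall>l\<in>topspace L. h (t, l) = H (0, t, l))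
          (prod_topology (cube n) L) Z (\<lambda>(t, l). \<gamma> (t, v' (t, l))) f1"
    and B: "continuous_map (prod_topology unit_interval (prod_topology (cube n) L)) Z B"
    and Bends: "\<forall>t\<in>topspace (cube n). \<forall>l\<in>topspace L. B (0, t, l) = f1 (t, l) \<and> B (1, t, l) = f2 (t, l)"
    and bd: "\<forall>t\<in>cube_boundary n. \<forall>l\<in>topspace L. v' (t, l) = v (t, l) \<and> (\<forall>r\<in>{0..1}. B (r, t, l) = H (r, t, l))"
    and D: "homotopic_with (\<lambda>h. \<forall>t\<in>cube_boundary n. \<forall>l\<in>topspace L. h (t, l) = H (1, t, l))
          (prod_topology (cube n) L) Z f2 u"
    using assms[of v H] by auto
  let ?T = "prod_topology unit_interval (prod_topology (cube n) L)"
  obtain a where a: "continuous_map ?T Z a"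
    "\<And>z. a (0, z) = (case z of (t, l) \<Rightarrow> \<gamma> (t, v' (t, l)))" "\<And>z. a (1, z) = f1 z"
    "\<And>r. 0 \<le> r \<Longrightarrow> r \<le> 1 \<Longrightarrow> (\<forall>t\<in>cube_boundary n. \<forall>l\<in>topspace L. a (r, t, l) = H (0, t, l))"
    using A by (rule homotopic_withE) auto
  obtain d where d: "continuous_map ?T Z d" "\<And>z. d (0, z) = f2 z" "\<And>z. d (1, z) = u z"
    "\<And>r. 0 \<le> r \<Longrightarrow> r \<le> 1 \<Longrightarrow> (\<forall>t\<in>cube_boundary n. \<forall>l\<in>topspace L. d (r, t, l) = H (1, t, l))"
    using D by (rule homotopic_withE) auto
  define E where "E = concat3 a B d"
  have "continuous_map ?T Z E"
    unfolding E_def using Bends a(3) d(2) by (intro cm_concat3 a(1) B d(1)) auto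
  moreover have "E (0, t, l) = \<gamma> (t, v' (t, l)) \<and> E (1, t, l) = u (t, l)" for t l
    by (simp add: E_def concat3_def a d)
  moreover have "E (r, t, l) = H (max 0 (min 1 (3 * r - 1)), t, l)"
    if t: "t \<in> cube_boundary n" "l \<in> topspace L" and r: "r \<in> {0..1}" for t l r
  proof -
    consider "r \<le> 1/3" | "1/3 < r" "r \<le> 2/3" | "2/3 < r" by linarith
    then show ?thesis
    proof cases
      case 1
      then have "max 0 (min 1 (3 * r - 1)) = 0" by simp
      then show ?thesis using 1 a(4) t by (simp add: E_def concat3_def)
    next
      case 2
      then show ?thesis using bd t by (simp add: E_def concat3_def)
    next
      case 3
      then have "max 0 (min 1 (3 * r - 1)) = 1" by simp
      then show ?thesis using 3 d(4) t by (simp add: E_def concat3_def)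
    qed
  qed
  ultimately show "\<exists>v' E. continuous_map (prod_topology (cube n) L) W v' \<and> continuous_map ?T Z E \<and>
      (\<forall>t\<in>topspace (cube n). \<forall>l\<in>topspace L. E (0, t, l) = \<gamma> (t, v' (t, l)) \<and> E (1, t, l) = u (t, l)) \<and>
      (\<forall>t\<in>cube_boundary n. \<forall>l\<in>topspace L. v' (t, l) = v (t, l) \<and>
        (\<forall>r\<in>{0..1}. E (r, t, l) = H (max 0 (min 1 (3 * r - 1)), t, l)))"
    using v' bd by (intro exI[of _ v'] exI[of _ E]) blast
qed

lemma update_in_cube:
  "\<lbrakk>t \<in> topspace (cube n); 0 < n; 0 \<le> q; q \<le> 1\<rbrakk> \<Longrightarrow> t(0 := q) \<in> topspace (cube n)"
  by (auto simp: topspace_cube PiE_def Pi_def extensional_def)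

lemma cm_update:
  assumes n: "0 < n" and f: "continuous_map Z (cube n) f" and q: "continuous_map Z unit_interval q"
  shows "continuous_map Z (cube n) (\<lambda>z. (f z)(0 := q z))"
proof (rule cm_into_cube)
  show "continuous_map Z euclideanreal (\<lambda>z. ((f z)(0 := q z)) i)" if "i < n" for i
    using cm_cube_coord[OF that f] cm_real[OF q] by (cases "i = 0") auto
  show "(f z)(0 := q z) \<in> topspace (cube n)" if "z \<in> topspace Z" for z
    using update_in_cube[OF cm_range[OF f that] n] cm_unit_range[OF q that] by simp
qed

text \<open>If coordinate 0 is not what puts \<open>t\<close> on the boundary, some other coordinate
  is, and it survives the update.\<close>

lemma update_in_boundary:
  assumes t: "t \<in> topspace (cube n)" and n: "0 < n" and q: "0 \<le> q" "q \<le> 1"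
    and or: "q = 0 \<or> q = 1 \<or> (t \<in> cube_boundary n \<and> t 0 \<noteq> 0 \<and> t 0 \<noteq> 1)"
  shows "t(0 := q) \<in> cube_boundary n"
proof -
  have "t(0 := q) \<in> topspace (cube n)" by (rule update_in_cube[OF t n q])
  moreover have "\<exists>i<n. (t(0 := q)) i = 0 \<or> (t(0 := q)) i = 1"
    using or
  proof (elim disjE conjE)
    assume b: "t \<in> cube_boundary n" "t 0 \<noteq> 0" "t 0 \<noteq> 1"
    then obtain i where "i < n" "t i = 0 \<or> t i = 1" by (auto simp: cube_boundary_def)
    then show ?thesis using b by (intro exI[of _ i]) auto
  qed (use n in auto)
  ultimately show ?thesis by (simp add: cube_boundary_def)
qed

text \<open>
  Families over the cube that are the identity over the boundary form a group up to homotopy, the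
  inverse being given by reversal of a coordinate.
\<close>

lemma reversed_family_inverse:
  assumes n: "0 < n" and \<delta>: "continuous_map (prod_topology (cube n) F) F \<delta>"
    and bd: "\<And>t y. t \<in> cube_boundary n \<Longrightarrow> y \<in> topspace F \<Longrightarrow> \<delta> (t, y) = y"
  shows "homotopic_with (\<lambda>h. \<forall>t\<in>cube_boundary n. \<forall>y\<in>topspace F. h (t, y) = y) (prod_topology (cube n) F) F
     (\<lambda>(t, y). \<delta> (t, \<delta> (t(0 := 1 - t 0), y))) snd" (is "homotopic_with ?P ?D F ?f snd")
proof -
  let ?T = "prod_topology unit_interval ?D"
  let ?g = "\<lambda>(t, y). \<delta> (t(0 := min (2 * t 0) (2 - 2 * t 0)), y)"
  have P_cong: "?P h \<longleftrightarrow> ?P k" if "\<And>x. x \<in> topspace ?D \<Longrightarrow> h x = k x" for h k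
    using that cube_boundary_subset[of n] by (intro ball_cong refl) auto
  have top: "0 \<le> fst z \<and> fst z \<le> 1 \<and> fst (snd z) \<in> topspace (cube n) \<and> snd (snd z) \<in> topspace F \<and>
      0 \<le> fst (snd z) 0 \<and> fst (snd z) 0 \<le> 1" if "z \<in> topspace ?T" for z
    using that cube_bounds[of "fst (snd z)" n 0] n by auto
  have cfst: "continuous_map ?T euclideanreal fst" by (rule cm_real[OF continuous_map_fst])
  have ct: "continuous_map ?T (cube n) (\<lambda>z. fst (snd z))" and cy: "continuous_map ?T F (\<lambda>z. snd (snd z))"
    by (rule cmi)+
  have ct0: "continuous_map ?T euclideanreal (\<lambda>z. fst (snd z) 0)" by (rule cm_cube_coord[OF n ct])
  \<comment> \<open>Both coordinates \<open>x\<close> and \<open>1 - x\<close> are accelerated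
    until, at \<open>s = 1\<close>, at least one of them has reached 1 for every \<open>x\<close>.
    Over that point \<open>\<delta>\<close> is the identity, so the composite collapses to one
    factor, with the tent function as coordinate.\<close>
  define q where "q s x = min 1 ((1 + s) * x)" for s x :: real
  have q01: "0 \<le> q s x \<and> q s x \<le> 1" if "0 \<le> s" "0 \<le> x" for s x using that by (auto simp: q_def)
  have q_ends: "q s 0 = 0" "0 \<le> s \<Longrightarrow> q s 1 = 1" for s by (auto simp: q_def)
  have \<delta>bd: "\<delta> (t(0 := x), y) = y"
    if "t \<in> topspace (cube n)" "0 \<le> x" "x \<le> 1" "y \<in> topspace F"
      "x = 0 \<or> x = 1 \<or> (t \<in> cube_boundary n \<and> t 0 \<noteq> 0 \<and> t 0 \<noteq> 1)" for t x y
    using bd update_in_boundary[OF that(1) n that(2,3,5)] that(4) by simp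
  have \<delta>in: "\<delta> (t, y) \<in> topspace F" if "t \<in> topspace (cube n)" "y \<in> topspace F" for t y
    using cm_range[OF \<delta>, of "(t, y)"] that by simp
  have 1: "homotopic_with ?P ?D F ?f ?g"
  proof (rule homotopic_withI[where h = "\<lambda>z. \<delta> ((fst (snd z))(0 := q (fst z) (fst (snd z) 0)),
        \<delta> ((fst (snd z))(0 := q (fst z) (1 - fst (snd z) 0)), snd (snd z)))"])
    have "continuous_map ?T unit_interval (\<lambda>z. q (fst z) (fst (snd z) 0))"
      "continuous_map ?T unit_interval (\<lambda>z. q (fst z) (1 - fst (snd z) 0))"
    proof -
      have 1: "continuous_map ?T euclideanreal (\<lambda>z. q (fst z) (fst (snd z) 0))"
        and 2: "continuous_map ?T euclideanreal (\<lambda>z. q (fst z) (1 - fst (snd z) 0))"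
        unfolding q_def by (intro continuous_intros cfst ct0)+
      show "continuous_map ?T unit_interval (\<lambda>z. q (fst z) (fst (snd z) 0))"
        using 1 by (rule cm_unit) (rule q01; drule top; simp)
      show "continuous_map ?T unit_interval (\<lambda>z. q (fst z) (1 - fst (snd z) 0))"
        using 2 by (rule cm_unit) (rule q01; drule top; simp)
    qed
    then show "continuous_map ?T F (\<lambda>z. \<delta> ((fst (snd z))(0 := q (fst z) (fst (snd z) 0)),
        \<delta> ((fst (snd z))(0 := q (fst z) (1 - fst (snd z) 0)), snd (snd z))))"
      by (intro cm_comp[OF \<delta>] cm_pair cm_update[OF n ct] cy)
    fix p assume p: "p \<in> topspace ?D"
    obtain t y where ty: "p = (t, y)" "t \<in> topspace (cube n)" "y \<in> topspace F" using p by auto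
    have t0: "0 \<le> t 0" "t 0 \<le> 1" using cube_bounds[OF ty(2) n] by auto
    show "\<delta> ((fst (snd (0, p)))(0 := q (fst (0, p)) (fst (snd (0, p)) 0)),
        \<delta> ((fst (snd (0, p)))(0 := q (fst (0, p)) (1 - fst (snd (0, p)) 0)), snd (snd (0, p)))) = ?f p"
      using t0 by (simp add: q_def ty)
    have "\<delta> (t(0 := q 1 (t 0)), \<delta> (t(0 := q 1 (1 - t 0)), y)) = \<delta> (t(0 := min (2 * t 0) (2 - 2 * t 0)), y)"
    proof (cases "t 0 \<le> 1/2")
      case True
      then have "q 1 (1 - t 0) = 1" "q 1 (t 0) = 2 * t 0" "min (2 * t 0) (2 - 2 * t 0) = 2 * t 0"
        by (auto simp: q_def)
      then show ?thesis using \<delta>bd[OF ty(2) _ _ ty(3), of 1] by simp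
    next
      case False
      then have q: "q 1 (1 - t 0) = 2 - 2 * t 0" "q 1 (t 0) = 1" "min (2 * t 0) (2 - 2 * t 0) = 2 - 2 * t 0"
        by (auto simp: q_def)
      have "\<delta> (t(0 := 2 - 2 * t 0), y) \<in> topspace F"
        by (intro \<delta>in update_in_cube ty n) (use False t0 in auto)
      then show ?thesis using \<delta>bd[OF ty(2), of 1] q by simp
    qed
    then show "\<delta> ((fst (snd (1, p)))(0 := q (fst (1, p)) (fst (snd (1, p)) 0)),
        \<delta> ((fst (snd (1, p)))(0 := q (fst (1, p)) (1 - fst (snd (1, p)) 0)), snd (snd (1, p)))) = ?g p"
      by (simp add: ty)
  next
    fix s :: real assume s: "0 \<le> s" "s \<le> 1"
    have "\<delta> (t(0 := q s (t 0)), \<delta> (t(0 := q s (1 - t 0)), y)) = y" if t: "t \<in> cube_boundary n" and y: "y \<in> topspace F" for t y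
    proof -
      have tc: "t \<in> topspace (cube n)" using t cube_boundary_subset by blast
      have t0: "0 \<le> t 0" "t 0 \<le> 1" using cube_bounds[OF tc n] by auto
      have "\<delta> (t(0 := q s (1 - t 0)), y) = y" 
        by (rule \<delta>bd[OF tc _ _ y]) (use q01[of s "1 - t 0"] q_ends s t0 t in auto)
      moreover have "\<delta> (t(0 := q s (t 0)), y) = y"
        by (rule \<delta>bd[OF tc _ _ y]) (use q01[of s "t 0"] q_ends s t0 t in auto)
      ultimately show ?thesis by simp
    qed
    then show "?P (\<lambda>x. \<delta> ((fst (snd (s, x)))(0 := q (fst (s, x)) (fst (snd (s, x)) 0)),
        \<delta> ((fst (snd (s, x)))(0 := q (fst (s, x)) (1 - fst (snd (s, x)) 0)), snd (snd (s, x)))))" by simp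
  qed (rule P_cong)
  \<comment> \<open>The tent is flattened to 0, where \<open>\<delta>\<close> is the
    identity.\<close>
  define w where "w s x = (1 - s) * min (2 * x) (2 - 2 * x)" for s x :: real
  have w01: "0 \<le> w s x \<and> w s x \<le> 1" if "0 \<le> s" "s \<le> 1" "0 \<le> x" "x \<le> 1" for s x
  proof -
    have "0 \<le> min (2 * x) (2 - 2 * x)" "min (2 * x) (2 - 2 * x) \<le> 1" using that by auto
    then show ?thesis using that mult_le_one[of "1 - s" "min (2 * x) (2 - 2 * x)"] by (simp add: w_def)
  qed
  have 2: "homotopic_with ?P ?D F ?g snd"
  proof (rule homotopic_withI[where h = "\<lambda>z. \<delta> ((fst (snd z))(0 := w (fst z) (fst (snd z) 0)), snd (snd z))"])
    have "continuous_map ?T unit_interval (\<lambda>z. w (fst z) (fst (snd z) 0))"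
    proof (rule cm_unit)
      show "continuous_map ?T euclideanreal (\<lambda>z. w (fst z) (fst (snd z) 0))"
        unfolding w_def by (intro continuous_intros cfst ct0)
    qed (use top w01 in blast)
    then show "continuous_map ?T F (\<lambda>z. \<delta> ((fst (snd z))(0 := w (fst z) (fst (snd z) 0)), snd (snd z)))"
      by (intro cm_comp[OF \<delta>] cm_pair cm_update[OF n ct] cy)
    fix p assume p: "p \<in> topspace ?D"
    obtain t y where ty: "p = (t, y)" "t \<in> topspace (cube n)" "y \<in> topspace F" using p by auto
    show "\<delta> ((fst (snd (0, p)))(0 := w (fst (0, p)) (fst (snd (0, p)) 0)), snd (snd (0, p))) = ?g p"
      by (simp add: w_def ty)
    show "\<delta> ((fst (snd (1, p)))(0 := w (fst (1, p)) (fst (snd (1, p)) 0)), snd (snd (1, p))) = snd p"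
      using \<delta>bd[OF ty(2) _ _ ty(3), of 0] by (simp add: w_def ty)
  next
    fix s :: real assume s: "0 \<le> s" "s \<le> 1"
    have "\<delta> (t(0 := w s (t 0)), y) = y" if t: "t \<in> cube_boundary n" and y: "y \<in> topspace F" for t y
    proof -
      have tc: "t \<in> topspace (cube n)" using t cube_boundary_subset by blast
      have t0: "0 \<le> t 0" "t 0 \<le> 1" using cube_bounds[OF tc n] by auto
      show ?thesis
        by (rule \<delta>bd[OF tc _ _ y]) (use w01[OF s t0] t in \<open>auto simp: w_def\<close>)
    qed
    then show "?P (\<lambda>x. \<delta> ((fst (snd (s, x)))(0 := w (fst (s, x)) (fst (snd (s, x)) 0)), snd (snd (s, x))))" by simp
  qed (rule P_cong)
  show ?thesis by (rule homotopic_with_trans[OF 1 2])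
qed

text \<open>Unbased on purpose: the maps of the fibre found along a path in the base need not
  preserve the base point of the fibre.\<close>

definition free_equivalence :: "'a topology \<Rightarrow> 'b topology \<Rightarrow> ('a \<Rightarrow> 'b) \<Rightarrow> bool" where
  "free_equivalence X Y f \<longleftrightarrow> continuous_map X Y f \<and> (\<exists>g. continuous_map Y X g \<and>
     homotopic_with (\<lambda>_. True) X X (g \<circ> f) id \<and> homotopic_with (\<lambda>_. True) Y Y (f \<circ> g) id)"

text \<open>Over the boundary, \<open>v\<close> is homotopic to the constant family
  \<open>k\<close>, an inverse at the centre, so it extends to some \<open>v0\<close> over the cube.
  Extending \<open>H\<close> as well ends in a family \<open>\<delta>\<close> that is the identity
  over the boundary but need not be deformable to the identity relative to it. This obstruction is
  removed by precomposing with the reversed family.\<close>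

lemma family_cell_lifting:
  assumes \<Gamma>: "continuous_map (prod_topology (cube n) F) F \<Gamma>"
    and eqv: "\<And>t. t \<in> topspace (cube n) \<Longrightarrow> free_equivalence F F (\<lambda>y. \<Gamma> (t, y))"
  shows "cell_lifting n F F F \<Gamma> snd"
proof (rule cell_liftingI)
  fix v H
  assume v: "continuous_map (prod_topology (cube_bd n) F) F v"
    and H: "continuous_map (prod_topology unit_interval (prod_topology (cube_bd n) F)) F H"
    and H0: "\<And>t y. t \<in> cube_boundary n \<Longrightarrow> y \<in> topspace F \<Longrightarrow> H (0, t, y) = \<Gamma> (t, v (t, y))"
    and H1': "\<And>t y. t \<in> cube_boundary n \<Longrightarrow> y \<in> topspace F \<Longrightarrow> H (1, t, y) = snd (t, y)"
  have H1: "\<And>t y. t \<in> cube_boundary n \<Longrightarrow> y \<in> topspace F \<Longrightarrow> H (1, t, y) = y" using H1' by simp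
  let ?D = "prod_topology (cube n) F" and ?B = "prod_topology (cube_bd n) F"
  let ?P = "\<lambda>r (h :: (nat \<Rightarrow> real) \<times> 'a \<Rightarrow> 'a). \<forall>t\<in>cube_boundary n. \<forall>l\<in>topspace F. h (t, l) = H (r, t, l)"
  let ?goal = "\<lambda>v' f1 f2 B. continuous_map ?D F v' \<and> homotopic_with (?P 0) ?D F (\<lambda>(t, l). \<Gamma> (t, v' (t, l))) f1 \<and>
        continuous_map (prod_topology unit_interval ?D) F B \<and>
        (\<forall>t\<in>topspace (cube n). \<forall>l\<in>topspace F. B (0, t, l) = f1 (t, l) \<and> B (1, t, l) = f2 (t, l)) \<and>
        (\<forall>t\<in>cube_boundary n. \<forall>l\<in>topspace F. v' (t, l) = v (t, l) \<and> (\<forall>r\<in>{0..1}. B (r, t, l) = H (r, t, l))) \<and>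
        homotopic_with (?P 1) ?D F f2 snd"
  define c where "c = dilate n 0 (\<lambda>_. 0)"
  have dil0: "dilate n 0 t = c" for t by (simp add: c_def dilate_def)
  have c: "c \<in> topspace (cube n)" unfolding c_def by (rule dilate_in_cube) auto
  obtain k where k: "continuous_map F F k"
    and kl: "homotopic_with (\<lambda>_. True) F F (k \<circ> (\<lambda>y. \<Gamma> (c, y))) id"
    and kr: "homotopic_with (\<lambda>_. True) F F ((\<lambda>y. \<Gamma> (c, y)) \<circ> k) id"
    using eqv[OF c] unfolding free_equivalence_def by blast
  show "\<exists>v' f1 f2 B. ?goal v' f1 f2 B"
  \<comment> \<open>With empty boundary nothing has to be extended, and there is no coordinate to
    reverse; the inverse \<open>k\<close> itself serves as lift.\<close>
  proof (cases "n = 0")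
    case True
    have tc: "t = c" if "t \<in> topspace (cube n)" for t using that c True by (simp add: topspace_cube_0)
    obtain R where R: "continuous_map (prod_topology unit_interval F) F R"
      "\<And>z. R (0, z) = ((\<lambda>y. \<Gamma> (c, y)) \<circ> k) z" "\<And>z. R (1, z) = id z"
      using kr by (rule homotopicE) auto
    have cv: "continuous_map ?D F (\<lambda>p. k (snd p))" by (rule cm_comp[OF k continuous_map_snd])
    have cG: "continuous_map ?D F (\<lambda>(t, l). \<Gamma> (t, k l))"
      unfolding case_prod_unfold by (intro cm_comp[OF \<Gamma>] cm_pair continuous_map_fst cv)
    have cB: "continuous_map (prod_topology unit_interval ?D) F (\<lambda>z. R (fst z, snd (snd z)))"
      by (rule cm_comp[OF R(1)], (rule cmi)+)
    have "?goal (\<lambda>p. k (snd p)) (\<lambda>(t, l). \<Gamma> (t, k l)) snd (\<lambda>z. R (fst z, snd (snd z)))"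
      using cv cG cB True tc by (auto simp: cube_boundary_0 R continuous_map_snd)
    then show ?thesis by blast
  next
    case False
    then have n: "0 < n" by simp
    obtain R where R: "continuous_map (prod_topology unit_interval F) F R"
      "\<And>z. R (0, z) = (k \<circ> (\<lambda>y. \<Gamma> (c, y))) z" "\<And>z. R (1, z) = id z"
      using kl by (rule homotopicE) auto
    let ?TB = "prod_topology unit_interval ?B"
    have cfst: "continuous_map ?TB euclideanreal fst" by (rule cm_real[OF continuous_map_fst])
    \<comment> \<open>Three deformations over the boundary: backwards along \<open>H\<close>,
      radially with the parameter of \<open>\<Gamma>\<close> to the centre \<open>c\<close>, and
      finally from \<open>k\<close> after \<open>\<Gamma>\<close> at \<open>c\<close> to the
      identity.\<close>
    have "homotopic_with (\<lambda>_. True) ?B F (\<lambda>p. k (snd p)) (\<lambda>p. k (\<Gamma> (fst p, v p)))"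
    proof (rule homotopicI[where h = "\<lambda>z. k (H (1 - fst z, snd z))"])
      show "continuous_map ?TB F (\<lambda>z. k (H (1 - fst z, snd z)))"
        by (intro cm_comp[OF k] cm_comp[OF H] cm_pair cm_scaled_coord continuous_map_snd)
    qed (auto simp: H0 H1)
    moreover have "homotopic_with (\<lambda>_. True) ?B F (\<lambda>p. k (\<Gamma> (fst p, v p))) (\<lambda>p. k (\<Gamma> (c, v p)))"
    proof (rule homotopicI[where h = "\<lambda>z. k (\<Gamma> (dilate n (1 - fst z) (fst (snd z)), v (snd z)))"])
      have "continuous_map ?TB (cube n) (\<lambda>z. dilate n (1 - fst z) (fst (snd z)))"
      proof (rule cm_dilate)
        show "continuous_map ?TB (cube n) (\<lambda>z. fst (snd z))"
          by (rule cm_cube_bd) ((rule cmi)+)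
        show "continuous_map ?TB euclideanreal (\<lambda>z. 1 - fst z)"
          by (rule cm_real[OF cm_scaled_coord])
      qed (use cnorm_nonneg in \<open>auto simp: cube_boundary_cnorm\<close>)
      then show "continuous_map ?TB F (\<lambda>z. k (\<Gamma> (dilate n (1 - fst z) (fst (snd z)), v (snd z))))"
        by (intro cm_comp[OF k] cm_comp[OF \<Gamma>] cm_pair cm_comp[OF v continuous_map_snd])
    qed (auto simp: dilate_1 dil0 cube_boundary_cnorm)
    moreover have "homotopic_with (\<lambda>_. True) ?B F (\<lambda>p. k (\<Gamma> (c, v p))) v"
    proof (rule homotopicI[where h = "\<lambda>z. R (fst z, v (snd z))"])
      show "continuous_map ?TB F (\<lambda>z. R (fst z, v (snd z)))"
        by (intro cm_comp[OF R(1)] cm_pair continuous_map_fst cm_comp[OF v continuous_map_snd])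
    qed (auto simp: R)
    ultimately have "homotopic_with (\<lambda>_. True) ?B F (\<lambda>p. k (snd p)) v"
      by (meson homotopic_with_trans)
    moreover have "continuous_map ?D F (\<lambda>p. k (snd p))" by (rule cm_comp[OF k continuous_map_snd])
    ultimately obtain v0 where v0: "continuous_map ?D F v0"
      and v0bd: "\<And>t y. t \<in> cube_boundary n \<Longrightarrow> y \<in> topspace F \<Longrightarrow> v0 (t, y) = v (t, y)"
      by (metis cube_extension_up_to_homotopy)
    have c\<Gamma>: "continuous_map ?D F (\<lambda>p. \<Gamma> (fst p, v0 p))"
      by (intro cm_comp[OF \<Gamma>] cm_pair continuous_map_fst v0)
    obtain E where E: "continuous_map (prod_topology unit_interval ?D) F E"
      and E0: "\<And>t y. t \<in> topspace (cube n) \<Longrightarrow> E (0, t, y) = (\<lambda>p. \<Gamma> (fst p, v0 p)) (t, y)"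
      and Ebd: "\<And>s t y. \<lbrakk>0 \<le> s; s \<le> 1; t \<in> cube_boundary n; y \<in> topspace F\<rbrakk> \<Longrightarrow> E (s, t, y) = H (s, t, y)"
      by (rule cube_homotopy_extension[OF c\<Gamma> H]) (auto simp: H0 v0bd)
    define \<delta> where "\<delta> p = E (1, p)" for p
    have c\<delta>: "continuous_map ?D F \<delta>"
      unfolding \<delta>_def by (intro cm_comp[OF E] cm_pair cm_id) simp
    have \<delta>bd: "\<delta> (t, y) = y" if "t \<in> cube_boundary n" "y \<in> topspace F" for t y
      using that by (simp add: \<delta>_def Ebd H1)
    \<comment> \<open>The inverse of \<open>\<delta>\<close> up to a homotopy relative to the
      boundary; it is again the identity over the boundary, so inserting it preserves boundary
      data.\<close>
    define w where "w p = \<delta> ((fst p)(0 := 1 - fst p 0), snd p)" for p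
    have cw: "continuous_map ?D F w"
    proof -
      have "continuous_map ?D euclideanreal (\<lambda>p. fst p 0)"
        by (rule cm_cube_coord[OF n continuous_map_fst])
      then have "continuous_map ?D unit_interval (\<lambda>p. 1 - fst p 0)"
      proof (intro cm_unit continuous_intros)
        show "0 \<le> 1 - fst z 0 \<and> 1 - fst z 0 \<le> 1" if "z \<in> topspace ?D" for z
          using cube_bounds[of "fst z" n 0] that n by auto
      qed simp
      then show ?thesis
        unfolding w_def by (intro cm_comp[OF c\<delta>] cm_pair cm_update[OF n] continuous_map_fst continuous_map_snd)
    qed
    have wbd: "w (t, y) = y" if t: "t \<in> cube_boundary n" and y: "y \<in> topspace F" for t y
    proof -
      have tc: "t \<in> topspace (cube n)" using t cube_boundary_subset by blast
      have "t(0 := 1 - t 0) \<in> cube_boundary n"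
        by (rule update_in_boundary[OF tc n]) (use cube_bounds[OF tc n] t in auto)
      then show ?thesis by (simp add: w_def \<delta>bd y)
    qed
    \<comment> \<open>Inserting \<open>w\<close> into the fibre variable of \<open>E\<close> joins
      \<open>\<Gamma> (t, v' (t, y))\<close> to \<open>\<delta> (t, w (t, y))\<close>, which
      contracts to \<open>y\<close> relative to the boundary.\<close>
    define v' where "v' p = v0 (fst p, w p)" for p
    have cv': "continuous_map ?D F v'"
      unfolding v'_def by (intro cm_comp[OF v0] cm_pair continuous_map_fst cw)
    have v'bd: "v' (t, y) = v (t, y)" if "t \<in> cube_boundary n" "y \<in> topspace F" for t y
      using that by (simp add: v'_def wbd v0bd)
    have win: "w (t, y) \<in> topspace F" if "t \<in> topspace (cube n)" "y \<in> topspace F" for t y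
      using cm_range[OF cw, of "(t, y)"] that by simp
    let ?B' = "\<lambda>z. E (fst z, fst (snd z), w (snd z))"
    have "continuous_map ?D F (\<lambda>(t, y). \<Gamma> (t, v' (t, y)))"
      unfolding case_prod_unfold prod.collapse by (intro cm_comp[OF \<Gamma>] cm_pair continuous_map_fst cv')
    then have A: "homotopic_with (?P 0) ?D F (\<lambda>(t, y). \<Gamma> (t, v' (t, y))) (\<lambda>(t, y). \<Gamma> (t, v' (t, y)))"
      by (simp add: v'bd H0)
    have B: "continuous_map (prod_topology unit_interval ?D) F ?B'"
      by (intro cm_comp[OF E] cm_pair continuous_map_fst cm_comp[OF cw continuous_map_snd]) ((rule cmi)+)
    have D: "homotopic_with (?P 1) ?D F (\<lambda>(t, y). \<delta> (t, w (t, y))) snd"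
      using reversed_family_inverse[OF n c\<delta> \<delta>bd] by (simp add: w_def H1)
    have "?goal v' (\<lambda>(t, y). \<Gamma> (t, v' (t, y))) (\<lambda>(t, y). \<delta> (t, w (t, y))) ?B'"
      by (intro conjI cv' A B D) (simp_all add: E0 v'_def \<delta>_def wbd Ebd v0bd)
    then show ?thesis by blast
  qed
qed

lemma free_equivalence_homotopic:
  assumes f: "free_equivalence X Y f" and fg: "homotopic_with (\<lambda>_. True) X Y f g"
  shows "free_equivalence X Y g"
proof -
  obtain h where h: "continuous_map X Y f" "continuous_map Y X h"
    "homotopic_with (\<lambda>_. True) X X (h \<circ> f) id" "homotopic_with (\<lambda>_. True) Y Y (f \<circ> h) id"
    using f unfolding free_equivalence_def by blast
  note gf = homotopic_with_symD[OF fg]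
  have 1: "homotopic_with (\<lambda>_. True) X X (h \<circ> g) (h \<circ> f)"
    by (rule homotopic_with_compose_continuous_map_left[OF gf h(2)]) simp
  have 2: "homotopic_with (\<lambda>_. True) Y Y (g \<circ> h) (f \<circ> h)"
    by (rule homotopic_with_compose_continuous_map_right[OF gf h(2)]) simp
  show ?thesis
    unfolding free_equivalence_def
    using h(2) homotopic_with_imp_continuous_maps[OF fg] homotopic_with_trans[OF 1 h(3)] homotopic_with_trans[OF 2 h(4)]
    by (intro conjI exI[of _ h]) simp_all
qed

lemma based_imp_free_homotopic:
  "based_homotopic Z z W w p q \<Longrightarrow> homotopic_with (\<lambda>_. True) Z W p q"
  unfolding based_homotopic_def by (erule homotopic_with_mono) simp

lemma based_imp_free_equivalence:
  assumes "based_homotopy_equivalence X x Y y f"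
  shows "free_equivalence X Y f"
proof -
  obtain g where g: "f \<in> based_maps X x Y y" "g \<in> based_maps Y y X x"
    "based_homotopic X x X x (g \<circ> f) id" "based_homotopic Y y Y y (f \<circ> g) id"
    using assms by (rule based_homotopy_equivalenceE)
  show ?thesis
    unfolding free_equivalence_def
    using based_mapsD(1)[OF g(1)] based_mapsD(1)[OF g(2)] based_imp_free_homotopic[OF g(3)] based_imp_free_homotopic[OF g(4)]
    by (intro conjI exI[of _ g])
qed

lemma based_homotopy_equivalence_eq:
  assumes "based_homotopy_equivalence X x Y y f" "x \<in> topspace X" "\<And>z. z \<in> topspace X \<Longrightarrow> f z = g z"
  shows "based_homotopy_equivalence X x Y y g"
proof (rule based_homotopy_equivalence_homotopic[OF assms(1)])
  show "based_homotopic X x Y y f g"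
    by (rule based_homotopic_eq[OF _ assms(2,3)]) (use assms(1) in \<open>auto simp: based_homotopy_equivalence_def\<close>)
qed

lemma homeomorphism_imp_equivalence:
  assumes f: "f \<in> based_maps X x Y y" and g: "g \<in> based_maps Y y X x"
    and x: "x \<in> topspace X"
    and gf: "\<And>z. z \<in> topspace X \<Longrightarrow> g (f z) = z" and fg: "\<And>z. z \<in> topspace Y \<Longrightarrow> f (g z) = z"
  shows "based_homotopy_equivalence X x Y y f"
proof (rule based_homotopy_equivalenceI[OF f g])
  have y: "y \<in> topspace Y" using cm_range[OF based_mapsD(1)[OF f] x] based_mapsD(2)[OF f] by simp
  show "based_homotopic X x X x (g \<circ> f) id"
    by (rule based_homotopic_eq[OF based_maps_comp[OF f g] x]) (simp add: gf)
  show "based_homotopic Y y Y y (f \<circ> g) id"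
    by (rule based_homotopic_eq[OF based_maps_comp[OF g f] y]) (simp add: fg)
qed

text \<open>\<open>lifting\<close> with both \<open>W\<close> and \<open>L\<close> equal to the
  fibre. All fibre maps are free equivalences because a path in the base joins them to the one over
  \<open>x0\<close>. Prescribing a based inverse over \<open>x0\<close> makes the result based and
  again an equivalence there, so that the lemma applies to it in turn.\<close>

lemma (in cw_complex) fibrewise_right_inverse:
  assumes conn: "path_connected_space X" and x0: "x0 \<in> topspace X" "cdim x0 = 0" and f0: "f0 \<in> topspace F"
    and g: "continuous_map (prod_topology X F) F g"
    and eqv: "based_homotopy_equivalence F f0 F f0 (\<lambda>y. g (x0, y))"
  obtains h where "continuous_map (prod_topology X F) F h"
    "based_homotopy_equivalence F f0 F f0 (\<lambda>y. h (x0, y))"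
    "based_homotopic (prod_topology X F) (x0, f0) F f0 (\<lambda>p. g (fst p, h p)) snd"
proof -
  obtain k where k: "k \<in> based_maps F f0 F f0" "based_homotopic F f0 F f0 ((\<lambda>y. g (x0, y)) \<circ> k) id"
    "based_homotopy_equivalence F f0 F f0 k"
    using eqv by (rule based_homotopy_equivalenceE)
  obtain H0 where H0: "continuous_map (prod_topology unit_interval F) F H0"
    "\<And>z. H0 (0, z) = ((\<lambda>y. g (x0, y)) \<circ> k) z" "\<And>z. H0 (1, z) = id z" "\<And>t. 0 \<le> t \<Longrightarrow> t \<le> 1 \<Longrightarrow> H0 (t, f0) = f0"
    using k(2) by (rule based_homotopicE) auto
  have lift: "cell_lifting n F F F (\<lambda>z. g (\<phi> (fst z), snd z)) (\<lambda>z. snd (\<phi> (fst z), snd z))"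
    if \<phi>: "\<phi> \<in> C n" for n \<phi>
    unfolding snd_conv
  proof (rule family_cell_lifting)
    have "continuous_map (prod_topology (cube n) F) X (\<lambda>z. \<phi> (fst z))"
      by (rule cm_comp[OF cm_char[OF \<phi>] continuous_map_fst])
    then show "continuous_map (prod_topology (cube n) F) F (\<lambda>z. g (\<phi> (fst z), snd z))"
      by (intro cm_comp[OF g] cm_pair continuous_map_snd)
    fix t assume "t \<in> topspace (cube n)"
    then have "path_component_of X x0 (\<phi> t)"
      using conn x0 char_in[OF \<phi>] by (simp add: path_connected_space_iff_path_component)
    then obtain p where p: "pathin X p" "p 0 = x0" "p 1 = \<phi> t"
      unfolding path_component_of_def by blast
    have "homotopic_with (\<lambda>_. True) F F (\<lambda>y. g (x0, y)) (\<lambda>y. g (\<phi> t, y))"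
    proof (rule homotopicI[where h = "\<lambda>z. g (p (fst z), snd z)"])
      have "continuous_map unit_interval X p" using p(1) by (simp add: pathin_def)
      then show "continuous_map (prod_topology unit_interval F) F (\<lambda>z. g (p (fst z), snd z))"
        by (intro cm_comp[OF g] cm_pair continuous_map_snd cm_comp[OF _ continuous_map_fst])
    qed (simp_all add: p)
    then show "free_equivalence F F (\<lambda>y. (\<lambda>z. g (\<phi> (fst z), snd z)) (t, y))"
      using free_equivalence_homotopic[OF based_imp_free_equivalence[OF eqv]] by simp
  qed
  obtain v where v: "continuous_map (prod_topology X F) F v"
    "\<And>l. l \<in> topspace F \<Longrightarrow> v (x0, l) = k l"
    "homotopic_with (\<lambda>h. h (x0, f0) = f0) (prod_topology X F) F (\<lambda>p. g (fst p, v p)) snd"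
  proof (rule lifting[OF g continuous_map_snd lift x0 f0 based_mapsD(1)[OF k(1)] H0(1)])
    show "H0 (0, l) = g (x0, k l)" "H0 (1, l) = snd (x0, l)" for l
      by (simp_all add: H0)
  qed (use H0(4) in auto)
  show ?thesis
  proof (rule that[OF v(1)])
    show "based_homotopy_equivalence F f0 F f0 (\<lambda>y. v (x0, y))"
      by (rule based_homotopy_equivalence_eq[OF k(3) f0]) (simp add: v(2))
  qed (use v(3) in \<open>simp add: based_homotopic_def\<close>)
qed

lemma connected_based_CW_complexE:
  assumes "connected_based_CW_complex Y y"
  obtains C where "cw_complex Y C" "path_connected_space Y" "y \<in> topspace Y" "cw_complex.cdim C y = 0"
proof -
  obtain C where C: "CW_structure Y C" "connected_space Y" "y \<in> (\<Union>\<phi>\<in>C 0. \<phi> ` topspace (cube 0))"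
    using assms unfolding connected_based_CW_complex_def by (elim conjE exE)
  interpret cw_complex Y C by (rule cw_complex.intro) (rule C(1))
  obtain \<phi> t where \<phi>: "\<phi> \<in> C 0" "t \<in> topspace (cube 0)" "y = \<phi> t" using C(3) by blast
  have "t \<in> cube_interior 0" using \<phi>(2) by (simp add: cube_interior_def cube_boundary_0)
  then have "cdim y = 0" using cell_index_char(1)[OF \<phi>(1)] \<phi>(3) by simp
  moreover have "y \<in> topspace Y" using char_in[OF \<phi>(1,2)] \<phi>(3) by simp
  ultimately show ?thesis
    using that[OF cw_complex_axioms path_connected_if_connected[OF C(2)]] by simp
qed

text \<open>The base \<open>A\<close> has only the homotopy type of a complex. The family is pulled
  back to \<open>Y\<close> along \<open>\<beta>\<close>, inverted there, and the inverse pulled back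
  along \<open>\<alpha>\<close>; a homotopy from \<open>\<beta> \<circ> \<alpha>\<close> to the
  identity corrects the base variable. The result satisfies the hypotheses again, so two right
  inverses are available.\<close>

lemma fibrewise_equivalence:
  fixes A :: "'a topology" and Y :: "'b topology" and F :: "'f topology"
  assumes Y: "connected_based_CW_complex Y y" and AY: "\<exists>h. based_homotopy_equivalence A a Y y h"
    and a: "a \<in> topspace A" and f0: "f0 \<in> topspace F"
    and g: "continuous_map (prod_topology A F) F g"
    and eqv: "based_homotopy_equivalence F f0 F f0 (\<lambda>z. g (a, z))"
  shows "based_homotopy_equivalence (prod_topology A F) (a, f0) (prod_topology A F) (a, f0) (\<lambda>p. (fst p, g p))"
proof -
  obtain C where C: "cw_complex Y C" and conn: "path_connected_space Y" and y: "y \<in> topspace Y" "cw_complex.cdim C y = 0"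
    using Y by (rule connected_based_CW_complexE)
  interpret cw_complex Y C by (rule C)
  obtain \<alpha> where "based_homotopy_equivalence A a Y y \<alpha>" using AY by blast
  then obtain \<beta> where \<alpha>: "\<alpha> \<in> based_maps A a Y y" and \<beta>: "\<beta> \<in> based_maps Y y A a"
    and \<beta>\<alpha>: "based_homotopic A a A a (\<beta> \<circ> \<alpha>) id"
    by (rule based_homotopy_equivalenceE)
  let ?P = "prod_topology A F"
  let ?Q = "prod_topology Y F"
  have step: "\<exists>h. continuous_map ?P F h \<and> based_homotopy_equivalence F f0 F f0 (\<lambda>z. h (a, z)) \<and>
      based_homotopic ?P (a, f0) F f0 (\<lambda>p. g (fst p, h p)) snd"
    if g: "continuous_map ?P F g" and eqv: "based_homotopy_equivalence F f0 F f0 (\<lambda>z. g (a, z))" for g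
  proof -
    have cg': "continuous_map ?Q F (\<lambda>p. g (\<beta> (fst p), snd p))"
      by (intro cm_comp[OF g] cm_pair cm_comp[OF based_mapsD(1)[OF \<beta>] continuous_map_fst] continuous_map_snd)
    obtain h where h: "continuous_map ?Q F h" "based_homotopy_equivalence F f0 F f0 (\<lambda>z. h (y, z))"
      "based_homotopic ?Q (y, f0) F f0 (\<lambda>p. g (\<beta> (fst p), h p)) snd"
      by (rule fibrewise_right_inverse[OF conn y f0 cg']) (use eqv based_mapsD(2)[OF \<beta>] in auto)
    define k where "k p = h (\<alpha> (fst p), snd p)" for p
    have c\<alpha>: "(\<lambda>p. (\<alpha> (fst p), snd p)) \<in> based_maps ?P (a, f0) ?Q (y, f0)"
      by (rule based_mapsI)
        (use based_mapsD[OF \<alpha>] in \<open>auto intro!: cm_pair cm_comp[OF based_mapsD(1)[OF \<alpha>] continuous_map_fst] continuous_map_snd\<close>)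
    have ck: "continuous_map ?P F k"
      unfolding k_def using cm_comp[OF h(1) based_mapsD(1)[OF c\<alpha>]] .
    have "k (a, f0) = f0"
      using h(2) based_mapsD(2)[OF \<alpha>] by (auto simp: k_def based_homotopy_equivalence_def based_maps_def)
    obtain R where R: "continuous_map (prod_topology unit_interval A) A R"
      "\<And>z. R (0, z) = (\<beta> \<circ> \<alpha>) z" "\<And>z. R (1, z) = id z" "\<And>t. 0 \<le> t \<Longrightarrow> t \<le> 1 \<Longrightarrow> R (t, a) = a"
      using \<beta>\<alpha> by (rule based_homotopicE) auto
    have "based_homotopic ?P (a, f0) F f0 (\<lambda>p. g (\<beta> (\<alpha> (fst p)), k p)) (\<lambda>p. g (fst p, k p))"
    proof (rule based_homotopicI[where h = "\<lambda>z. g (R (fst z, fst (snd z)), k (snd z))"])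
      have "continuous_map (prod_topology unit_interval ?P) A (\<lambda>z. R (fst z, fst (snd z)))"
        by (rule cm_comp[OF R(1)], (rule cmi)+)
      then show "continuous_map (prod_topology unit_interval ?P) F (\<lambda>z. g (R (fst z, fst (snd z)), k (snd z)))"
        by (intro cm_comp[OF g] cm_pair cm_comp[OF ck continuous_map_snd])
      have "g (a, f0) = f0" using eqv by (auto simp: based_homotopy_equivalence_def based_maps_def)
      then show "g (R (fst (t, a, f0), fst (snd (t, a, f0))), k (snd (t, a, f0))) = f0" if "0 \<le> t" "t \<le> 1" for t
        using R(4)[OF that] \<open>k (a, f0) = f0\<close> by simp
    qed (use a f0 R in auto)
    from based_homotopic_sym[OF this]
    have gk: "based_homotopic ?P (a, f0) F f0 (\<lambda>p. g (fst p, k p)) snd"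
    proof (rule based_homotopic_trans)
      show "based_homotopic ?P (a, f0) F f0 (\<lambda>p. g (\<beta> (\<alpha> (fst p)), k p)) snd"
        using based_homotopic_comp_right[OF h(3) c\<alpha>] by (simp add: o_def k_def)
    qed
    have eqk: "based_homotopy_equivalence F f0 F f0 (\<lambda>z. k (a, z))"
      using h(2) based_mapsD(2)[OF \<alpha>] by (simp add: k_def)
    show ?thesis by (intro exI[of _ k] conjI ck gk eqk)
  qed
  have total_map: "(\<lambda>p. (fst p, g p)) \<in> based_maps ?P (a, f0) ?P (a, f0)"
    if "continuous_map ?P F g" "based_homotopy_equivalence F f0 F f0 (\<lambda>z. g (a, z))" for g
    using that by (auto simp: based_maps_def based_homotopy_equivalence_def intro!: cm_pair continuous_map_fst)
  have total: "based_homotopic ?P (a, f0) ?P (a, f0) ((\<lambda>p. (fst p, g p)) \<circ> (\<lambda>p. (fst p, h p))) id"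
    if hyp: "based_homotopic ?P (a, f0) F f0 (\<lambda>p. g (fst p, h p)) snd" for g h
  proof -
    obtain R where R: "continuous_map (prod_topology unit_interval ?P) F R"
      "\<And>z. R (0, z) = g (fst z, h z)" "\<And>z. R (1, z) = snd z" "\<And>t. 0 \<le> t \<Longrightarrow> t \<le> 1 \<Longrightarrow> R (t, (a, f0)) = f0"
      using hyp by (rule based_homotopicE) auto
    have c: "continuous_map (prod_topology unit_interval ?P) ?P (\<lambda>z. (fst (snd z), R z))"
      by (intro cm_pair R(1)) ((rule cmi)+)
    show ?thesis
      by (rule based_homotopicI[OF _ c]) (use a f0 R in auto)
  qed
  obtain h where h: "continuous_map ?P F h" "based_homotopy_equivalence F f0 F f0 (\<lambda>z. h (a, z))"
    "based_homotopic ?P (a, f0) F f0 (\<lambda>p. g (fst p, h p)) snd"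
    using step[OF g eqv] by blast
  obtain k where k: "continuous_map ?P F k" "based_homotopy_equivalence F f0 F f0 (\<lambda>z. k (a, z))"
    "based_homotopic ?P (a, f0) F f0 (\<lambda>p. h (fst p, k p)) snd"
    using step[OF h(1,2)] by blast
  show ?thesis
    by (rule based_homotopy_equivalence_right_inverses[OF total_map[OF g eqv] total_map[OF h(1,2)] total_map[OF k(1,2)]
          total[OF h(3)] total[OF k(3)]])
qed

text \<open>One base factor is added at a time, the fibre being the product of the factors treated
  before. In this way the base is always a single factor with its own complex \<open>Y j\<close>,
  and no complex equivalent to a product has to be produced.\<close>

lemma component_equivalence:
  fixes X :: "'i \<Rightarrow> 'a topology" and Y :: "'i \<Rightarrow> 'b topology"
  assumes "finite S" "k \<notin> S"
    and x: "\<And>j. j \<in> insert k S \<Longrightarrow> x j \<in> topspace (X j)"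
    and Y: "\<And>j. j \<in> S \<Longrightarrow> connected_based_CW_complex (Y j) (y j)"
    and XY: "\<And>j. j \<in> S \<Longrightarrow> \<exists>h. based_homotopy_equivalence (X j) (x j) (Y j) (y j) h"
    and f: "continuous_map (product_topology X (insert k S)) (X k) f"
    and eqv: "based_homotopy_equivalence (X k) (x k) (X k) (x k) (\<lambda>u. f (restrict (x(k := u)) (insert k S)))"
  shows "based_homotopy_equivalence (product_topology X (insert k S)) (restrict x (insert k S))
      (product_topology X (insert k S)) (restrict x (insert k S)) (\<lambda>z. z(k := f z))"
  using assms(1,2) x Y XY f eqv
proof (induction S arbitrary: f rule: finite_induct)
  case empty
  let ?P = "product_topology X {k}" and ?p = "restrict x {k}"
  have xk: "x k \<in> topspace (X k)" using empty.prems(2) by simp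
  have p: "?p \<in> topspace ?P" using xk by auto
  define \<alpha> where "\<alpha> u = restrict (x(k := u)) {k}" for u
  have ext: "z \<in> topspace ?P \<Longrightarrow> \<alpha> (z k) = z" for z
    by (auto simp: \<alpha>_def PiE_def extensional_def restrict_def fun_eq_iff)
  have \<alpha>: "\<alpha> \<in> based_maps (X k) (x k) ?P ?p"
    by (rule based_mapsI) (auto simp: \<alpha>_def intro!: cm_product cm_id)
  have \<beta>: "(\<lambda>z. z k) \<in> based_maps ?P ?p (X k) (x k)"
    by (rule based_mapsI) (auto intro!: cm_coord cm_id)
  have 1: "based_homotopy_equivalence (X k) (x k) ?P ?p \<alpha>"
    by (rule homeomorphism_imp_equivalence[OF \<alpha> \<beta> xk]) (use ext in \<open>auto simp: \<alpha>_def\<close>)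
  have 2: "based_homotopy_equivalence ?P ?p (X k) (x k) (\<lambda>z. z k)"
    by (rule homeomorphism_imp_equivalence[OF \<beta> \<alpha> p]) (use ext in \<open>auto simp: \<alpha>_def\<close>)
  have 3: "based_homotopy_equivalence (X k) (x k) (X k) (x k) (\<lambda>u. f (\<alpha> u))"
    using empty.prems(6) unfolding \<alpha>_def .
  have "based_homotopy_equivalence ?P ?p ?P ?p (\<alpha> \<circ> ((\<lambda>u. f (\<alpha> u)) \<circ> (\<lambda>z. z k)))"
    by (rule based_homotopy_equivalence_comp[OF based_homotopy_equivalence_comp[OF 2 3] 1])
  then show ?case
  proof (rule based_homotopy_equivalence_eq[OF _ p])
    show "(\<alpha> \<circ> ((\<lambda>u. f (\<alpha> u)) \<circ> (\<lambda>z. z k))) z = z(k := f z)" if "z \<in> topspace ?P" for z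
    proof -
      have "z i = undefined" if "i \<noteq> k" for i
        using \<open>z \<in> topspace ?P\<close> that by (auto simp: PiE_def extensional_def)
      then show ?thesis by (auto simp: ext[OF that]) (auto simp: \<alpha>_def fun_eq_iff)
    qed
  qed
next
  case (insert j S)
  let ?T = "insert k S"
  let ?A = "X j" and ?F = "product_topology X ?T" and ?f0 = "restrict x ?T"
  let ?P = "product_topology X (insert k (insert j S))" and ?p = "restrict x (insert k (insert j S))"
  have jk: "j \<noteq> k" "j \<notin> ?T" "k \<notin> S" using insert.hyps insert.prems by auto
  have ins: "insert k (insert j S) = insert j ?T" by blast
  have xj: "x j \<in> topspace ?A" and f0: "?f0 \<in> topspace ?F" and p: "?p \<in> topspace ?P"
    using insert.prems(2) by auto
  \<comment> \<open>\<open>e\<close> and \<open>d\<close> are inverse homeomorphisms that split off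
    coordinate \<open>j\<close>. Under them the map becomes fibrewise over the factor
    \<open>j\<close>, with fibre component \<open>g\<close>.\<close>
  define e where "e q = (snd q)(j := fst q)" for q :: "'a \<times> ('i \<Rightarrow> 'a)"
  define d where "d w = (w j, restrict w ?T)" for w :: "'i \<Rightarrow> 'a"
  have ce: "continuous_map (prod_topology ?A ?F) ?P e"
    unfolding ins
  proof (rule cm_product)
    show "e z \<in> extensional (insert j ?T)" if "z \<in> topspace (prod_topology ?A ?F)" for z
      using that by (auto simp: e_def PiE_def extensional_def)
    show "continuous_map (prod_topology ?A ?F) (X i) (\<lambda>z. e z i)" if "i \<in> insert j ?T" for i
    proof (cases "i = j")
      case True
      then show ?thesis by (simp add: e_def continuous_map_fst)
    next
      case False
      then have "i \<in> ?T" using that by blast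
      from cm_coord[OF continuous_map_snd this]
      have "continuous_map (prod_topology ?A ?F) (X i) (\<lambda>z. snd z i)" .
      then show ?thesis using False by (simp add: e_def)
    qed
  qed
  have cd: "continuous_map ?P (prod_topology ?A ?F) d"
    unfolding d_def ins by (intro cm_pair cm_product) (auto intro!: cm_coord[OF cm_id])
  have e: "e \<in> based_maps (prod_topology ?A ?F) (x j, ?f0) ?P ?p"
    by (rule based_mapsI[OF ce]) (auto simp: e_def fun_eq_iff restrict_def)
  have d: "d \<in> based_maps ?P ?p (prod_topology ?A ?F) (x j, ?f0)"
    by (rule based_mapsI[OF cd]) (auto simp: d_def fun_eq_iff restrict_def)
  have q0: "(x j, ?f0) \<in> topspace (prod_topology ?A ?F)" using xj f0 by simp
  have de: "d (e z) = z" if "z \<in> topspace (prod_topology ?A ?F)" for z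
  proof -
    have "snd z \<in> extensional ?T" using that by (auto simp: PiE_def)
    then have "restrict ((snd z)(j := fst z)) ?T = snd z"
      using jk(2) by (intro ext) (auto simp: restrict_def extensional_def)
    then show ?thesis by (simp add: d_def e_def prod_eq_iff)
  qed
  have ed: "e (d w) = w" if "w \<in> topspace ?P" for w
  proof -
    have "w \<in> extensional (insert j ?T)" using that by (auto simp: PiE_def ins)
    then have "(restrict w ?T)(j := w j) = w"
      using jk(2) by (intro ext) (auto simp: restrict_def extensional_def)
    then show ?thesis by (simp add: d_def e_def)
  qed
  have eqe: "based_homotopy_equivalence (prod_topology ?A ?F) (x j, ?f0) ?P ?p e"
    by (rule homeomorphism_imp_equivalence[OF e d q0]) (fact de, fact ed)
  have eqd: "based_homotopy_equivalence ?P ?p (prod_topology ?A ?F) (x j, ?f0) d"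
    by (rule homeomorphism_imp_equivalence[OF d e p]) (fact ed, fact de)
  define g where "g q = (snd q)(k := f (e q))" for q
  have cfe: "continuous_map (prod_topology ?A ?F) (X k) (\<lambda>q. f (e q))"
    by (rule cm_comp[OF insert.prems(5) ce])
  have cg: "continuous_map (prod_topology ?A ?F) ?F g"
  proof (rule cm_product)
    show "g z \<in> extensional ?T" if "z \<in> topspace (prod_topology ?A ?F)" for z
      using that by (auto simp: g_def PiE_def extensional_def)
    show "continuous_map (prod_topology ?A ?F) (X i) (\<lambda>z. g z i)" if "i \<in> ?T" for i
    proof (cases "i = k")
      case True
      then show ?thesis using cfe by (simp add: g_def)
    next
      case False
      from cm_coord[OF continuous_map_snd that]
      have "continuous_map (prod_topology ?A ?F) (X i) (\<lambda>z. snd z i)" .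
      then show ?thesis using False by (simp add: g_def)
    qed
  qed
  have "based_homotopy_equivalence ?F ?f0 ?F ?f0 (\<lambda>z. z(k := f (e (x j, z))))"
  proof (rule insert.IH[OF jk(3)])
    have "continuous_map ?F (prod_topology ?A ?F) (\<lambda>z. (x j, z))"
      by (intro cm_pair cm_id) (use xj in simp)
    from cm_comp[OF cfe this] show "continuous_map ?F (X k) (\<lambda>z. f (e (x j, z)))" by simp
    have "e (x j, restrict (x(k := u)) ?T) = restrict (x(k := u)) (insert k (insert j S))" for u
      using jk by (auto simp: e_def fun_eq_iff restrict_def)
    then show "based_homotopy_equivalence (X k) (x k) (X k) (x k) (\<lambda>u. f (e (x j, restrict (x(k := u)) ?T)))"
      using insert.prems(6) by (simp only:)
  qed (use insert.prems(2-4) in auto)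
  then have eqg: "based_homotopy_equivalence ?F ?f0 ?F ?f0 (\<lambda>z. g (x j, z))"
    by (simp add: g_def)
  have "connected_based_CW_complex (Y j) (y j)" "\<exists>h. based_homotopy_equivalence ?A (x j) (Y j) (y j) h"
    using insert.prems(3,4) by auto
  note 1 = fibrewise_equivalence[OF this xj f0 cg eqg]
  have "based_homotopy_equivalence ?P ?p ?P ?p (e \<circ> ((\<lambda>q. (fst q, g q)) \<circ> d))"
    by (rule based_homotopy_equivalence_comp[OF based_homotopy_equivalence_comp[OF eqd 1] eqe])
  then show ?case
  proof (rule based_homotopy_equivalence_eq[OF _ p])
    show "(e \<circ> ((\<lambda>q. (fst q, g q)) \<circ> d)) w = w(k := f w)" if "w \<in> topspace ?P" for w
    proof -
      have "e (fst (d w), g (d w)) = (e (d w))(k := f (e (d w)))"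
        using jk(1) by (simp add: e_def d_def g_def fun_upd_twist)
      then show ?thesis using ed[OF that] by simp
    qed
  qed
qed

section \<open>Homotopies of cubes relative to the boundary\<close>

definition rel_homotopic :: "nat \<Rightarrow> 'a topology \<Rightarrow> ((nat \<Rightarrow> real) \<Rightarrow> 'a) \<Rightarrow> ((nat \<Rightarrow> real) \<Rightarrow> 'a) \<Rightarrow> bool" where
  "rel_homotopic n Z f g \<longleftrightarrow> homotopic_with (\<lambda>h. \<forall>t\<in>cube_boundary n. h t = f t) (cube n) Z f g"

lemma rel_homotopicI:
  assumes "continuous_map (prod_topology unit_interval (cube n)) Z h"
    and "\<And>t. t \<in> topspace (cube n) \<Longrightarrow> h (0, t) = f t" "\<And>t. t \<in> topspace (cube n) \<Longrightarrow> h (1, t) = g t"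
    and "\<And>s t. 0 \<le> s \<Longrightarrow> s \<le> 1 \<Longrightarrow> t \<in> cube_boundary n \<Longrightarrow> h (s, t) = f t"
  shows "rel_homotopic n Z f g"
  unfolding rel_homotopic_def
proof (rule homotopic_withI[OF assms(1-3)])
  show "(\<forall>t\<in>cube_boundary n. h t = f t) \<longleftrightarrow> (\<forall>t\<in>cube_boundary n. k t = f t)"
    if "\<And>x. x \<in> topspace (cube n) \<Longrightarrow> h x = k x" for h k
    using that cube_boundary_subset[of n] by (intro ball_cong refl) auto
qed (use assms(4) in auto)

lemma rel_homotopicE:
  assumes "rel_homotopic n Z f g"
  obtains h where "continuous_map (prod_topology unit_interval (cube n)) Z h"
    "\<And>t. h (0, t) = f t" "\<And>t. h (1, t) = g t"
    "\<And>s t. 0 \<le> s \<Longrightarrow> s \<le> 1 \<Longrightarrow> t \<in> cube_boundary n \<Longrightarrow> h (s, t) = f t"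
  using assms unfolding rel_homotopic_def homotopic_with_def by auto

lemma rel_homotopic_boundary: "rel_homotopic n Z f g \<Longrightarrow> t \<in> cube_boundary n \<Longrightarrow> g t = f t"
  unfolding rel_homotopic_def by (drule homotopic_with_imp_property) blast

lemma rel_homotopic_sym: "rel_homotopic n Z f g \<Longrightarrow> rel_homotopic n Z g f"
  unfolding rel_homotopic_def
  by (frule homotopic_with_imp_property, subst homotopic_with_sym, erule homotopic_with_mono) auto

lemma rel_homotopic_trans [trans]:
  assumes fg: "rel_homotopic n Z f g" and gh: "rel_homotopic n Z g h"
  shows "rel_homotopic n Z f h"
proof -
  have "homotopic_with (\<lambda>h. \<forall>t\<in>cube_boundary n. h t = f t) (cube n) Z g h"
    using gh unfolding rel_homotopic_def
    by (rule homotopic_with_mono) (use rel_homotopic_boundary[OF fg] in auto)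
  then show ?thesis using fg homotopic_with_trans unfolding rel_homotopic_def by blast
qed

lemma rel_homotopic_comp:
  assumes "rel_homotopic n Z f g" "continuous_map Z W e"
  shows "rel_homotopic n W (e \<circ> f) (e \<circ> g)"
  using assms(1) unfolding rel_homotopic_def
  by (rule homotopic_with_compose_continuous_map_left[OF _ assms(2)]) simp

lemma rel_homotopic_eq:
  assumes "continuous_map (cube n) Z f" "\<And>t. t \<in> topspace (cube n) \<Longrightarrow> f t = g t"
  shows "rel_homotopic n Z f g"
  unfolding rel_homotopic_def
  by (rule homotopic_with_equal) (use assms cube_boundary_subset[of n] in force)+

lemma cm_end:
  assumes "continuous_map (prod_topology unit_interval X) Z F" "0 \<le> s" "s \<le> 1"
  shows "continuous_map X Z (\<lambda>t. F (s, t))"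
  by (rule cm_comp[OF assms(1)]) (use assms(2,3) in \<open>auto intro!: cm_pair cm_id\<close>)

lemma cm_reverse:
  assumes "continuous_map (prod_topology unit_interval X) Z F"
  shows "continuous_map (prod_topology unit_interval X) Z (\<lambda>z. F (1 - fst z, snd z))"
  by (intro cm_comp[OF assms] cm_pair cm_scaled_coord continuous_map_snd)

lemma cm_homotopy_from_cube_bd:
  assumes "continuous_map (prod_topology unit_interval (cube n)) Z f"
  shows "continuous_map (prod_topology unit_interval (cube_bd n)) Z f"
proof -
  have "continuous_map (prod_topology unit_interval (cube_bd n)) (prod_topology unit_interval (cube n)) (\<lambda>z. (fst z, snd z))"
    by (intro cm_pair continuous_map_fst cm_cube_bd continuous_map_snd)
  from cm_comp[OF assms this] show ?thesis by simp
qed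

lemma cube_homotopy_extension_simple:
  assumes f: "continuous_map (cube n) Z f"
    and h: "continuous_map (prod_topology unit_interval (cube_bd n)) Z h"
    and h0: "\<And>t. t \<in> cube_boundary n \<Longrightarrow> h (0, t) = f t"
  obtains F where "continuous_map (prod_topology unit_interval (cube n)) Z F"
    and "\<And>t. t \<in> topspace (cube n) \<Longrightarrow> F (0, t) = f t"
    and "\<And>s t. \<lbrakk>0 \<le> s; s \<le> 1; t \<in> cube_boundary n\<rbrakk> \<Longrightarrow> F (s, t) = h (s, t)"
proof -
  let ?L = "discrete_topology {()}"
  have 1: "continuous_map (prod_topology (cube n) ?L) Z (\<lambda>p. f (fst p))"
    by (rule cm_comp[OF f continuous_map_fst])
  have 2: "continuous_map (prod_topology unit_interval (prod_topology (cube_bd n) ?L)) Z (\<lambda>p. h (fst p, fst (snd p)))"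
    by (rule cm_comp[OF h], (rule cmi)+)
  obtain F where F: "continuous_map (prod_topology unit_interval (prod_topology (cube n) ?L)) Z F"
    "\<And>t l. t \<in> topspace (cube n) \<Longrightarrow> F (0, t, l) = (\<lambda>p. f (fst p)) (t, l)"
    "\<And>s t l. \<lbrakk>0 \<le> s; s \<le> 1; t \<in> cube_boundary n; l \<in> topspace ?L\<rbrakk> \<Longrightarrow> F (s, t, l) = (\<lambda>p. h (fst p, fst (snd p))) (s, t, l)"
    by (rule cube_homotopy_extension[OF 1 2]) (auto simp: h0)
  show ?thesis
  proof (rule that[of "\<lambda>z. F (fst z, snd z, ())"])
    show "continuous_map (prod_topology unit_interval (cube n)) Z (\<lambda>z. F (fst z, snd z, ()))"
      by (rule cm_comp[OF F(1)]) (intro cm_pair continuous_map_fst continuous_map_snd, simp)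
  qed (simp_all add: F)
qed

text \<open>On the boundary the homotopy runs along a path and back; this path is shrunk by homotopy
  extension with time as the parameter.\<close>

lemma rel_homotopic_if_symmetric:
  assumes \<Gamma>: "continuous_map (prod_topology unit_interval (cube n)) Z \<Gamma>"
    and sym: "\<And>\<tau> t. 0 \<le> \<tau> \<Longrightarrow> \<tau> \<le> 1 \<Longrightarrow> t \<in> cube_boundary n \<Longrightarrow> \<Gamma> (1 - \<tau>, t) = \<Gamma> (\<tau>, t)"
  shows "rel_homotopic n Z (\<lambda>t. \<Gamma> (0, t)) (\<lambda>t. \<Gamma> (1, t))"
proof -
  \<comment> \<open>At \<open>\<sigma> = 0\<close> this is the fold of the interval, which by
    symmetry describes \<open>\<Gamma>\<close> on the boundary at all times. Capping it, from 1/2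
    down to 0, shortens the path and its return until the boundary rests.\<close>
  define q where "q \<sigma> \<tau> = min (min \<tau> (1 - \<tau>)) ((1 - \<sigma>) / 2)" for \<sigma> \<tau> :: real
  have q01: "0 \<le> q \<sigma> \<tau> \<and> q \<sigma> \<tau> \<le> 1" if "0 \<le> \<sigma>" "\<sigma> \<le> 1" "0 \<le> \<tau>" "\<tau> \<le> 1" for \<sigma> \<tau>
    using that by (auto simp: q_def)
  have f: "continuous_map (prod_topology (cube n) unit_interval) Z (\<lambda>p. \<Gamma> (snd p, fst p))"
    by (rule cm_comp[OF \<Gamma>], (rule cmi)+)
  let ?T = "prod_topology unit_interval (prod_topology (cube_bd n) unit_interval)"
  have h: "continuous_map ?T Z (\<lambda>z. \<Gamma> (q (fst z) (snd (snd z)), fst (snd z)))"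
  proof (intro cm_comp[OF \<Gamma>] cm_pair)
    have "continuous_map ?T unit_interval (\<lambda>z. snd (snd z))" by (rule cmi)+
    then have "continuous_map ?T euclideanreal (\<lambda>z. q (fst z) (snd (snd z)))"
      unfolding q_def by (intro continuous_intros cm_real[OF continuous_map_fst] cm_real) auto
    then show "continuous_map ?T unit_interval (\<lambda>z. q (fst z) (snd (snd z)))"
    proof (rule cm_unit)
      show "0 \<le> q (fst z) (snd (snd z)) \<and> q (fst z) (snd (snd z)) \<le> 1" if "z \<in> topspace ?T" for z
        using that by (intro q01) auto
    qed
    show "continuous_map ?T (cube n) (\<lambda>z. fst (snd z))"
      by (rule cm_cube_bd) ((rule cmi)+)
  qed
  obtain F where F: "continuous_map (prod_topology unit_interval (prod_topology (cube n) unit_interval)) Z F"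
    "\<And>t l. t \<in> topspace (cube n) \<Longrightarrow> F (0, t, l) = (\<lambda>p. \<Gamma> (snd p, fst p)) (t, l)"
    "\<And>s t l. \<lbrakk>0 \<le> s; s \<le> 1; t \<in> cube_boundary n; l \<in> topspace unit_interval\<rbrakk> \<Longrightarrow>
        F (s, t, l) = (\<lambda>z. \<Gamma> (q (fst z) (snd (snd z)), fst (snd z))) (s, t, l)"
  proof (rule cube_homotopy_extension[OF f h])
    fix t \<tau> assume t: "t \<in> cube_boundary n" and "\<tau> \<in> topspace unit_interval"
    then have \<tau>: "0 \<le> \<tau>" "\<tau> \<le> 1" by auto
    have "q 0 \<tau> = \<tau> \<or> q 0 \<tau> = 1 - \<tau>" by (auto simp: q_def min_def)
    then show "\<Gamma> (q (fst (0, t, \<tau>)) (snd (snd (0, t, \<tau>))), fst (snd (0, t, \<tau>))) = \<Gamma> (snd (t, \<tau>), fst (t, \<tau>))"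
      using sym[OF \<tau> t] by auto
  qed (auto simp: that)
  let ?I = "prod_topology unit_interval (cube n)"
  have e0: "\<Gamma> (1, t) = \<Gamma> (0, t)" if "t \<in> cube_boundary n" for t using sym[of 0 t] that by simp
  have q_ends: "q \<sigma> 0 = 0" "q \<sigma> 1 = 0" "q 1 \<tau> = 0" if "\<sigma> \<le> 1" "0 \<le> \<tau>" "\<tau> \<le> 1" for \<sigma> \<tau>
    using that by (auto simp: q_def)
  \<comment> \<open>In the square of times, the detour runs along the side
    \<open>\<tau> = 0\<close>, then along \<open>\<sigma> = 1\<close>, then back along
    \<open>\<tau> = 1\<close>. On these three sides \<open>q\<close> vanishes, so the boundary is
    fixed throughout.\<close>
  have 1: "rel_homotopic n Z (\<lambda>t. \<Gamma> (0, t)) (\<lambda>t. F (1, t, 0))"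
  proof (rule rel_homotopicI[where h = "\<lambda>z. F (fst z, snd z, 0)"])
    show "continuous_map ?I Z (\<lambda>z. F (fst z, snd z, 0))"
      by (rule cm_comp[OF F(1)]) (intro cm_pair continuous_map_fst continuous_map_snd, simp)
  qed (auto simp: F q_ends)
  have 2: "rel_homotopic n Z (\<lambda>t. F (1, t, 0)) (\<lambda>t. F (1, t, 1))"
  proof (rule rel_homotopicI[where h = "\<lambda>z. F (1, snd z, fst z)"])
    show "continuous_map ?I Z (\<lambda>z. F (1, snd z, fst z))"
      by (rule cm_comp[OF F(1)]) (intro cm_pair continuous_map_fst continuous_map_snd, simp)
  qed (auto simp: F q_ends)
  have 3: "rel_homotopic n Z (\<lambda>t. \<Gamma> (1, t)) (\<lambda>t. F (1, t, 1))"
  proof (rule rel_homotopicI[where h = "\<lambda>z. F (fst z, snd z, 1)"])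
    show "continuous_map ?I Z (\<lambda>z. F (fst z, snd z, 1))"
      by (rule cm_comp[OF F(1)]) (intro cm_pair continuous_map_fst continuous_map_snd, simp)
  qed (auto simp: F q_ends e0)
  show ?thesis by (rule rel_homotopic_trans[OF 1 rel_homotopic_trans[OF 2 rel_homotopic_sym[OF 3]]])
qed

text \<open>Run \<open>F\<close>, then the given relative homotopy, then \<open>G\<close> backwards.
  On the boundary this follows a path, rests, and returns along the same path, so the symmetric case
  applies.\<close>

lemma rel_homotopic_transport:
  assumes F: "continuous_map (prod_topology unit_interval (cube n)) Z F"
    and G: "continuous_map (prod_topology unit_interval (cube n)) Z G"
    and bd: "\<And>s t. 0 \<le> s \<Longrightarrow> s \<le> 1 \<Longrightarrow> t \<in> cube_boundary n \<Longrightarrow> G (s, t) = F (s, t)"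
    and rel: "rel_homotopic n Z (\<lambda>t. F (1, t)) (\<lambda>t. G (1, t))"
  shows "rel_homotopic n Z (\<lambda>t. F (0, t)) (\<lambda>t. G (0, t))"
proof -
  obtain R where R: "continuous_map (prod_topology unit_interval (cube n)) Z R"
    "\<And>t. R (0, t) = F (1, t)" "\<And>t. R (1, t) = G (1, t)"
    "\<And>s t. 0 \<le> s \<Longrightarrow> s \<le> 1 \<Longrightarrow> t \<in> cube_boundary n \<Longrightarrow> R (s, t) = F (1, t)"
    using rel by (rule rel_homotopicE) auto
  define \<Gamma> where "\<Gamma> = concat3 F R (\<lambda>z. G (1 - fst z, snd z))"
  have "continuous_map (prod_topology unit_interval (cube n)) Z \<Gamma>"
    unfolding \<Gamma>_def by (rule cm_concat3[OF F R(1) cm_reverse[OF G]]) (simp_all add: R)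
  moreover have "\<Gamma> (1 - \<tau>, t) = \<Gamma> (\<tau>, t)" if \<tau>: "0 \<le> \<tau>" "\<tau> \<le> 1" and t: "t \<in> cube_boundary n" for \<tau> t
  proof -
    have *: "\<Gamma> (\<tau>, t) = F (min 1 (3 * min \<tau> (1 - \<tau>)), t)" if \<tau>: "0 \<le> \<tau>" "\<tau> \<le> 1" for \<tau>
    proof -
      consider "\<tau> \<le> 1/3" | "1/3 < \<tau>" "\<tau> \<le> 2/3" | "2/3 < \<tau>" by linarith
      then show ?thesis
      proof cases
        case 1
        then show ?thesis using \<tau> by (simp add: \<Gamma>_def concat3_def)
      next
        case 2
        then have "min 1 (3 * min \<tau> (1 - \<tau>)) = 1" by (auto simp: min_def)
        then show ?thesis using 2 t R(4) by (simp add: \<Gamma>_def concat3_def)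
      next
        case 3
        then have "min 1 (3 * min \<tau> (1 - \<tau>)) = 1 - max 0 (min 1 (3 * \<tau> - 2))" using \<tau> by (auto simp: min_def max_def)
        then show ?thesis using 3 t \<tau> bd by (simp add: \<Gamma>_def concat3_def)
      qed
    qed
    show ?thesis using *[OF \<tau>] *[of "1 - \<tau>"] \<tau> by (simp add: min.commute)
  qed
  ultimately have "rel_homotopic n Z (\<lambda>t. \<Gamma> (0, t)) (\<lambda>t. \<Gamma> (1, t))"
    by (rule rel_homotopic_if_symmetric)
  then show ?thesis by (simp add: \<Gamma>_def concat3_def)
qed

lemma rel_homotopic_transport':
  assumes F: "continuous_map (prod_topology unit_interval (cube n)) Z F"
    and G: "continuous_map (prod_topology unit_interval (cube n)) Z G"
    and bd: "\<And>s t. 0 \<le> s \<Longrightarrow> s \<le> 1 \<Longrightarrow> t \<in> cube_boundary n \<Longrightarrow> G (s, t) = F (s, t)"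
    and rel: "rel_homotopic n Z (\<lambda>t. F (0, t)) (\<lambda>t. G (0, t))"
  shows "rel_homotopic n Z (\<lambda>t. F (1, t)) (\<lambda>t. G (1, t))"
  using rel_homotopic_transport[OF cm_reverse[OF F] cm_reverse[OF G]] bd rel by simp

text \<open>Shrink to the centre of the cube, then follow a path to \<open>z0\<close>. The boundary
  moves too, which is why relative homotopy classes must be transported along such contractions
  below.\<close>

lemma cube_contraction:
  assumes f: "continuous_map (cube n) Z f" and Z: "path_connected_space Z" "z0 \<in> topspace Z"
  obtains A where "continuous_map (prod_topology unit_interval (cube n)) Z A"
    "\<And>t. A (0, t) = f t" "\<And>t. A (1, t) = z0"
proof -
  define c where "c = dilate n 0 (\<lambda>_. 0)"
  have dil0: "dilate n 0 t = c" for t by (simp add: c_def dilate_def)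
  have c: "c \<in> topspace (cube n)" unfolding c_def by (rule dilate_in_cube) auto
  let ?I = "prod_topology unit_interval (cube n)"
  have "homotopic_with (\<lambda>_. True) (cube n) Z f (\<lambda>_. f c)"
  proof (rule homotopicI[where h = "\<lambda>z. f (dilate n (1 - fst z) (snd z))"])
    have "continuous_map ?I (cube n) (\<lambda>z. dilate n (1 - fst z) (snd z))"
    proof (rule cm_dilate[OF continuous_map_snd cm_real[OF cm_scaled_coord]])
      show "(1 - fst z) * cnorm n (snd z) \<le> 1" if "z \<in> topspace ?I" for z
        using that cnorm_le_1[of "snd z" n] cnorm_nonneg[of n "snd z"] by (intro mult_le_one) auto
    qed auto
    then show "continuous_map ?I Z (\<lambda>z. f (dilate n (1 - fst z) (snd z)))"
      by (rule cm_comp[OF f])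
  qed (simp_all add: dilate_1 dil0)
  moreover have "path_component_of Z (f c) z0"
    using Z cm_range[OF f c] by (simp add: path_connected_space_iff_path_component)
  then have "homotopic_with (\<lambda>_. True) (cube n) Z (\<lambda>_. f c) (\<lambda>_. z0)"
    by (simp add: homotopic_constant_maps)
  ultimately have "homotopic_with (\<lambda>_. True) (cube n) Z f (\<lambda>_. z0)"
    by (rule homotopic_with_trans)
  then show ?thesis by (rule homotopicE) (rule that)
qed

lemma cube_join:
  "\<lbrakk>t \<in> topspace (cube k); 0 \<le> \<tau>; \<tau> \<le> 1\<rbrakk> \<Longrightarrow> t(k := \<tau>) \<in> topspace (cube (Suc k))"
  by (auto simp: topspace_cube PiE_def Pi_def extensional_def less_Suc_eq)

lemma cube_join_boundary:
  assumes "t \<in> topspace (cube k)" "0 \<le> \<tau>" "\<tau> \<le> 1" "t \<in> cube_boundary k \<or> \<tau> = 0 \<or> \<tau> = 1"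
  shows "t(k := \<tau>) \<in> cube_boundary (Suc k)"
proof -
  have "\<exists>i<Suc k. (t(k := \<tau>)) i = 0 \<or> (t(k := \<tau>)) i = 1"
    using assms(4)
  proof (elim disjE)
    assume "t \<in> cube_boundary k"
    then obtain i where "i < k" "t i = 0 \<or> t i = 1" by (auto simp: cube_boundary_def)
    then show ?thesis by (intro exI[of _ i]) auto
  qed (auto intro!: exI[of _ k])
  then show ?thesis using cube_join[OF assms(1-3)] by (simp add: cube_boundary_def)
qed

lemma cm_cube_join:
  assumes g: "continuous_map Y (cube k) g" and q: "continuous_map Y unit_interval q"
  shows "continuous_map Y (cube (Suc k)) (\<lambda>y. (g y)(k := q y))"
proof (rule cm_into_cube)
  show "continuous_map Y euclideanreal (\<lambda>y. ((g y)(k := q y)) i)" if "i < Suc k" for i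
    using that cm_real[OF q] cm_cube_coord[OF _ g, of i] by (cases "i = k") auto
  show "(g y)(k := q y) \<in> topspace (cube (Suc k))" if "y \<in> topspace Y" for y
    using cube_join[OF cm_range[OF g that]] cm_unit_range[OF q that] by simp
qed

lemma cm_cube_join_bd:
  assumes g: "continuous_map Y (cube k) g" and q: "continuous_map Y unit_interval q"
    and "\<And>y. y \<in> topspace Y \<Longrightarrow> g y \<in> cube_boundary k \<or> q y = 0 \<or> q y = 1"
  shows "continuous_map Y (cube_bd (Suc k)) (\<lambda>y. (g y)(k := q y))"
  unfolding cube_bd_def
proof (rule cm_subt[OF cm_cube_join[OF g q]])
  show "(g y)(k := q y) \<in> cube_boundary (Suc k)" if "y \<in> topspace Y" for y
    using cube_join_boundary[OF cm_range[OF g that] _ _ assms(3)[OF that]] cm_unit_range[OF q that] by simp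
qed

lemma cm_cube_restrict:
  assumes "continuous_map Y (cube (Suc k)) g"
  shows "continuous_map Y (cube k) (\<lambda>y. restrict (g y) {..<k})"
proof (rule cm_into_cube)
  show "continuous_map Y euclideanreal (\<lambda>y. restrict (g y) {..<k} i)" if "i < k" for i
    using that cm_cube_coord[OF _ assms, of i] by simp
  show "restrict (g y) {..<k} \<in> topspace (cube k)" if "y \<in> topspace Y" for y
    using cube_bounds[OF cm_range[OF assms that]] by (auto simp: topspace_cube)
qed

section \<open>Whitehead's theorem\<close>

definition loop_homotopic :: "nat \<Rightarrow> 'a topology \<Rightarrow> 'a \<Rightarrow> ((nat \<Rightarrow> real) \<Rightarrow> 'a) \<Rightarrow> ((nat \<Rightarrow> real) \<Rightarrow> 'a) \<Rightarrow> bool" where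
  "loop_homotopic k X x = homotopic_with (\<lambda>h. \<forall>t\<in>cube_boundary k. h t = x) (cube k) X"

text \<open>Bijectivity on the k-th homotopy set, on the level of representatives: this covers maps
  between different spaces and treats \<open>k = 0\<close> uniformly.\<close>

definition pi_bijective :: "nat \<Rightarrow> 'a topology \<Rightarrow> 'a \<Rightarrow> 'b topology \<Rightarrow> 'b \<Rightarrow> ('a \<Rightarrow> 'b) \<Rightarrow> bool" where
  "pi_bijective k X x Y y f \<longleftrightarrow>
     (\<forall>a\<in>loops k X x. \<forall>b\<in>loops k X x. loop_homotopic k Y y (f \<circ> a) (f \<circ> b) \<longrightarrow> loop_homotopic k X x a b) \<and>
     (\<forall>b\<in>loops k Y y. \<exists>a\<in>loops k X x. loop_homotopic k Y y (f \<circ> a) b)"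

lemma rel_homotopic_loops:
  assumes "\<And>t. t \<in> cube_boundary k \<Longrightarrow> a t = x"
  shows "rel_homotopic k X a b \<longleftrightarrow> loop_homotopic k X x a b"
proof -
  have "(\<lambda>h. \<forall>t\<in>cube_boundary k. h t = a t) = (\<lambda>h. \<forall>t\<in>cube_boundary k. h t = x)"
    using assms by (auto simp: fun_eq_iff)
  then show ?thesis by (simp add: rel_homotopic_def loop_homotopic_def)
qed

locale pi_equivalence =
  fixes W :: "'w topology" and w0 and Z :: "'z topology" and z0 and e
  assumes e: "e \<in> based_maps W w0 Z z0"
    and bij: "\<And>k. pi_bijective k W w0 Z z0 e"
    and W: "path_connected_space W" "w0 \<in> topspace W"
    and Z: "path_connected_space Z" "z0 \<in> topspace Z"
begin

lemma ce: "continuous_map W Z e" using based_mapsD(1)[OF e] .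
lemma e0: "e w0 = z0" using based_mapsD(2)[OF e] .

text \<open>Contracting \<open>b\<close> to the base point and carrying \<open>a\<close> along with
  the same motion of the boundary turns both into loops. Transport carries the relative homotopy
  over to the loops in \<open>Z\<close>, injectivity applies there, and transport leads back in
  \<open>W\<close>.\<close>

lemma rel_injective:
  assumes a: "continuous_map (cube k) W a" and b: "continuous_map (cube k) W b"
    and bd: "\<And>t. t \<in> cube_boundary k \<Longrightarrow> a t = b t"
    and rel: "rel_homotopic k Z (e \<circ> a) (e \<circ> b)"
  shows "rel_homotopic k W a b"
proof -
  obtain B where B: "continuous_map (prod_topology unit_interval (cube k)) W B" "\<And>t. B (0, t) = b t" "\<And>t. B (1, t) = w0"
    using cube_contraction[OF b W] by metis
  obtain A where A: "continuous_map (prod_topology unit_interval (cube k)) W A"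
    "\<And>t. t \<in> topspace (cube k) \<Longrightarrow> A (0, t) = a t"
    "\<And>s t. \<lbrakk>0 \<le> s; s \<le> 1; t \<in> cube_boundary k\<rbrakk> \<Longrightarrow> A (s, t) = B (s, t)"
    by (rule cube_homotopy_extension_simple[OF a cm_homotopy_from_cube_bd[OF B(1)]]) (auto simp: B bd)
  have A0: "rel_homotopic k W a (\<lambda>t. A (0, t))"
    by (rule rel_homotopic_eq[OF a]) (simp add: A(2))
  have "rel_homotopic k Z (\<lambda>t. e (A (1, t))) (\<lambda>t. e (B (1, t)))"
  proof (rule rel_homotopic_transport'[where F = "\<lambda>z. e (A z)" and G = "\<lambda>z. e (B z)"])
    have "rel_homotopic k Z (e \<circ> (\<lambda>t. A (0, t))) (e \<circ> b)"
      by (rule rel_homotopic_trans[OF rel_homotopic_sym[OF rel_homotopic_comp[OF A0 ce]] rel])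
    then show "rel_homotopic k Z (\<lambda>t. e (A (0, t))) (\<lambda>t. e (B (0, t)))"
      by (simp add: B(2) o_def)
  qed (use A(3) in \<open>auto intro: cm_comp[OF ce] A(1) B(1)\<close>)
  then have "loop_homotopic k Z z0 (e \<circ> (\<lambda>t. A (1, t))) (e \<circ> (\<lambda>t. B (1, t)))"
    by (subst rel_homotopic_loops[symmetric]) (simp_all add: A(3) B(3) e0 o_def)
  moreover have "(\<lambda>t. A (1, t)) \<in> loops k W w0" "(\<lambda>t. B (1, t)) \<in> loops k W w0"
    using cm_end[OF A(1), of 1] cm_end[OF B(1), of 1] by (auto simp: loops_def A(3) B(3))
  ultimately have "loop_homotopic k W w0 (\<lambda>t. A (1, t)) (\<lambda>t. B (1, t))"
    using bij[of k] unfolding pi_bijective_def by blast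
  then have "rel_homotopic k W (\<lambda>t. A (1, t)) (\<lambda>t. B (1, t))"
    by (subst rel_homotopic_loops[where x = w0]) (simp_all add: A(3) B(3))
  then have "rel_homotopic k W (\<lambda>t. A (0, t)) (\<lambda>t. B (0, t))"
    by (rule rel_homotopic_transport[OF A(1) B(1), rotated]) (simp add: A(3))
  then show ?thesis using rel_homotopic_trans[OF A0] by (simp add: B(2))
qed

text \<open>A contraction of \<open>v\<close> moves the boundary values to the base point;
  \<open>u\<close> is carried along over \<open>e\<close> and becomes a loop, which surjectivity
  lifts to \<open>w\<close>. The contraction run backwards on the boundary turns \<open>w\<close>
  into a map with the boundary values of \<open>v\<close>.\<close>

lemma rel_surjective:
  assumes v: "continuous_map (cube n) W v" and u: "continuous_map (cube n) Z u"
    and bd: "\<And>t. t \<in> cube_boundary n \<Longrightarrow> e (v t) = u t"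
  obtains v' where "continuous_map (cube n) W v'" "\<And>t. t \<in> cube_boundary n \<Longrightarrow> v' t = v t"
    "rel_homotopic n Z (e \<circ> v') u"
proof -
  obtain A where A: "continuous_map (prod_topology unit_interval (cube n)) W A" "\<And>t. A (0, t) = v t" "\<And>t. A (1, t) = w0"
    using cube_contraction[OF v W] by metis
  have ceA: "continuous_map (prod_topology unit_interval (cube_bd n)) Z (\<lambda>z. e (A z))"
    by (rule cm_homotopy_from_cube_bd[OF cm_comp[OF ce A(1)]])
  obtain U where U: "continuous_map (prod_topology unit_interval (cube n)) Z U"
    "\<And>t. t \<in> topspace (cube n) \<Longrightarrow> U (0, t) = u t"
    "\<And>s t. \<lbrakk>0 \<le> s; s \<le> 1; t \<in> cube_boundary n\<rbrakk> \<Longrightarrow> U (s, t) = e (A (s, t))"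
    by (rule cube_homotopy_extension_simple[OF u ceA]) (auto simp: A bd)
  have "(\<lambda>t. U (1, t)) \<in> loops n Z z0"
    using cm_end[OF U(1), of 1] by (auto simp: loops_def U(3) A(3) e0)
  then obtain w where w: "w \<in> loops n W w0" "loop_homotopic n Z z0 (e \<circ> w) (\<lambda>t. U (1, t))"
    using bij[of n] unfolding pi_bijective_def by blast
  have cw: "continuous_map (cube n) W w" and w_bd: "\<And>t. t \<in> cube_boundary n \<Longrightarrow> w t = w0"
    using w(1) by (auto simp: loops_def)
  obtain V where V: "continuous_map (prod_topology unit_interval (cube n)) W V"
    "\<And>t. t \<in> topspace (cube n) \<Longrightarrow> V (0, t) = w t"
    "\<And>s t. \<lbrakk>0 \<le> s; s \<le> 1; t \<in> cube_boundary n\<rbrakk> \<Longrightarrow> V (s, t) = A (1 - s, t)"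
    by (rule cube_homotopy_extension_simple[OF cw cm_homotopy_from_cube_bd[OF cm_reverse[OF A(1)]]]) (auto simp: A w_bd)
  have "rel_homotopic n Z (\<lambda>t. e (V (1 - 0, t))) (\<lambda>t. U (0, t))"
  proof (rule rel_homotopic_transport[where F = "\<lambda>z. e (V (1 - fst z, snd z))" and G = U, simplified fst_conv snd_conv])
    show "continuous_map (prod_topology unit_interval (cube n)) Z (\<lambda>z. e (V (1 - fst z, snd z)))"
      by (rule cm_comp[OF ce cm_reverse[OF V(1)]])
    show "U (s, t) = e (V (1 - s, t))" if "0 \<le> s" "s \<le> 1" "t \<in> cube_boundary n" for s t
      using that by (simp add: U(3) V(3))
    have "rel_homotopic n Z (e \<circ> w) (\<lambda>t. U (1, t))"
      using w(2) by (subst rel_homotopic_loops[where x = z0]) (auto simp: w_bd e0)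
    moreover have "rel_homotopic n Z (e \<circ> (\<lambda>t. V (0, t))) (e \<circ> w)"
      by (rule rel_homotopic_comp[OF rel_homotopic_sym[OF rel_homotopic_eq] ce]) (use cw V(2) in auto)
    ultimately show "rel_homotopic n Z (\<lambda>t. e (V (1 - 1, t))) (\<lambda>t. U (1, t))"
      using rel_homotopic_trans by (simp add: o_def) blast
  qed (rule U(1))
  moreover have "rel_homotopic n Z (\<lambda>t. U (0, t)) u"
    by (rule rel_homotopic_sym[OF rel_homotopic_eq[OF u]]) (simp add: U(2))
  ultimately have "rel_homotopic n Z (e \<circ> (\<lambda>t. V (1, t))) u"
    using rel_homotopic_trans by (simp add: o_def) blast
  then show ?thesis
    using that[of "\<lambda>t. V (1, t)"] cm_end[OF V(1), of 1] by (simp add: V(3) A(2))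
qed

text \<open>The cube is regarded as \<open>cube k\<close> times an interval, the height being
  coordinate \<open>k\<close>. Homotopy extension fills it from the bottom and the sides, giving
  some map \<open>V (1, -)\<close> on the top. It is joined to \<open>v\<close> on the top face by
  injectivity, because after \<open>e\<close> the filling \<open>u\<close> relates the two.\<close>

lemma extension:
  assumes v: "continuous_map (cube_bd (Suc k)) W v" and u: "continuous_map (cube (Suc k)) Z u"
    and bd: "\<And>t. t \<in> cube_boundary (Suc k) \<Longrightarrow> e (v t) = u t"
  obtains v' where "continuous_map (cube (Suc k)) W v'" "\<And>t. t \<in> cube_boundary (Suc k) \<Longrightarrow> v' t = v t"
proof -
  let ?n = "Suc k"
  let ?I = "prod_topology unit_interval (cube k)" and ?J = "prod_topology unit_interval (cube_bd k)"
  have face: "continuous_map (cube k) W (\<lambda>t. v (t(k := \<tau>)))" if "\<tau> = 0 \<or> \<tau> = 1" for \<tau>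
    by (rule cm_comp[OF v cm_cube_join_bd[OF cm_id]]) (use that in auto)
  have side: "continuous_map ?J W (\<lambda>z. v ((snd z)(k := fst z)))"
    by (rule cm_comp[OF v cm_cube_join_bd[OF cm_cube_bd[OF continuous_map_snd] continuous_map_fst]]) auto
  obtain V where V: "continuous_map ?I W V"
    "\<And>t. t \<in> topspace (cube k) \<Longrightarrow> V (0, t) = v (t(k := 0))"
    "\<And>s t. \<lbrakk>0 \<le> s; s \<le> 1; t \<in> cube_boundary k\<rbrakk> \<Longrightarrow> V (s, t) = v (t(k := s))"
    by (rule cube_homotopy_extension_simple[OF face[of 0] side]) auto
  have ev: "e (v (t(k := \<tau>))) = u (t(k := \<tau>))"
    if "t \<in> topspace (cube k)" "0 \<le> \<tau>" "\<tau> \<le> 1" "t \<in> cube_boundary k \<or> \<tau> = 0 \<or> \<tau> = 1" for t \<tau>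
    using bd[OF cube_join_boundary[OF that]] .
  have bd_in: "t \<in> cube_boundary k \<Longrightarrow> t \<in> topspace (cube k)" for t using cube_boundary_subset by blast
  \<comment> \<open>The levels of \<open>u\<close> and those of \<open>e\<close> after
    \<open>V\<close> agree at the bottom and over the sides, so transport from the bottom compares
    them at the top.\<close>
  have "rel_homotopic k Z (\<lambda>t. u (t(k := 1 - 0))) (\<lambda>t. e (V (1 - 0, t)))"
  proof (rule rel_homotopic_transport[where F = "\<lambda>z. u ((snd z)(k := 1 - fst z))" and G = "\<lambda>z. e (V (1 - fst z, snd z))",
        simplified fst_conv snd_conv])
    show "continuous_map ?I Z (\<lambda>z. u ((snd z)(k := 1 - fst z)))"
      by (rule cm_comp[OF u cm_cube_join[OF continuous_map_snd cm_scaled_coord]])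
    show "continuous_map ?I Z (\<lambda>z. e (V (1 - fst z, snd z)))"
      by (rule cm_comp[OF ce cm_reverse[OF V(1)]])
    show "e (V (1 - s, t)) = u (t(k := 1 - s))" if "0 \<le> s" "s \<le> 1" "t \<in> cube_boundary k" for s t
      using that bd_in by (simp add: V(3) ev)
    have "continuous_map (cube k) Z (\<lambda>t. u (t(k := 0)))"
      by (rule cm_comp[OF u cm_cube_join[OF cm_id]]) simp
    then show "rel_homotopic k Z (\<lambda>t. u (t(k := 1 - 1))) (\<lambda>t. e (V (1 - 1, t)))"
      unfolding diff_self by (rule rel_homotopic_eq) (simp add: V(2) ev)
  qed
  moreover have "rel_homotopic k Z (e \<circ> (\<lambda>t. v (t(k := 1)))) (\<lambda>t. u (t(k := 1)))"
  proof (rule rel_homotopic_eq)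
    show "continuous_map (cube k) Z (e \<circ> (\<lambda>t. v (t(k := 1))))"
      by (rule continuous_map_compose[OF face ce]) simp
  qed (simp add: ev)
  ultimately have "rel_homotopic k Z (e \<circ> (\<lambda>t. v (t(k := 1)))) (e \<circ> (\<lambda>t. V (1, t)))"
    using rel_homotopic_trans by (simp add: o_def) blast
  then have "rel_homotopic k W (\<lambda>t. v (t(k := 1))) (\<lambda>t. V (1, t))"
    by (intro rel_injective face cm_end[OF V(1)]) (auto simp: V(3))
  then have "rel_homotopic k W (\<lambda>t. V (1, t)) (\<lambda>t. v (t(k := 1)))" by (rule rel_homotopic_sym)
  then obtain R where R: "continuous_map ?I W R" "\<And>t. R (0, t) = V (1, t)" "\<And>t. R (1, t) = v (t(k := 1))"
    "\<And>s t. 0 \<le> s \<Longrightarrow> s \<le> 1 \<Longrightarrow> t \<in> cube_boundary k \<Longrightarrow> R (s, t) = V (1, t)"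
    by (rule rel_homotopicE) auto
  \<comment> \<open>\<open>V\<close> in the lower half and the correction \<open>R\<close> in the
    upper half. The sides are thereby traversed at double speed, so \<open>v2\<close> has the
    boundary values of \<open>v\<close> only up to this reparametrization of the height.\<close>
  define v2 where "v2 t = (if t k \<le> 1/2 then V (max 0 (min 1 (2 * t k)), restrict t {..<k})
      else R (max 0 (min 1 (2 * t k - 1)), restrict t {..<k}))" for t
  have ck: "continuous_map (cube ?n) euclideanreal (\<lambda>t. t k)" by (rule cm_cube_coord[OF _ cm_id]) simp
  have cr: "continuous_map (cube ?n) (cube k) (\<lambda>t. restrict t {..<k})" by (rule cm_cube_restrict[OF cm_id])
  have cv2: "continuous_map (cube ?n) W v2"
    unfolding v2_def
  proof (rule cm_cases_le[OF ck])
    show "continuous_map (subtopology (cube ?n) {t \<in> topspace (cube ?n). t k \<le> 1/2}) W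
        (\<lambda>t. V (max 0 (min 1 (2 * t k)), restrict t {..<k}))"
      by (rule continuous_map_from_subtopology, intro cm_comp[OF V(1)] cm_pair cm_clamp cr continuous_intros ck) simp
    show "continuous_map (subtopology (cube ?n) {t \<in> topspace (cube ?n). 1/2 \<le> t k}) W
        (\<lambda>t. R (max 0 (min 1 (2 * t k - 1)), restrict t {..<k}))"
      by (rule continuous_map_from_subtopology, intro cm_comp[OF R(1)] cm_pair cm_clamp cr continuous_intros ck) simp_all
  qed (simp_all add: R)
  have bd_cases: "restrict t {..<k} \<in> topspace (cube k) \<and> 0 \<le> t k \<and> t k \<le> 1 \<and>
      (restrict t {..<k} \<in> cube_boundary k \<or> t k = 0 \<or> t k = 1)" if "t \<in> cube_boundary ?n" for t
  proof -
    have t: "t \<in> topspace (cube ?n)" using that cube_boundary_subset by blast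
    then have r: "restrict t {..<k} \<in> topspace (cube k)" using cm_range[OF cr] by simp
    obtain i where "i < ?n" "t i = 0 \<or> t i = 1"
      using \<open>t \<in> cube_boundary ?n\<close> by (auto simp: cube_boundary_def)
    then show ?thesis using r cube_bounds[OF t, of k] by (auto simp: cube_boundary_def less_Suc_eq)
  qed
  have v2_bd: "v2 t = v ((restrict t {..<k})(k := min 1 (2 * t k)))" if "t \<in> cube_boundary ?n" for t
  proof -
    note b = bd_cases[OF that]
    show ?thesis
    proof (cases "t k \<le> 1/2")
      case True
      then show ?thesis using b V(2)[of "restrict t {..<k}"] V(3)[of "2 * t k" "restrict t {..<k}"] by (auto simp: v2_def)
    next
      case False
      then have "min 1 (2 * t k) = 1" by simp
      then show ?thesis using False b R(3)[of "restrict t {..<k}"] R(4)[of "2 * t k - 1" "restrict t {..<k}"] V(3)[of 1 "restrict t {..<k}"] by (auto simp: v2_def)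
    qed
  qed
  let ?K = "prod_topology unit_interval (cube_bd ?n)"
  \<comment> \<open>The speed on the boundary is lowered from 2 to 1; extending this homotopy from
    \<open>v2\<close> gives a filling with the exact boundary values.\<close>
  have h: "continuous_map ?K W (\<lambda>z. v ((restrict (snd z) {..<k})(k := min 1 ((2 - fst z) * snd z k))))"
  proof (rule cm_comp[OF v], rule cm_cube_join_bd)
    have c2: "continuous_map ?K (cube ?n) snd" by (rule cm_cube_bd[OF continuous_map_snd])
    show "continuous_map ?K (cube k) (\<lambda>z. restrict (snd z) {..<k})" by (rule cm_cube_restrict[OF c2])
    have "continuous_map ?K euclideanreal (\<lambda>z. snd z k)" by (rule cm_cube_coord[OF _ c2]) simp
    then show "continuous_map ?K unit_interval (\<lambda>z. min 1 ((2 - fst z) * snd z k))"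
    proof (intro cm_unit continuous_intros cm_real[OF continuous_map_fst])
      show "0 \<le> min 1 ((2 - fst z) * snd z k) \<and> min 1 ((2 - fst z) * snd z k) \<le> 1" if "z \<in> topspace ?K" for z
        using that bd_cases[of "snd z"] by auto
    qed simp_all
    show "restrict (snd z) {..<k} \<in> cube_boundary k \<or> min 1 ((2 - fst z) * snd z k) = 0 \<or> min 1 ((2 - fst z) * snd z k) = 1"
      if "z \<in> topspace ?K" for z
      using that bd_cases[of "snd z"] by auto
  qed
  obtain F where F: "continuous_map (prod_topology unit_interval (cube ?n)) W F"
    "\<And>s t. \<lbrakk>0 \<le> s; s \<le> 1; t \<in> cube_boundary ?n\<rbrakk> \<Longrightarrow> F (s, t) = v ((restrict t {..<k})(k := min 1 ((2 - s) * t k)))"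
    by (rule cube_homotopy_extension_simple[OF cv2 h]) (auto simp: v2_bd)
  show ?thesis
  proof (rule that[OF cm_end[OF F(1), of 1]])
    show "F (1, t) = v t" if t: "t \<in> cube_boundary ?n" for t
    proof -
      have "t \<in> extensional {..<?n}" using t cube_boundary_subset[of ?n] by (auto simp: topspace_cube PiE_def)
      then have "(restrict t {..<k})(k := t k) = t"
        by (intro ext) (auto simp: restrict_def extensional_def)
      moreover have "min 1 (t k) = t k" using bd_cases[OF t] by simp
      ultimately show ?thesis using F(2)[of 1 t] t by simp
    qed
  qed simp_all
qed

text \<open>After sliding \<open>u\<close> backwards along \<open>H\<close>, its boundary values lie
  strictly under those of \<open>v\<close>. Then \<open>extension\<close> fills \<open>v\<close> and
  \<open>rel_surjective\<close> corrects the filling so that \<open>e\<close> maps it to the slid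
  \<open>u\<close>, up to a relative homotopy; sliding forwards again restricts to \<open>H\<close>
  on the boundary.\<close>

lemma cell_lifting_pi:
  assumes u: "continuous_map (prod_topology (cube n) (discrete_topology {()})) Z u"
  shows "cell_lifting n W Z (discrete_topology {()}) (\<lambda>p. e (snd p)) u"
proof (rule cell_liftingI)
  let ?L = "discrete_topology {()}"
  let ?D = "prod_topology (cube n) ?L" and ?B = "prod_topology (cube_bd n) ?L"
  fix v H
  assume v: "continuous_map ?B W v"
    and H: "continuous_map (prod_topology unit_interval ?B) Z H"
    and H0: "\<And>t l. t \<in> cube_boundary n \<Longrightarrow> l \<in> topspace ?L \<Longrightarrow> H (0, t, l) = e (snd (t, v (t, l)))"
    and H1: "\<And>t l. t \<in> cube_boundary n \<Longrightarrow> l \<in> topspace ?L \<Longrightarrow> H (1, t, l) = u (t, l)"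
  let ?P = "\<lambda>r h. \<forall>t\<in>cube_boundary n. \<forall>l\<in>topspace ?L. h (t, l) = H (r, t, l)"
  let ?goal = "\<lambda>v' f1 f2 B. continuous_map ?D W v' \<and> homotopic_with (?P 0) ?D Z (\<lambda>(t, l). e (snd (t, v' (t, l)))) f1 \<and>
        continuous_map (prod_topology unit_interval ?D) Z B \<and>
        (\<forall>t\<in>topspace (cube n). \<forall>l\<in>topspace ?L. B (0, t, l) = f1 (t, l) \<and> B (1, t, l) = f2 (t, l)) \<and>
        (\<forall>t\<in>cube_boundary n. \<forall>l\<in>topspace ?L. v' (t, l) = v (t, l) \<and> (\<forall>r\<in>{0..1}. B (r, t, l) = H (r, t, l))) \<and>
        homotopic_with (?P 1) ?D Z f2 u"
  have cu: "continuous_map (cube n) Z (\<lambda>t. u (t, ()))"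
    by (rule cm_comp[OF u]) (intro cm_pair cm_id, simp)
  have cH: "continuous_map (prod_topology unit_interval (cube_bd n)) Z (\<lambda>z. H (1 - fst z, snd z, ()))"
    by (rule cm_comp[OF H]) (intro cm_pair cm_scaled_coord continuous_map_snd, simp)
  obtain U where U: "continuous_map (prod_topology unit_interval (cube n)) Z U"
    "\<And>t. t \<in> topspace (cube n) \<Longrightarrow> U (0, t) = u (t, ())"
    "\<And>s t. \<lbrakk>0 \<le> s; s \<le> 1; t \<in> cube_boundary n\<rbrakk> \<Longrightarrow> U (s, t) = H (1 - s, t, ())"
    by (rule cube_homotopy_extension_simple[OF cu cH]) (auto simp: H1)
  have cU: "continuous_map (cube n) Z (\<lambda>t. U (1, t))" by (rule cm_end[OF U(1)]) simp_all
  obtain v' where v': "continuous_map (cube n) W v'" "\<And>t. t \<in> cube_boundary n \<Longrightarrow> v' t = v (t, ())"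
    "rel_homotopic n Z (e \<circ> v') (\<lambda>t. U (1, t))"
  \<comment> \<open>A 0-cell has no boundary, and since \<open>Z\<close> is path-connected the base
    point may serve as the lift.\<close>
  proof (cases n)
    case 0
    obtain A where A: "continuous_map (prod_topology unit_interval (cube n)) Z A" "\<And>t. A (0, t) = U (1, t)" "\<And>t. A (1, t) = z0"
      using cube_contraction[OF cU Z] by metis
    have "rel_homotopic n Z (\<lambda>t. U (1, t)) (\<lambda>t. z0)"
      by (rule rel_homotopicI[OF A(1)]) (auto simp: A 0 cube_boundary_0)
    then have "rel_homotopic n Z (e \<circ> (\<lambda>t. w0)) (\<lambda>t. U (1, t))"
      using rel_homotopic_sym by (simp add: o_def e0)
    then show ?thesis using that[of "\<lambda>t. w0"] W(2) 0 by (simp add: cube_boundary_0)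
  next
    case (Suc k)
    have cv: "continuous_map (cube_bd n) W (\<lambda>t. v (t, ()))"
      by (rule cm_comp[OF v]) (intro cm_pair cm_id, simp)
    have ev: "e (v (t, ())) = U (1, t)" if "t \<in> cube_boundary n" for t
      using that H0[of t "()"] by (simp add: U(3))
    obtain v0 where v0: "continuous_map (cube n) W v0" "\<And>t. t \<in> cube_boundary n \<Longrightarrow> v0 t = v (t, ())"
      using extension[of k "\<lambda>t. v (t, ())" "\<lambda>t. U (1, t)"] cv cU ev unfolding Suc by metis
    show ?thesis
      by (rule rel_surjective[OF v0(1) cU]) (use v0(2) ev that in auto)
  qed
  have p: "continuous_map (prod_topology unit_interval ?D) (prod_topology unit_interval (cube n)) (\<lambda>z. (fst z, fst (snd z)))"
    by (rule cmi)+
  obtain R where R: "continuous_map (prod_topology unit_interval (cube n)) Z R"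
    "\<And>t. R (0, t) = e (v' t)" "\<And>t. R (1, t) = U (1, t)"
    "\<And>s t. 0 \<le> s \<Longrightarrow> s \<le> 1 \<Longrightarrow> t \<in> cube_boundary n \<Longrightarrow> R (s, t) = e (v' t)"
    using v'(3) by (rule rel_homotopicE) auto
  have P_cong: "?P r h \<longleftrightarrow> ?P r k" if "\<And>x. x \<in> topspace ?D \<Longrightarrow> h x = k x" for r h k
    using that cube_boundary_subset[of n] by (intro ball_cong refl) auto
  have 1: "homotopic_with (?P 0) ?D Z (\<lambda>(t, l). e (snd (t, v' (fst (t, l))))) (\<lambda>p. U (1, fst p))"
  proof (rule homotopic_withI[OF cm_comp[OF R(1) p] _ _ _ P_cong])
    show "?P 0 (\<lambda>x. R (fst (s, x), fst (snd (s, x))))" if "0 \<le> s" "s \<le> 1" for s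
      using that by (auto simp: R(4) H0 v'(2))
  qed (auto simp: R(2,3))
  have 2: "continuous_map (prod_topology unit_interval ?D) Z (\<lambda>z. U (1 - fst z, fst (snd z)))"
    by (rule cm_comp[OF U(1)], intro cm_pair cm_scaled_coord) ((rule cmi)+)
  have 3: "homotopic_with (?P 1) ?D Z u u"
    using u H1 by simp
  have 4: "continuous_map ?D W (\<lambda>p. v' (fst p))"
    by (rule cm_comp[OF v'(1) continuous_map_fst])
  have "?goal (\<lambda>p. v' (fst p)) (\<lambda>p. U (1, fst p)) u (\<lambda>z. U (1 - fst z, fst (snd z)))"
    by (intro conjI 1 2 3 4) (auto simp: U(2,3) v'(2))
  then show "\<exists>v' f1 f2 B. ?goal v' f1 f2 B" by blast
qed

end

text \<open>\<open>lifting\<close> with a one-point \<open>L\<close>, with \<open>u\<close> the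
  identity of the complex and with \<open>\<gamma>\<close> independent of its first
  argument.\<close>

lemma (in cw_complex) pi_equivalence_right_inverse:
  assumes conn: "path_connected_space X" and x0: "x0 \<in> topspace X" "cdim x0 = 0"
    and e: "pi_equivalence W w0 X x0 e"
  obtains v where "v \<in> based_maps X x0 W w0" "based_homotopic X x0 X x0 (e \<circ> v) id"
proof -
  interpret pi_equivalence W w0 X x0 e by (rule e)
  let ?L = "discrete_topology {()}"
  have c\<gamma>: "continuous_map (prod_topology X W) X (\<lambda>p. e (snd p))"
    by (rule cm_comp[OF ce continuous_map_snd])
  have lift: "cell_lifting n W X ?L (\<lambda>z. e (snd (\<phi> (fst z), snd z))) (\<lambda>z. fst (\<phi> (fst z), snd z))"
    if "\<phi> \<in> C n" for n \<phi>
    unfolding snd_conv fst_conv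
    by (rule cell_lifting_pi) (rule cm_comp[OF cm_char[OF that] continuous_map_fst])
  obtain v where v: "continuous_map (prod_topology X ?L) W v" "\<And>l. l \<in> topspace ?L \<Longrightarrow> v (x0, l) = w0"
    "homotopic_with (\<lambda>h. h (x0, ()) = x0) (prod_topology X ?L) X (\<lambda>p. e (snd (fst p, v p))) fst"
    by (rule lifting[OF c\<gamma> continuous_map_fst lift x0, of "()" "\<lambda>_. w0" "\<lambda>_. x0" x0])
      (use W(2) x0 e0 in auto)
  have i: "continuous_map X (prod_topology X ?L) (\<lambda>x. (x, ()))" by (intro cm_pair cm_id) simp
  have "homotopic_with (\<lambda>h. h x0 = x0) X X ((\<lambda>p. e (snd (fst p, v p))) \<circ> (\<lambda>x. (x, ()))) (fst \<circ> (\<lambda>x. (x, ())))"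
    by (rule homotopic_with_compose_continuous_map_right[OF v(3) i]) simp
  then have "based_homotopic X x0 X x0 (e \<circ> (\<lambda>x. v (x, ()))) id"
    by (simp add: based_homotopic_def o_def id_def)
  moreover have "(\<lambda>x. v (x, ())) \<in> based_maps X x0 W w0"
    by (rule based_mapsI[OF cm_comp[OF v(1) i]]) (simp add: v(2))
  ultimately show ?thesis using that by blast
qed

section \<open>Self-maps and homotopy groups\<close>

lemma loop_homotopic_imp_loops: "loop_homotopic k X x a b \<Longrightarrow> a \<in> loops k X x \<and> b \<in> loops k X x"
  unfolding loop_homotopic_def
  by (frule homotopic_with_imp_continuous_maps, drule homotopic_with_imp_property) (auto simp: loops_def)

lemma loop_homotopic_refl: "a \<in> loops k X x \<Longrightarrow> loop_homotopic k X x a a"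
  by (auto simp: loop_homotopic_def loops_def)

lemma loop_homotopic_sym: "loop_homotopic k X x a b \<Longrightarrow> loop_homotopic k X x b a"
  unfolding loop_homotopic_def by (rule homotopic_with_symD)

lemma loop_homotopic_trans [trans]:
  "\<lbrakk>loop_homotopic k X x a b; loop_homotopic k X x b c\<rbrakk> \<Longrightarrow> loop_homotopic k X x a c"
  unfolding loop_homotopic_def by (rule homotopic_with_trans)

lemma loops_comp: "\<lbrakk>a \<in> loops k X x; f \<in> based_maps X x Y y\<rbrakk> \<Longrightarrow> f \<circ> a \<in> loops k Y y"
  by (auto simp: loops_def based_maps_def intro: continuous_map_compose)

lemma loop_homotopic_comp:
  "\<lbrakk>loop_homotopic k X x a b; f \<in> based_maps X x Y y\<rbrakk> \<Longrightarrow> loop_homotopic k Y y (f \<circ> a) (f \<circ> b)"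
  unfolding loop_homotopic_def
  by (rule homotopic_with_compose_continuous_map_left[where p = "\<lambda>h. \<forall>t\<in>cube_boundary k. h t = x"])
    (auto simp: based_maps_def)

lemma based_homotopic_loop:
  "\<lbrakk>based_homotopic X x Y y f g; a \<in> loops k X x\<rbrakk> \<Longrightarrow> loop_homotopic k Y y (f \<circ> a) (g \<circ> a)"
  unfolding loop_homotopic_def based_homotopic_def
  by (rule homotopic_with_compose_continuous_map_right[where p = "\<lambda>h. h x = y"]) (auto simp: loops_def)

lemma loop_homotopicI:
  assumes "continuous_map (prod_topology unit_interval (cube k)) X h"
    and "\<And>t. t \<in> topspace (cube k) \<Longrightarrow> h (0, t) = a t" "\<And>t. t \<in> topspace (cube k) \<Longrightarrow> h (1, t) = b t"
    and "\<And>s t. 0 \<le> s \<Longrightarrow> s \<le> 1 \<Longrightarrow> t \<in> cube_boundary k \<Longrightarrow> h (s, t) = x"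
  shows "loop_homotopic k X x a b"
proof -
  have bd: "a t = x" if "t \<in> cube_boundary k" for t
    using assms(2)[of t] assms(4)[of 0 t] that cube_boundary_subset[of k] by auto
  have "rel_homotopic k X a b"
    by (rule rel_homotopicI[OF assms(1-3)]) (simp_all add: assms(4) bd)
  then show ?thesis using rel_homotopic_loops[of k a x X b] bd by simp
qed

lemma loop_homotopicE:
  assumes "loop_homotopic k X x a b"
  obtains h where "continuous_map (prod_topology unit_interval (cube k)) X h"
    "\<And>t. h (0, t) = a t" "\<And>t. h (1, t) = b t"
    "\<And>s t. 0 \<le> s \<Longrightarrow> s \<le> 1 \<Longrightarrow> t \<in> cube_boundary k \<Longrightarrow> h (s, t) = x"
  using assms unfolding loop_homotopic_def homotopic_with_def by auto

lemma pi_bijectiveI: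
  assumes "\<And>a b. \<lbrakk>a \<in> loops k X x; b \<in> loops k X x; loop_homotopic k Y y (f \<circ> a) (f \<circ> b)\<rbrakk> \<Longrightarrow> loop_homotopic k X x a b"
    and "\<And>b. b \<in> loops k Y y \<Longrightarrow> \<exists>a\<in>loops k X x. loop_homotopic k Y y (f \<circ> a) b"
  shows "pi_bijective k X x Y y f"
  using assms by (simp add: pi_bijective_def)

lemma pi_bijective_inj:
  "\<lbrakk>pi_bijective k X x Y y f; loop_homotopic k Y y (f \<circ> a) (f \<circ> b); a \<in> loops k X x; b \<in> loops k X x\<rbrakk>
   \<Longrightarrow> loop_homotopic k X x a b"
  by (simp add: pi_bijective_def)

lemma pi_bijective_surj:
  assumes "pi_bijective k X x Y y f" "b \<in> loops k Y y"
  obtains a where "a \<in> loops k X x" "loop_homotopic k Y y (f \<circ> a) b"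
  using assms unfolding pi_bijective_def by blast

lemma pi_bijective_homotopic:
  assumes f: "pi_bijective k X x Y y f" and fg: "based_homotopic X x Y y f g"
  shows "pi_bijective k X x Y y g"
proof (rule pi_bijectiveI)
  note fga = based_homotopic_loop[OF fg, where k = k]
  show "loop_homotopic k X x a b"
    if a: "a \<in> loops k X x" and b: "b \<in> loops k X x" and g: "loop_homotopic k Y y (g \<circ> a) (g \<circ> b)" for a b
    by (rule pi_bijective_inj[OF f _ a b])
      (rule loop_homotopic_trans[OF fga[OF a] loop_homotopic_trans[OF g loop_homotopic_sym[OF fga[OF b]]]])
  show "\<exists>a\<in>loops k X x. loop_homotopic k Y y (g \<circ> a) b" if b: "b \<in> loops k Y y" for b
  proof -
    obtain a where "a \<in> loops k X x" "loop_homotopic k Y y (f \<circ> a) b"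
      using pi_bijective_surj[OF f b] by metis
    then show ?thesis
      using loop_homotopic_trans[OF loop_homotopic_sym[OF fga]] by metis
  qed
qed

lemma pi_bijective_comp:
  assumes f: "pi_bijective k X x Y y f" and g: "pi_bijective k Y y Z z g"
    and cf: "f \<in> based_maps X x Y y" and cg: "g \<in> based_maps Y y Z z"
  shows "pi_bijective k X x Z z (g \<circ> f)"
proof (rule pi_bijectiveI)
  show "loop_homotopic k X x a b"
    if a: "a \<in> loops k X x" and b: "b \<in> loops k X x" and h: "loop_homotopic k Z z (g \<circ> f \<circ> a) (g \<circ> f \<circ> b)" for a b
    using pi_bijective_inj[OF f pi_bijective_inj[OF g] a b] h loops_comp[OF _ cf] a b by (simp add: o_assoc)
  show "\<exists>a\<in>loops k X x. loop_homotopic k Z z (g \<circ> f \<circ> a) b" if b: "b \<in> loops k Z z" for b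
  proof -
    obtain c where c: "c \<in> loops k Y y" "loop_homotopic k Z z (g \<circ> c) b"
      using pi_bijective_surj[OF g b] by metis
    obtain a where a: "a \<in> loops k X x" "loop_homotopic k Y y (f \<circ> a) c"
      using pi_bijective_surj[OF f c(1)] by metis
    have "loop_homotopic k Z z (g \<circ> f \<circ> a) b"
      using loop_homotopic_trans[OF loop_homotopic_comp[OF a(2) cg] c(2)] by (simp add: o_assoc)
    then show ?thesis using a(1) by blast
  qed
qed

lemma pi_bijective_equivalence:
  assumes "based_homotopy_equivalence X x Y y f"
  shows "pi_bijective k X x Y y f"
proof -
  obtain g where f: "f \<in> based_maps X x Y y" and g: "g \<in> based_maps Y y X x"
    and gf: "based_homotopic X x X x (g \<circ> f) id" and fg: "based_homotopic Y y Y y (f \<circ> g) id"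
    using assms by (rule based_homotopy_equivalenceE)
  have gf_loop: "loop_homotopic k X x (g \<circ> (f \<circ> a)) a" if "a \<in> loops k X x" for a
    using based_homotopic_loop[OF gf that] by (simp add: o_assoc)
  have fg_loop: "loop_homotopic k Y y (f \<circ> (g \<circ> b)) b" if "b \<in> loops k Y y" for b
    using based_homotopic_loop[OF fg that] by (simp add: o_assoc)
  show ?thesis
  proof (rule pi_bijectiveI)
    show "loop_homotopic k X x a b"
      if a: "a \<in> loops k X x" and b: "b \<in> loops k X x" and h: "loop_homotopic k Y y (f \<circ> a) (f \<circ> b)" for a b
      using loop_homotopic_trans[OF loop_homotopic_sym[OF gf_loop[OF a]]
          loop_homotopic_trans[OF loop_homotopic_comp[OF h g] gf_loop[OF b]]] .
    show "\<exists>a\<in>loops k X x. loop_homotopic k Y y (f \<circ> a) b" if "b \<in> loops k Y y" for b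
      using fg_loop[OF that] loops_comp[OF that g] by blast
  qed
qed

lemma pi_bijective_right_inverse:
  assumes f: "pi_bijective k X x Y y f" and cf: "f \<in> based_maps X x Y y" and cg: "g \<in> based_maps Y y X x"
    and fg: "based_homotopic Y y Y y (f \<circ> g) id"
  shows "pi_bijective k Y y X x g"
proof (rule pi_bijectiveI)
  have fg_loop: "loop_homotopic k Y y (f \<circ> (g \<circ> b)) b" if "b \<in> loops k Y y" for b
    using based_homotopic_loop[OF fg that] by (simp add: o_assoc)
  show "loop_homotopic k Y y a b"
    if a: "a \<in> loops k Y y" and b: "b \<in> loops k Y y" and h: "loop_homotopic k X x (g \<circ> a) (g \<circ> b)" for a b
    using loop_homotopic_trans[OF loop_homotopic_sym[OF fg_loop[OF a]]
        loop_homotopic_trans[OF loop_homotopic_comp[OF h cf] fg_loop[OF b]]] .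
  show "\<exists>a\<in>loops k Y y. loop_homotopic k X x (g \<circ> a) b" if b: "b \<in> loops k X x" for b
  proof -
    have fb: "f \<circ> b \<in> loops k Y y" by (rule loops_comp[OF b cf])
    have "loop_homotopic k X x (g \<circ> (f \<circ> b)) b"
      by (rule pi_bijective_inj[OF f fg_loop[OF fb] loops_comp[OF fb cg] b])
    then show ?thesis using fb by blast
  qed
qed

section \<open>Homotopy classes, induced maps and the group operation\<close>

lemma loop_class_eq_iff:
  assumes "a \<in> loops k X x"
  shows "loop_class k X x a = loop_class k X x b \<longleftrightarrow> loop_homotopic k X x a b"
proof -
  have c: "loop_class k X x a = {b. loop_homotopic k X x a b}" for a
    by (simp add: loop_class_def loop_homotopic_def)
  show ?thesis
    unfolding c using loop_homotopic_refl[OF assms] loop_homotopic_sym loop_homotopic_trans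
    by (metis (no_types, lifting) Collect_cong mem_Collect_eq)
qed

lemma in_loop_class: "b \<in> loop_class k X x a \<longleftrightarrow> loop_homotopic k X x a b"
  by (simp add: loop_class_def loop_homotopic_def)

lemma based_class_eq_iff:
  assumes "f \<in> based_maps X x Y y"
  shows "based_class X x Y y f = based_class X x Y y g \<longleftrightarrow> based_homotopic X x Y y f g"
  unfolding based_class_def
  using based_homotopic_refl[OF assms] based_homotopic_sym based_homotopic_trans
  by (metis (no_types, lifting) Collect_cong mem_Collect_eq)

text \<open>All representatives over which the union in \<open>induced_map\<close> ranges give the
  same class, so the union is that class.\<close>

lemma induced_map_class:
  assumes f: "f \<in> based_maps X x Y y" and a: "a \<in> loops k X x"
  shows "induced_map k Y y (based_class X x Y y f) (loop_class k X x a) = loop_class k Y y (f \<circ> a)"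
proof -
  have eq: "loop_class k Y y (g \<circ> b) = loop_class k Y y (f \<circ> a)"
    if g: "g \<in> based_class X x Y y f" and b: "b \<in> loop_class k X x a" for g b
  proof -
    have fg: "based_homotopic X x Y y f g" using g by (simp add: based_class_def)
    have ab: "loop_homotopic k X x a b" using b by (simp add: in_loop_class)
    have "loop_homotopic k Y y (f \<circ> a) (g \<circ> b)"
      using loop_homotopic_trans[OF loop_homotopic_comp[OF ab f] based_homotopic_loop[OF fg]]
        loop_homotopic_imp_loops[OF ab] by blast
    then have "loop_class k Y y (f \<circ> a) = loop_class k Y y (g \<circ> b)"
      by (simp only: loop_class_eq_iff[OF loops_comp[OF a f]])
    then show ?thesis ..
  qed
  have f_in: "f \<in> based_class X x Y y f" using based_homotopic_refl[OF f] by (simp add: based_class_def)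
  have a_in: "a \<in> loop_class k X x a" using loop_homotopic_refl[OF a] by (simp add: in_loop_class)
  show ?thesis
    unfolding induced_map_def
  proof (intro equalityI subsetI)
    fix z assume "z \<in> (\<Union>f\<in>based_class X x Y y f. \<Union>a\<in>loop_class k X x a. loop_class k Y y (f \<circ> a))"
    then show "z \<in> loop_class k Y y (f \<circ> a)" by (elim UN_E) (simp only: eq)
  next
    fix z assume "z \<in> loop_class k Y y (f \<circ> a)"
    then show "z \<in> (\<Union>f\<in>based_class X x Y y f. \<Union>a\<in>loop_class k X x a. loop_class k Y y (f \<circ> a))"
      by (intro UN_I[OF f_in] UN_I[OF a_in])
  qed
qed

lemma cm_loop_concat:
  assumes k: "0 < k"
    and H: "continuous_map (prod_topology unit_interval (cube k)) X H" and K: "continuous_map (prod_topology unit_interval (cube k)) X K"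
    and Hb: "\<And>s t. 0 \<le> s \<Longrightarrow> s \<le> 1 \<Longrightarrow> t \<in> cube_boundary k \<Longrightarrow> H (s, t) = x"
    and Kb: "\<And>s t. 0 \<le> s \<Longrightarrow> s \<le> 1 \<Longrightarrow> t \<in> cube_boundary k \<Longrightarrow> K (s, t) = x"
  defines "h \<equiv> \<lambda>z. loop_concat (\<lambda>t. H (fst z, t)) (\<lambda>t. K (fst z, t)) (snd z)"
  shows "continuous_map (prod_topology unit_interval (cube k)) X h"
    and "\<And>s t. 0 \<le> s \<Longrightarrow> s \<le> 1 \<Longrightarrow> t \<in> cube_boundary k \<Longrightarrow> h (s, t) = x"
proof -
  let ?I = "prod_topology unit_interval (cube k)"
  have ct0: "continuous_map ?I euclideanreal (\<lambda>z. snd z 0)" by (rule cm_cube_coord[OF k continuous_map_snd])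
  \<comment> \<open>The clamp makes this a map into the cube on all of \<open>?I\<close>; on the
    half where each branch is used it changes nothing.\<close>
  have c: "continuous_map ?I ?I (\<lambda>z. (fst z, (snd z)(0 := max 0 (min 1 (2 * snd z 0 - r)))))" for r
    by (intro cm_pair continuous_map_fst cm_update[OF k continuous_map_snd] cm_clamp continuous_intros ct0)
  have top: "0 \<le> snd z 0 \<and> snd z 0 \<le> 1" if "z \<in> topspace ?I" for z
    using that cube_bounds[OF _ k, of "snd z"] by auto
  show "continuous_map ?I X h"
    unfolding h_def loop_concat_def
  proof (rule cm_cases_le[OF ct0])
    have "continuous_map ?I X (\<lambda>z. H (fst z, (snd z)(0 := max 0 (min 1 (2 * snd z 0)))))"
      using cm_comp[OF H c[of 0]] by simp
    then show "continuous_map (subtopology ?I {z \<in> topspace ?I. snd z 0 \<le> 1/2}) X (\<lambda>z. H (fst z, (snd z)(0 := 2 * snd z 0)))"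
    proof (rule continuous_map_eq[OF continuous_map_from_subtopology])
      fix z assume z: "z \<in> topspace (subtopology ?I {z \<in> topspace ?I. snd z 0 \<le> 1/2})"
      then have "0 \<le> snd z 0" using top by auto
      then have "max 0 (min 1 (2 * snd z 0)) = 2 * snd z 0" using z by auto
      then show "H (fst z, (snd z)(0 := max 0 (min 1 (2 * snd z 0)))) = H (fst z, (snd z)(0 := 2 * snd z 0))"
        by simp
    qed
    show "continuous_map (subtopology ?I {z \<in> topspace ?I. 1/2 \<le> snd z 0}) X (\<lambda>z. K (fst z, (snd z)(0 := 2 * snd z 0 - 1)))"
    proof (rule continuous_map_eq[OF continuous_map_from_subtopology[OF cm_comp[OF K c[of 1]]]])
      fix z assume z: "z \<in> topspace (subtopology ?I {z \<in> topspace ?I. 1/2 \<le> snd z 0})"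
      then have "snd z 0 \<le> 1" using top by auto
      then have "max 0 (min 1 (2 * snd z 0 - 1)) = 2 * snd z 0 - 1" using z by auto
      then show "K (fst z, (snd z)(0 := max 0 (min 1 (2 * snd z 0 - 1)))) = K (fst z, (snd z)(0 := 2 * snd z 0 - 1))"
        by simp
    qed
    show "H (fst z, (snd z)(0 := 2 * snd z 0)) = K (fst z, (snd z)(0 := 2 * snd z 0 - 1))"
      if z: "z \<in> topspace ?I" "snd z 0 = 1/2" for z
    proof -
      have s: "0 \<le> fst z" "fst z \<le> 1" and t: "snd z \<in> topspace (cube k)" using z by auto
      have "(snd z)(0 := q) \<in> cube_boundary k" if "q = 0 \<or> q = 1" for q
        by (rule update_in_boundary[OF t k]) (use that in auto)
      then show ?thesis using Hb[OF s] Kb[OF s] z(2) by simp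
    qed
  qed simp
  fix s :: real and t assume s: "0 \<le> s" "s \<le> 1" and t: "t \<in> cube_boundary k"
  have tc: "t \<in> topspace (cube k)" using t cube_boundary_subset by blast
  note t0 = cube_bounds[OF tc k]
  show "h (s, t) = x"
  proof (cases "t 0 \<le> 1/2")
    case True
    have "t(0 := 2 * t 0) \<in> cube_boundary k"
      by (rule update_in_boundary[OF tc k]) (use True t0 t in auto)
    then show ?thesis using True Hb[OF s] by (simp add: h_def loop_concat_def)
  next
    case False
    have "t(0 := 2 * t 0 - 1) \<in> cube_boundary k"
      by (rule update_in_boundary[OF tc k]) (use False t0 t in auto)
    then show ?thesis using False Kb[OF s] by (simp add: h_def loop_concat_def)
  qed
qed

lemma loop_homotopic_concat:
  assumes k: "0 < k" and aa: "loop_homotopic k X x a a'" and bb: "loop_homotopic k X x b b'"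
  shows "loop_homotopic k X x (loop_concat a b) (loop_concat a' b')"
proof -
  obtain H where H: "continuous_map (prod_topology unit_interval (cube k)) X H"
    "\<And>t. H (0, t) = a t" "\<And>t. H (1, t) = a' t"
    "\<And>s t. 0 \<le> s \<Longrightarrow> s \<le> 1 \<Longrightarrow> t \<in> cube_boundary k \<Longrightarrow> H (s, t) = x"
    using aa by (rule loop_homotopicE) auto
  obtain K where K: "continuous_map (prod_topology unit_interval (cube k)) X K"
    "\<And>t. K (0, t) = b t" "\<And>t. K (1, t) = b' t"
    "\<And>s t. 0 \<le> s \<Longrightarrow> s \<le> 1 \<Longrightarrow> t \<in> cube_boundary k \<Longrightarrow> K (s, t) = x"
    using bb by (rule loop_homotopicE) auto
  let ?h = "\<lambda>z. loop_concat (\<lambda>t. H (fst z, t)) (\<lambda>t. K (fst z, t)) (snd z)"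
  have h1: "continuous_map (prod_topology unit_interval (cube k)) X ?h"
    by (rule cm_loop_concat(1)[OF k H(1) K(1)]) (simp_all add: H(4) K(4))
  have h2: "?h (s, t) = x" if "0 \<le> s" "s \<le> 1" "t \<in> cube_boundary k" for s t
    by (rule cm_loop_concat(2)[OF k H(1) K(1)]) (simp_all add: H(4) K(4) that)
  show ?thesis
  proof (rule loop_homotopicI[OF h1])
    show "loop_concat (\<lambda>t'. H (fst (0, t), t')) (\<lambda>t'. K (fst (0, t), t')) (snd (0, t)) = loop_concat a b t" for t
      by (simp add: loop_concat_def H(2) K(2))
    show "loop_concat (\<lambda>t'. H (fst (1, t), t')) (\<lambda>t'. K (fst (1, t), t')) (snd (1, t)) = loop_concat a' b' t" for t
      by (simp add: loop_concat_def H(3) K(3))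
  qed (rule h2)
qed

lemma mult_loop_class:
  assumes k: "0 < k" and a: "a \<in> loops k X x" and b: "b \<in> loops k X x"
  shows "mult (homotopy_group k X x) (loop_class k X x a) (loop_class k X x b) = loop_class k X x (loop_concat a b)"
proof -
  note refl = loop_homotopic_refl[OF a] loop_homotopic_refl[OF b]
  have "loop_concat a b \<in> loops k X x"
    using loop_homotopic_imp_loops[OF loop_homotopic_concat[OF k refl]] by simp
  then have eq: "loop_class k X x (loop_concat a' b') = loop_class k X x (loop_concat a b)"
    if "a' \<in> loop_class k X x a" "b' \<in> loop_class k X x b" for a' b'
  proof -
    have "loop_homotopic k X x (loop_concat a b) (loop_concat a' b')"
      using that unfolding in_loop_class by (rule loop_homotopic_concat[OF k])
    then have "loop_class k X x (loop_concat a b) = loop_class k X x (loop_concat a' b')"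
      by (simp only: loop_class_eq_iff[OF \<open>loop_concat a b \<in> loops k X x\<close>])
    then show ?thesis ..
  qed
  have a_in: "a \<in> loop_class k X x a" and b_in: "b \<in> loop_class k X x b"
    using refl by (simp_all add: in_loop_class)
  show ?thesis
    unfolding homotopy_group_def monoid.simps
  proof (intro equalityI subsetI)
    fix z assume "z \<in> (\<Union>a\<in>loop_class k X x a. \<Union>b\<in>loop_class k X x b. loop_class k X x (loop_concat a b))"
    then show "z \<in> loop_class k X x (loop_concat a b)" by (elim UN_E) (simp only: eq)
  next
    fix z assume "z \<in> loop_class k X x (loop_concat a b)"
    then show "z \<in> (\<Union>a\<in>loop_class k X x a. \<Union>b\<in>loop_class k X x b. loop_class k X x (loop_concat a b))"
      by (intro UN_I[OF a_in] UN_I[OF b_in])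
  qed
qed

text \<open>Composition with \<open>f\<close> commutes with \<open>loop_concat\<close> on the nose,
  so the induced map is a homomorphism for positive \<open>k\<close> and only bijectivity is at
  stake.\<close>

lemma automorphism_iff_pi_bijective:
  assumes f: "f \<in> based_maps X x X x"
  shows "induced_map k X x (based_class X x X x f) \<in> homotopy_group_automorphisms k X x \<longleftrightarrow> pi_bijective k X x X x f"
proof -
  let ?h = "induced_map k X x (based_class X x X x f)"
  let ?G = "homotopy_group k X x"
  let ?c = "loop_class k X x"
  have carrier: "carrier ?G = ?c ` loops k X x" by (simp add: homotopy_group_def)
  have h: "?h (?c a) = ?c (f \<circ> a)" if "a \<in> loops k X x" for a by (rule induced_map_class[OF f that])
  have fa: "f \<circ> a \<in> loops k X x" if "a \<in> loops k X x" for a by (rule loops_comp[OF that f])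
  have closed: "?h ` carrier ?G \<subseteq> carrier ?G" using h fa by (auto simp: carrier)
  have "inj_on ?h (carrier ?G) \<longleftrightarrow>
      (\<forall>a\<in>loops k X x. \<forall>b\<in>loops k X x. loop_homotopic k X x (f \<circ> a) (f \<circ> b) \<longrightarrow> loop_homotopic k X x a b)"
    unfolding carrier inj_on_def ball_simps by (intro ball_cong refl) (simp add: h fa loop_class_eq_iff)
  moreover have "carrier ?G \<subseteq> ?h ` carrier ?G \<longleftrightarrow> (\<forall>b\<in>loops k X x. \<exists>a\<in>loops k X x. loop_homotopic k X x (f \<circ> a) b)"
  proof -
    have "carrier ?G \<subseteq> ?h ` carrier ?G \<longleftrightarrow> (\<forall>b\<in>loops k X x. \<exists>a\<in>loops k X x. ?c b = ?c (f \<circ> a))"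
    proof -
      have img: "?h ` carrier ?G = (\<lambda>a. ?c (f \<circ> a)) ` loops k X x"
        unfolding carrier image_image by (intro image_cong refl) (rule h)
      show ?thesis unfolding img unfolding carrier image_subset_iff image_iff ..
    qed
    also have "\<dots> \<longleftrightarrow> (\<forall>b\<in>loops k X x. \<exists>a\<in>loops k X x. loop_homotopic k X x (f \<circ> a) b)"
      using loop_class_eq_iff[OF fa] by (intro ball_cong bex_cong refl) (metis)
    finally show ?thesis .
  qed
  ultimately have bij: "bij_betw ?h (carrier ?G) (carrier ?G) \<longleftrightarrow> pi_bijective k X x X x f"
    using closed unfolding bij_betw_def pi_bijective_def by blast
  show ?thesis
  proof (cases "k = 0")
    case True
    then show ?thesis using bij by (simp add: homotopy_group_automorphisms_def)
  next
    case False
    then have k: "0 < k" by simp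
    have "?h \<in> hom ?G ?G"
    proof (rule homI)
      show "?h A \<in> carrier ?G" if "A \<in> carrier ?G" for A using closed that by blast
      fix A B assume "A \<in> carrier ?G" "B \<in> carrier ?G"
      then obtain a b where ab: "a \<in> loops k X x" "A = ?c a" "b \<in> loops k X x" "B = ?c b" by (auto simp: carrier)
      have cc: "loop_concat a b \<in> loops k X x"
        using loop_homotopic_imp_loops[OF loop_homotopic_concat[OF k loop_homotopic_refl[OF ab(1)] loop_homotopic_refl[OF ab(3)]]] by simp
      have "f \<circ> loop_concat a b = loop_concat (f \<circ> a) (f \<circ> b)" by (auto simp: loop_concat_def)
      then show "?h (mult ?G A B) = mult ?G (?h A) (?h B)"
        using ab h cc fa by (simp add: mult_loop_class[OF k])
    qed
    then show ?thesis using bij False by (simp add: homotopy_group_automorphisms_def iso_def)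
  qed
qed

lemma A_sharp_iff:
  assumes "f \<in> based_maps X x X x"
  shows "based_class X x X x f \<in> A_sharp n X x \<longleftrightarrow> (\<forall>k. enat k \<le> n \<longrightarrow> pi_bijective k X x X x f)"
  using assms by (auto simp: A_sharp_def based_classes_def automorphism_iff_pi_bijective)

lemma self_equivalences_iff:
  assumes "f \<in> based_maps X x X x"
  shows "based_class X x X x f \<in> self_equivalences X x \<longleftrightarrow> based_homotopy_equivalence X x X x f"
proof
  assume "based_class X x X x f \<in> self_equivalences X x"
  then obtain g where g: "based_class X x X x f = based_class X x X x g" "based_homotopy_equivalence X x X x g"
    by (auto simp: self_equivalences_def)
  from g(1) have "based_homotopic X x X x f g"
    by (simp add: based_class_eq_iff[OF assms])
  then have "based_homotopic X x X x g f" by (rule based_homotopic_sym)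
  then show "based_homotopy_equivalence X x X x f" by (rule based_homotopy_equivalence_homotopic[OF g(2)])
qed (auto simp: self_equivalences_def)

text \<open>Equivalences always induce automorphisms, so equality of the two sets amounts to one
  inclusion, here stated for representatives.\<close>

lemma A_sharp_eq_iff:
  "A_sharp n X x = self_equivalences X x \<longleftrightarrow>
     (\<forall>f\<in>based_maps X x X x. (\<forall>k. enat k \<le> n \<longrightarrow> pi_bijective k X x X x f) \<longrightarrow> based_homotopy_equivalence X x X x f)"
proof -
  have rep: "\<exists>f\<in>based_maps X x X x. c = based_class X x X x f" if "c \<in> A_sharp n X x \<or> c \<in> self_equivalences X x" for c
    using that by (auto simp: A_sharp_def based_classes_def self_equivalences_def based_homotopy_equivalence_def)
  have "self_equivalences X x \<subseteq> A_sharp n X x"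
  proof
    fix c assume c: "c \<in> self_equivalences X x"
    then obtain f where f: "f \<in> based_maps X x X x" "c = based_class X x X x f" using rep by blast
    then show "c \<in> A_sharp n X x"
      using c by (simp add: A_sharp_iff self_equivalences_iff pi_bijective_equivalence)
  qed
  moreover have "A_sharp n X x \<subseteq> self_equivalences X x \<longleftrightarrow>
    (\<forall>f\<in>based_maps X x X x. (\<forall>k. enat k \<le> n \<longrightarrow> pi_bijective k X x X x f) \<longrightarrow> based_homotopy_equivalence X x X x f)"
  proof
    assume sub: "A_sharp n X x \<subseteq> self_equivalences X x"
    show "\<forall>f\<in>based_maps X x X x. (\<forall>k. enat k \<le> n \<longrightarrow> pi_bijective k X x X x f) \<longrightarrow> based_homotopy_equivalence X x X x f"
    proof (intro ballI impI)
      fix f assume f: "f \<in> based_maps X x X x" and bij: "\<forall>k. enat k \<le> n \<longrightarrow> pi_bijective k X x X x f"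
      then have "based_class X x X x f \<in> A_sharp n X x" by (simp add: A_sharp_iff)
      then have "based_class X x X x f \<in> self_equivalences X x" using sub by (rule rev_subsetD)
      then show "based_homotopy_equivalence X x X x f" by (simp only: self_equivalences_iff[OF f])
    qed
  next
    assume *: "\<forall>f\<in>based_maps X x X x. (\<forall>k. enat k \<le> n \<longrightarrow> pi_bijective k X x X x f) \<longrightarrow> based_homotopy_equivalence X x X x f"
    show "A_sharp n X x \<subseteq> self_equivalences X x"
    proof
      fix c assume c: "c \<in> A_sharp n X x"
      then obtain f where "f \<in> based_maps X x X x" "c = based_class X x X x f" using rep by blast
      then show "c \<in> self_equivalences X x"
        using c * by (simp add: A_sharp_iff self_equivalences_iff)
    qed
  qed
  ultimately show ?thesis by blast
qed

text \<open>\<open>h \<circ> f\<close> maps into a complex and is bijective on homotopy groups, so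
  it has a right inverse \<open>v\<close>, and \<open>v \<circ> h\<close> is one for
  \<open>f\<close>. By \<open>pi_bijective_right_inverse\<close> it is again bijective on homotopy
  groups and can be inverted in the same way.\<close>

theorem Whitehead:
  assumes Y: "connected_based_CW_complex Y y" and XY: "\<exists>h. based_homotopy_equivalence X x Y y h"
    and x: "x \<in> topspace X" and f: "f \<in> based_maps X x X x" and bij: "\<And>k. pi_bijective k X x X x f"
  shows "based_homotopy_equivalence X x X x f"
proof -
  obtain C where C: "cw_complex Y C" and conn: "path_connected_space Y" and y: "y \<in> topspace Y" "cw_complex.cdim C y = 0"
    using Y by (rule connected_based_CW_complexE)
  interpret cw_complex Y C by (rule C)
  obtain h where hh: "based_homotopy_equivalence X x Y y h" using XY by blast
  then obtain h' where h: "h \<in> based_maps X x Y y" and h': "h' \<in> based_maps Y y X x"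
    and h'h: "based_homotopic X x X x (h' \<circ> h) id"
    by (rule based_homotopy_equivalenceE)
  have "path_connected_space X"
    unfolding path_connected_space_iff_path_component
  proof -
    obtain R where R: "continuous_map (prod_topology unit_interval X) X R"
      "\<And>z. R (0, z) = (h' \<circ> h) z" "\<And>z. R (1, z) = id z"
      using h'h by (rule based_homotopicE) auto
    have *: "path_component_of X (h' (h z)) z" if "z \<in> topspace X" for z
    proof -
      have "pathin X (\<lambda>s. R (s, z))"
        unfolding pathin_def by (rule cm_comp[OF R(1)]) (use that in \<open>auto intro!: cm_pair cm_id\<close>)
      then show ?thesis unfolding path_component_of_def using R(2,3) by (intro exI[of _ "\<lambda>s. R (s, z)"]) simp
    qed
    have **: "path_component_of X (h' (h z)) (h' (h w))" if "z \<in> topspace X" "w \<in> topspace X" for z w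
    proof -
      have "path_component_of Y (h z) (h w)"
        using conn cm_range[OF based_mapsD(1)[OF h]] that by (simp add: path_connected_space_iff_path_component)
      then obtain p where "pathin Y p" "p 0 = h z" "p 1 = h w" unfolding path_component_of_def by blast
      then show ?thesis
        unfolding path_component_of_def pathin_def
        using continuous_map_compose[OF _ based_mapsD(1)[OF h']] by (intro exI[of _ "h' \<circ> p"]) simp
    qed
    show "\<forall>z\<in>topspace X. \<forall>w\<in>topspace X. path_component_of X z w"
      using * ** path_component_of_sym path_component_of_trans by metis
  qed
  note connX = this
  have right_inverse: "\<exists>g\<in>based_maps X x X x. based_homotopic X x X x (f \<circ> g) id"
    if f: "f \<in> based_maps X x X x" and bij: "\<And>k. pi_bijective k X x X x f" for f
  proof -
    have hf: "h \<circ> f \<in> based_maps X x Y y" by (rule based_maps_comp[OF f h])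
    have "pi_equivalence X x Y y (h \<circ> f)"
      by (intro pi_equivalence.intro hf pi_bijective_comp[OF bij pi_bijective_equivalence[OF hh] f h] connX x conn y)
    then obtain v where v: "v \<in> based_maps Y y X x" "based_homotopic Y y Y y (h \<circ> f \<circ> v) id"
      using pi_equivalence_right_inverse[OF conn y] by metis
    have vh: "v \<circ> h \<in> based_maps X x X x" by (rule based_maps_comp[OF h v(1)])
    have fvh: "f \<circ> (v \<circ> h) \<in> based_maps X x X x" by (rule based_maps_comp[OF vh f])
    have "based_homotopic X x X x ((h' \<circ> h) \<circ> (f \<circ> (v \<circ> h))) (id \<circ> (f \<circ> (v \<circ> h)))"
      by (rule based_homotopic_comp_right[OF h'h fvh])
    then have "based_homotopic X x X x (f \<circ> (v \<circ> h)) ((h' \<circ> h) \<circ> (f \<circ> (v \<circ> h)))"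
      using based_homotopic_sym by simp
    also have "based_homotopic X x X x ((h' \<circ> h) \<circ> (f \<circ> (v \<circ> h))) (h' \<circ> (id \<circ> h))"
      using based_homotopic_comp_left[OF based_homotopic_comp_right[OF v(2) h] h'] by (simp add: o_assoc)
    also have "based_homotopic X x X x (h' \<circ> (id \<circ> h)) id" using h'h by simp
    finally show ?thesis using vh by blast
  qed
  obtain g where g: "g \<in> based_maps X x X x" "based_homotopic X x X x (f \<circ> g) id"
    using right_inverse[OF f bij] by blast
  obtain k where k: "k \<in> based_maps X x X x" "based_homotopic X x X x (g \<circ> k) id"
    using right_inverse[OF g(1) pi_bijective_right_inverse[OF bij f g]] by blast
  show ?thesis by (rule based_homotopy_equivalence_right_inverses[OF f g(1) k(1) g(2) k(2)])
qed

lemma A_sharp_self_closeness: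
  assumes "connected_based_CW_complex Y y" "\<exists>h. based_homotopy_equivalence X x Y y h" "x \<in> topspace X"
  shows "A_sharp (self_closeness X x) X x = self_equivalences X x"
proof -
  have "A_sharp \<infinity> X x = self_equivalences X x"
    unfolding A_sharp_eq_iff using Whitehead[OF assms] by simp
  then show ?thesis unfolding self_closeness_def by (rule LeastI)
qed

section \<open>Products\<close>

definition incl :: "'i set \<Rightarrow> ('i \<Rightarrow> 'a) \<Rightarrow> 'i \<Rightarrow> 'a \<Rightarrow> 'i \<Rightarrow> 'a" where
  "incl I x k u = restrict (x(k := u)) I"

context
  fixes I :: "'i set" and X :: "'i \<Rightarrow> 'a topology" and x :: "'i \<Rightarrow> 'a"
  assumes x: "\<And>j. j \<in> I \<Longrightarrow> x j \<in> topspace (X j)"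
begin

abbreviation "PX \<equiv> product_topology X I"
abbreviation "px \<equiv> restrict x I"

lemma px_in: "px \<in> topspace PX"
  using x by auto

lemma proj_based: "j \<in> I \<Longrightarrow> (\<lambda>z. z j) \<in> based_maps PX px (X j) (x j)"
  by (rule based_mapsI) (auto intro!: cm_coord cm_id)

lemma incl_based: "k \<in> I \<Longrightarrow> incl I x k \<in> based_maps (X k) (x k) PX px"
proof (rule based_mapsI)
  assume "k \<in> I"
  show "continuous_map (X k) PX (incl I x k)"
  proof (rule cm_product)
    show "continuous_map (X k) (X i) (\<lambda>z. incl I x k z i)" if "i \<in> I" for i
      using that x by (cases "i = k") (auto simp: incl_def intro: cm_id)
  qed (simp add: incl_def)
  show "incl I x k (x k) = px" by (simp add: incl_def)
qed

lemma loop_homotopic_componentwise: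
  assumes a: "a \<in> loops n PX px" and b: "b \<in> loops n PX px"
    and h: "\<And>j. j \<in> I \<Longrightarrow> loop_homotopic n (X j) (x j) (\<lambda>t. a t j) (\<lambda>t. b t j)"
  shows "loop_homotopic n PX px a b"
proof -
  have "\<forall>j\<in>I. \<exists>h. continuous_map (prod_topology unit_interval (cube n)) (X j) h \<and>
    (\<forall>t. h (0, t) = a t j) \<and> (\<forall>t. h (1, t) = b t j) \<and> (\<forall>s t. 0 \<le> s \<longrightarrow> s \<le> 1 \<longrightarrow> t \<in> cube_boundary n \<longrightarrow> h (s, t) = x j)"
  proof
    fix j assume "j \<in> I"
    obtain H where "continuous_map (prod_topology unit_interval (cube n)) (X j) H"
      "\<And>t. H (0, t) = a t j" "\<And>t. H (1, t) = b t j"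
      "\<And>s t. 0 \<le> s \<Longrightarrow> s \<le> 1 \<Longrightarrow> t \<in> cube_boundary n \<Longrightarrow> H (s, t) = x j"
      using h[OF \<open>j \<in> I\<close>] by (rule loop_homotopicE) auto
    then show "\<exists>h. continuous_map (prod_topology unit_interval (cube n)) (X j) h \<and>
      (\<forall>t. h (0, t) = a t j) \<and> (\<forall>t. h (1, t) = b t j) \<and> (\<forall>s t. 0 \<le> s \<longrightarrow> s \<le> 1 \<longrightarrow> t \<in> cube_boundary n \<longrightarrow> h (s, t) = x j)"
      by (intro exI[of _ H]) simp
  qed
  from bchoice[OF this] obtain H where H': "\<forall>j\<in>I. continuous_map (prod_topology unit_interval (cube n)) (X j) (H j) \<and>
    (\<forall>t. H j (0, t) = a t j) \<and> (\<forall>t. H j (1, t) = b t j) \<and> (\<forall>s t. 0 \<le> s \<longrightarrow> s \<le> 1 \<longrightarrow> t \<in> cube_boundary n \<longrightarrow> H j (s, t) = x j)" ..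
  have H: "\<And>j. j \<in> I \<Longrightarrow> continuous_map (prod_topology unit_interval (cube n)) (X j) (H j)"
    "\<And>j t. j \<in> I \<Longrightarrow> H j (0, t) = a t j" "\<And>j t. j \<in> I \<Longrightarrow> H j (1, t) = b t j"
    "\<And>j s t. j \<in> I \<Longrightarrow> 0 \<le> s \<Longrightarrow> s \<le> 1 \<Longrightarrow> t \<in> cube_boundary n \<Longrightarrow> H j (s, t) = x j"
    using H' by simp_all
  have ext: "restrict (c t) I = c t" if "c \<in> loops n PX px" "t \<in> topspace (cube n)" for c t
  proof -
    have "c t \<in> topspace PX" using that cm_range[of "cube n" PX c t] by (simp add: loops_def)
    then show ?thesis by (auto simp: PiE_def extensional_restrict)
  qed
  show ?thesis
  proof (rule loop_homotopicI[where h = "\<lambda>z. \<lambda>j\<in>I. H j z"])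
    show "continuous_map (prod_topology unit_interval (cube n)) PX (\<lambda>z. \<lambda>j\<in>I. H j z)"
      by (rule cm_product) (simp_all add: H)
    show "(\<lambda>j\<in>I. H j (0, t)) = a t" if "t \<in> topspace (cube n)" for t
      using ext[OF a that] H(2) by (metis (no_types, lifting) restrict_ext)
    show "(\<lambda>j\<in>I. H j (1, t)) = b t" if "t \<in> topspace (cube n)" for t
      using ext[OF b that] H(3) by (metis (no_types, lifting) restrict_ext)
    show "(\<lambda>j\<in>I. H j (s, t)) = px" if "0 \<le> s" "s \<le> 1" "t \<in> cube_boundary n" for s t
      using H(4) that by (intro restrict_ext) auto
  qed
qed

lemma loop_homotopic_component:
  "\<lbrakk>loop_homotopic n PX px a b; j \<in> I\<rbrakk> \<Longrightarrow> loop_homotopic n (X j) (x j) (\<lambda>t. a t j) (\<lambda>t. b t j)"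
  using loop_homotopic_comp[OF _ proj_based, of n a b j] by (simp add: o_def)

lemma loop_component: "\<lbrakk>a \<in> loops n PX px; j \<in> I\<rbrakk> \<Longrightarrow> (\<lambda>t. a t j) \<in> loops n (X j) (x j)"
  using loops_comp[OF _ proj_based, of a n j] by (simp add: o_def)

text \<open>On homotopy, \<open>g\<close> is block triangular with identity blocks outside
  \<open>k\<close>. For injectivity, loops are placed on the axis \<open>k\<close>. For
  surjectivity, a preimage \<open>z\<close> of a loop on the axis has, in the other coordinates, the
  components of its image, which are null; hence \<open>z\<close> is homotopic to its own k-th
  component placed on the axis.\<close>

lemma pi_bijective_component:
  assumes k: "k \<in> I" and g: "g \<in> based_maps PX px PX px"
    and other: "\<And>z j. z \<in> topspace PX \<Longrightarrow> j \<in> I \<Longrightarrow> j \<noteq> k \<Longrightarrow> g z j = z j"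
    and bij: "pi_bijective n PX px PX px g"
  shows "pi_bijective n (X k) (x k) (X k) (x k) (\<lambda>u. g (incl I x k u) k)"
proof -
  let ?\<phi> = "\<lambda>u. g (incl I x k u) k"
  have \<phi>: "?\<phi> \<in> based_maps (X k) (x k) (X k) (x k)"
    using based_maps_comp[OF based_maps_comp[OF incl_based[OF k] g] proj_based[OF k]] by (simp add: o_def)
  have loop_incl: "incl I x k \<circ> a \<in> loops n PX px" if "a \<in> loops n (X k) (x k)" for a
    by (rule loops_comp[OF that incl_based[OF k]])
  have g_incl: "(g \<circ> (incl I x k \<circ> a)) t j = (if j = k then ?\<phi> (a t) else x j)"
    if "a \<in> loops n (X k) (x k)" "t \<in> topspace (cube n)" "j \<in> I" for a t j
  proof -
    have "a t \<in> topspace (X k)" using that(1,2) cm_range[of "cube n" "X k" a t] by (simp add: loops_def)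
    then have "incl I x k (a t) \<in> topspace PX" using cm_range[OF based_mapsD(1)[OF incl_based[OF k]]] by simp
    then show ?thesis using other[OF _ that(3)] that(3) by (auto simp: incl_def)
  qed
  have eq: "loop_homotopic n Z z c d" if "c \<in> loops n Z z" "\<And>t. t \<in> topspace (cube n) \<Longrightarrow> c t = d t"
    for Z :: "'a topology" and z c d
    using rel_homotopic_eq[of n Z c d] rel_homotopic_loops[of n c z Z d] that by (simp add: loops_def)
  show ?thesis
  proof (rule pi_bijectiveI)
    fix a b assume a: "a \<in> loops n (X k) (x k)" and b: "b \<in> loops n (X k) (x k)"
      and h: "loop_homotopic n (X k) (x k) (?\<phi> \<circ> a) (?\<phi> \<circ> b)"
    have "loop_homotopic n PX px (g \<circ> (incl I x k \<circ> a)) (g \<circ> (incl I x k \<circ> b))"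
    proof (rule loop_homotopic_componentwise)
      show "loop_homotopic n (X j) (x j) (\<lambda>t. (g \<circ> (incl I x k \<circ> a)) t j) (\<lambda>t. (g \<circ> (incl I x k \<circ> b)) t j)" if j: "j \<in> I" for j
      proof (cases "j = k")
        case True
        then show ?thesis using h by (simp add: o_def)
      next
        case False
        show ?thesis
          by (rule eq[OF loop_component[OF loops_comp[OF loop_incl[OF a] g] j]])
            (use g_incl[OF a _ j] g_incl[OF b _ j] False in simp)
      qed
    qed (intro loops_comp[OF loop_incl g] a b)+
    then have "loop_homotopic n PX px (incl I x k \<circ> a) (incl I x k \<circ> b)"
      by (rule pi_bijective_inj[OF bij _ loop_incl[OF a] loop_incl[OF b]])
    from loop_homotopic_component[OF this k] show "loop_homotopic n (X k) (x k) a b"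
      using k by (simp add: incl_def o_def)
  next
    fix b assume b: "b \<in> loops n (X k) (x k)"
    obtain z where z: "z \<in> loops n PX px" "loop_homotopic n PX px (g \<circ> z) (incl I x k \<circ> b)"
      using pi_bijective_surj[OF bij loop_incl[OF b]] by metis
    let ?a = "\<lambda>t. z t k"
    have a: "?a \<in> loops n (X k) (x k)" by (rule loop_component[OF z(1) k])
    have z_in: "z t \<in> topspace PX" if "t \<in> topspace (cube n)" for t
      using z(1) that cm_range[of "cube n" PX z t] by (simp add: loops_def)
    have "loop_homotopic n PX px (incl I x k \<circ> ?a) z"
    proof (rule loop_homotopic_componentwise[OF loop_incl[OF a] z(1)])
      fix j assume j: "j \<in> I"
      show "loop_homotopic n (X j) (x j) (\<lambda>t. (incl I x k \<circ> ?a) t j) (\<lambda>t. z t j)"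
      proof (cases "j = k")
        case True
        then show ?thesis using loop_homotopic_refl[OF a] k by (simp add: incl_def)
      next
        case False
        have "loop_homotopic n (X j) (x j) (\<lambda>t. z t j) (\<lambda>t. (g \<circ> z) t j)"
          by (rule eq[OF loop_component[OF z(1) j]]) (simp add: other[OF z_in j False])
        also have "loop_homotopic n (X j) (x j) (\<lambda>t. (g \<circ> z) t j) (\<lambda>t. (incl I x k \<circ> b) t j)"
          by (rule loop_homotopic_component[OF z(2) j])
        finally show ?thesis using False j loop_homotopic_sym by (simp add: incl_def)
      qed
    qed
    from loop_homotopic_component[OF loop_homotopic_trans[OF loop_homotopic_comp[OF this g] z(2)] k]
    have "loop_homotopic n (X k) (x k) (?\<phi> \<circ> ?a) b"
      using k by (simp add: o_def incl_def)
    then show "\<exists>a\<in>loops n (X k) (x k). loop_homotopic n (X k) (x k) (?\<phi> \<circ> a) b"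
      using a by blast
  qed
qed

lemma product_with_identity_based:
  assumes k: "k \<in> I" and f: "f \<in> based_maps (X k) (x k) (X k) (x k)"
  shows "(\<lambda>z. z(k := f (z k))) \<in> based_maps PX px PX px"
proof (rule based_mapsI)
  show "continuous_map PX PX (\<lambda>z. z(k := f (z k)))"
  proof (rule cm_product)
    show "z(k := f (z k)) \<in> extensional I" if "z \<in> topspace PX" for z
      using that k by (auto simp: PiE_def extensional_def)
    show "continuous_map PX (X i) (\<lambda>z. (z(k := f (z k))) i)" if "i \<in> I" for i
      using based_mapsD(1)[OF proj_based[OF that]] cm_comp[OF based_mapsD(1)[OF f] based_mapsD(1)[OF proj_based[OF k]]]
      by (cases "i = k") simp_all
  qed
  show "px(k := f (px k)) = px" using k based_mapsD(2)[OF f] by (auto simp: fun_eq_iff)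
qed

lemma pi_bijective_product_with_identity:
  assumes k: "k \<in> I" and f: "f \<in> based_maps (X k) (x k) (X k) (x k)"
    and bij: "pi_bijective n (X k) (x k) (X k) (x k) f"
  shows "pi_bijective n PX px PX px (\<lambda>z. z(k := f (z k)))" (is "pi_bijective _ _ _ _ _ ?F")
proof (rule pi_bijectiveI)
  have F: "?F \<in> based_maps PX px PX px" by (rule product_with_identity_based[OF k f])
  fix a b assume a: "a \<in> loops n PX px" and b: "b \<in> loops n PX px" and h: "loop_homotopic n PX px (?F \<circ> a) (?F \<circ> b)"
  show "loop_homotopic n PX px a b"
  proof (rule loop_homotopic_componentwise[OF a b])
    fix j assume j: "j \<in> I"
    show "loop_homotopic n (X j) (x j) (\<lambda>t. a t j) (\<lambda>t. b t j)"
    proof (cases "j = k")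
      case True
      have "loop_homotopic n (X k) (x k) (f \<circ> (\<lambda>t. a t k)) (f \<circ> (\<lambda>t. b t k))"
        using loop_homotopic_component[OF h k] by (simp add: o_def)
      then show ?thesis
        using pi_bijective_inj[OF bij _ loop_component[OF a k] loop_component[OF b k]] True by simp
    next
      case False
      then show ?thesis using loop_homotopic_component[OF h j] by simp
    qed
  qed
next
  have F: "?F \<in> based_maps PX px PX px" by (rule product_with_identity_based[OF k f])
  fix b assume b: "b \<in> loops n PX px"
  obtain c where c: "c \<in> loops n (X k) (x k)" "loop_homotopic n (X k) (x k) (f \<circ> c) (\<lambda>t. b t k)"
    using pi_bijective_surj[OF bij loop_component[OF b k]] by metis
  let ?a = "\<lambda>t. (b t)(k := c t)"
  have cb: "continuous_map (cube n) PX b" and cc: "continuous_map (cube n) (X k) c"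
    using b c(1) by (simp_all add: loops_def)
  have "continuous_map (cube n) PX ?a"
  proof (rule cm_product)
    show "?a t \<in> extensional I" if "t \<in> topspace (cube n)" for t
      using cm_range[OF cb that] k by (auto simp: PiE_def extensional_def)
    show "continuous_map (cube n) (X i) (\<lambda>t. ?a t i)" if "i \<in> I" for i
      using cm_coord[OF cb that] cc by (cases "i = k") simp_all
  qed
  then have a: "?a \<in> loops n PX px"
    using b c(1) k by (auto simp: loops_def fun_eq_iff)
  have "loop_homotopic n PX px (?F \<circ> ?a) b"
  proof (rule loop_homotopic_componentwise[OF loops_comp[OF a F] b])
    fix j assume j: "j \<in> I"
    show "loop_homotopic n (X j) (x j) (\<lambda>t. (?F \<circ> ?a) t j) (\<lambda>t. b t j)"
      using c(2) loop_homotopic_refl[OF loop_component[OF b j]] by (cases "j = k") (simp_all add: o_def)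
  qed
  then show "\<exists>a\<in>loops n PX px. loop_homotopic n PX px (?F \<circ> a) b" using a by blast
qed

text \<open>The factor is a retract of the product, and the map intertwines with \<open>f\<close>
  under both the inclusion and the projection. Hence inclusion, inverse and projection compose to an
  inverse of \<open>f\<close>.\<close>

lemma factor_equivalence:
  assumes k: "k \<in> I" and f: "f \<in> based_maps (X k) (x k) (X k) (x k)"
    and eqv: "based_homotopy_equivalence PX px PX px (\<lambda>z. z(k := f (z k)))"
  shows "based_homotopy_equivalence (X k) (x k) (X k) (x k) f"
proof -
  let ?F = "\<lambda>z. z(k := f (z k))" and ?\<iota> = "incl I x k" and ?p = "\<lambda>z. z k"
  note \<iota> = incl_based[OF k] and p = proj_based[OF k]
  obtain h where F: "?F \<in> based_maps PX px PX px" and h: "h \<in> based_maps PX px PX px"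
    and hF: "based_homotopic PX px PX px (h \<circ> ?F) id" and Fh: "based_homotopic PX px PX px (?F \<circ> h) id"
    using eqv by (rule based_homotopy_equivalenceE)
  have p\<iota>: "?p \<circ> ?\<iota> = id" using k by (simp add: incl_def fun_eq_iff)
  have F\<iota>: "?F \<circ> ?\<iota> = ?\<iota> \<circ> f" using k by (auto simp: incl_def fun_eq_iff restrict_def)
  show ?thesis
  proof (rule based_homotopy_equivalenceI[OF f, of "?p \<circ> (h \<circ> ?\<iota>)"])
    show "?p \<circ> (h \<circ> ?\<iota>) \<in> based_maps (X k) (x k) (X k) (x k)"
      by (rule based_maps_comp[OF based_maps_comp[OF \<iota> h] p])
    have "based_homotopic (X k) (x k) (X k) (x k) (?p \<circ> ((h \<circ> ?F) \<circ> ?\<iota>)) (?p \<circ> (id \<circ> ?\<iota>))"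
      by (rule based_homotopic_comp_left[OF based_homotopic_comp_right[OF hF \<iota>] p])
    moreover have "?p \<circ> ((h \<circ> ?F) \<circ> ?\<iota>) = (?p \<circ> (h \<circ> ?\<iota>)) \<circ> f" by (simp only: comp_assoc F\<iota>)
    ultimately show "based_homotopic (X k) (x k) (X k) (x k) ((?p \<circ> (h \<circ> ?\<iota>)) \<circ> f) id"
      using p\<iota> by simp
    have "based_homotopic (X k) (x k) (X k) (x k) (?p \<circ> ((?F \<circ> h) \<circ> ?\<iota>)) (?p \<circ> (id \<circ> ?\<iota>))"
      by (rule based_homotopic_comp_left[OF based_homotopic_comp_right[OF Fh \<iota>] p])
    moreover have "?p \<circ> ((?F \<circ> h) \<circ> ?\<iota>) = f \<circ> (?p \<circ> (h \<circ> ?\<iota>))" by (simp add: fun_eq_iff)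
    ultimately show "based_homotopic (X k) (x k) (X k) (x k) (f \<circ> (?p \<circ> (h \<circ> ?\<iota>))) id"
      using p\<iota> by simp
  qed
qed

end

text \<open>The hypothesis allows one replacement at a time; induction over the finite set
  \<open>S\<close> gives several at once.\<close>

lemma reducible_replace:
  assumes red: "reducible m X x A"
    and f: "f \<in> based_maps (prod_space m X) (prod_point m x) (prod_space m X) (prod_point m x)"
    and p: "prod_point m x \<in> topspace (prod_space m X)"
    and fA: "based_class (prod_space m X) (prod_point m x) (prod_space m X) (prod_point m x) f \<in> A"
    and S: "S \<subseteq> {1..m}"
  defines "g \<equiv> \<lambda>z. \<lambda>j\<in>{1..m}. if j \<in> S then z j else f z j"
  shows "g \<in> based_maps (prod_space m X) (prod_point m x) (prod_space m X) (prod_point m x) \<and>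
     based_class (prod_space m X) (prod_point m x) (prod_space m X) (prod_point m x) g \<in> A"
proof -
  let ?P = "prod_space m X" and ?p = "prod_point m x"
  define rep where "rep S = (\<lambda>z. \<lambda>j\<in>{1..m}. if j \<in> S then z j else f z j)" for S
  have based: "rep S \<in> based_maps ?P ?p ?P ?p" for S
  proof (rule based_mapsI)
    show "continuous_map ?P ?P (rep S)"
      unfolding prod_space_def
    proof (rule cm_product)
      show "continuous_map (product_topology X {1..m}) (X i) (\<lambda>z. rep S z i)" if "i \<in> {1..m}" for i
        using that cm_coord[OF cm_id that] cm_coord[OF based_mapsD(1)[OF f, unfolded prod_space_def] that]
        by (cases "i \<in> S") (simp_all add: rep_def)
    qed (simp add: rep_def)
    show "rep S ?p = ?p" using based_mapsD(2)[OF f] by (auto simp: rep_def prod_point_def fun_eq_iff)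
  qed
  have "finite S" using S finite_subset by blast
  then have "based_class ?P ?p ?P ?p (rep S) \<in> A"
    using S
  proof (induction S rule: finite_induct)
    case empty
    \<comment> \<open>Points of the product are extensional, so both functions agree on the space,
      possibly not elsewhere; their classes coincide nevertheless.\<close>
    have "f z = rep {} z" if "z \<in> topspace ?P" for z
      using cm_range[OF based_mapsD(1)[OF f] that]
      by (auto simp: rep_def prod_space_def PiE_def extensional_def fun_eq_iff)
    then have "based_homotopic ?P ?p ?P ?p f (rep {})" by (rule based_homotopic_eq[OF f p])
    then have "based_class ?P ?p ?P ?p f = based_class ?P ?p ?P ?p (rep {})"
      by (simp only: based_class_eq_iff[OF f])
    then show ?case using fA by (simp only:)
  next
    case (insert k S)
    then have "based_class ?P ?p ?P ?p (replace_component m k (rep S)) \<in> A"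
      using red based unfolding reducible_def Let_def by blast
    moreover have "replace_component m k (rep S) = rep (insert k S)"
      using insert.prems by (auto simp: replace_component_def tuple_map_def proj_def rep_def fun_eq_iff)
    ultimately show ?case by simp
  qed
  then show ?thesis using based[of S] by (simp add: g_def rep_def)
qed

theorem theorem3p3:
  fixes m :: nat
    and X :: "nat \<Rightarrow> 'a topology" and x :: "nat \<Rightarrow> 'a"
    and Y :: "nat \<Rightarrow> 'b topology" and y :: "nat \<Rightarrow> 'b"
    and N :: enat
  assumes "m \<ge> 2"
    and "\<And>k. k \<in> {1..m} \<Longrightarrow> x k \<in> topspace (X k)"
    and "\<And>k. k \<in> {1..m} \<Longrightarrow> connected_based_CW_complex (Y k) (y k)"
    and "\<And>k. k \<in> {1..m} \<Longrightarrow> \<exists>h. based_homotopy_equivalence (X k) (x k) (Y k) (y k) h"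
    and "N = Max ((\<lambda>k. self_closeness (X k) (x k)) ` {1..m})"
    and "reducible m X x (A_sharp N (prod_space m X) (prod_point m x))"
  shows "A_sharp N (prod_space m X) (prod_point m x) =
           self_equivalences (prod_space m X) (prod_point m x)
       \<and> N = self_closeness (prod_space m X) (prod_point m x)"
proof -
  let ?I = "{1..m}"
  let ?P = "prod_space m X" and ?p = "prod_point m x"
  have Pdef: "?P = product_topology X ?I" and pdef: "?p = restrict x ?I"
    by (simp_all add: prod_space_def prod_point_def)
  have p: "?p \<in> topspace ?P" unfolding Pdef pdef by (rule px_in[OF assms(2)])
  have fin: "finite ((\<lambda>k. self_closeness (X k) (x k)) ` ?I)" and ne: "(\<lambda>k. self_closeness (X k) (x k)) ` ?I \<noteq> {}"
    using assms(1) by auto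
  have closeness: "A_sharp (self_closeness (X k) (x k)) (X k) (x k) = self_equivalences (X k) (x k)" if "k \<in> ?I" for k
    by (rule A_sharp_self_closeness[OF assms(3,4,2)]) (use that in auto)
  have factor: "based_homotopy_equivalence (X k) (x k) (X k) (x k) f"
    if k: "k \<in> ?I" and f: "f \<in> based_maps (X k) (x k) (X k) (x k)"
      and bij: "\<And>n. enat n \<le> N \<Longrightarrow> pi_bijective n (X k) (x k) (X k) (x k) f" for k f
  proof -
    have "self_closeness (X k) (x k) \<le> N" unfolding assms(5) by (rule Max_ge[OF fin]) (use k in auto)
    then show ?thesis
      using closeness[OF k] f bij order_trans unfolding A_sharp_eq_iff by blast
  qed
  \<comment> \<open>\<open>c\<close> bounds the indices of the components that may still differ from
    projections; at \<open>c = 0\<close> the map is the identity.\<close>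
  have triangular: "based_homotopy_equivalence ?P ?p ?P ?p f"
    if "f \<in> based_maps ?P ?p ?P ?p" "based_class ?P ?p ?P ?p f \<in> A_sharp N ?P ?p"
      "\<And>z j. z \<in> topspace ?P \<Longrightarrow> j \<in> ?I \<Longrightarrow> c < j \<Longrightarrow> f z j = z j" for f c
    using that
  proof (induction c arbitrary: f)
    case 0
    have "id z = f z" if "z \<in> topspace ?P" for z
    proof
      fix j show "id z j = f z j"
        using 0(3)[OF that, of j] that cm_range[OF based_mapsD(1)[OF 0(1)] that]
        by (cases "j \<in> ?I") (auto simp: Pdef PiE_def extensional_def)
    qed
    moreover have "based_homotopy_equivalence ?P ?p ?P ?p id"
      by (rule homeomorphism_imp_equivalence[OF based_maps_id based_maps_id p]) simp_all
    ultimately show ?case using based_homotopy_equivalence_eq[OF _ p] by metis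
  next
    case (Suc c)
    show ?case
    proof (cases "Suc c \<in> ?I")
      case False
      show ?thesis
      proof (rule Suc.IH[OF Suc.prems(1,2)])
        fix z j assume z: "z \<in> topspace ?P" and j: "j \<in> ?I" "c < j"
        then have "Suc c < j" using False by (metis Suc_lessI)
        then show "f z j = z j" using Suc.prems(3) z j by blast
      qed
    next
      case True
      let ?k = "Suc c"
      note f = Suc.prems(1)
      \<comment> \<open>Components below \<open>Suc c\<close> are replaced by means of reducibility
        and those above are projections already, so only component \<open>Suc c\<close> is left, and
        it is that of \<open>f\<close>.\<close>
      define g where "g z = (\<lambda>j\<in>?I. if j \<in> {1..c} then z j else f z j)" for z
      have g: "g \<in> based_maps ?P ?p ?P ?p" and gA: "based_class ?P ?p ?P ?p g \<in> A_sharp N ?P ?p"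
        using reducible_replace[OF assms(6) f p Suc.prems(2), of "{1..c}"] True by (simp_all add: g_def[abs_def])
      have g_eq: "z(?k := f z ?k) = g z" if "z \<in> topspace ?P" for z
      proof
        fix j
        consider "j \<notin> ?I" | "j \<in> ?I" "j < ?k" | "j = ?k" | "j \<in> ?I" "?k < j" by linarith
        then show "(z(?k := f z ?k)) j = g z j"
        proof cases
          case 1
          then show ?thesis using that True by (auto simp: g_def Pdef PiE_def extensional_def)
        next
          case 4
          then show ?thesis using Suc.prems(3)[OF that, of j] by (simp add: g_def)
        qed (use True in \<open>auto simp: g_def\<close>)
      qed
      have "based_homotopy_equivalence (X ?k) (x ?k) (X ?k) (x ?k) (\<lambda>u. g (incl ?I x ?k u) ?k)"
      proof (rule factor[OF True])
        show "(\<lambda>u. g (incl ?I x ?k u) ?k) \<in> based_maps (X ?k) (x ?k) (X ?k) (x ?k)"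
          using based_maps_comp[OF based_maps_comp[OF incl_based[OF assms(2) True] g[unfolded Pdef pdef]]
              proj_based[OF assms(2) True]] by (simp add: o_def)
        show "pi_bijective n (X ?k) (x ?k) (X ?k) (x ?k) (\<lambda>u. g (incl ?I x ?k u) ?k)" if "enat n \<le> N" for n
        proof (rule pi_bijective_component[OF assms(2) True g[unfolded Pdef pdef]])
          show "g z j = z j" if "z \<in> topspace (product_topology X ?I)" "j \<in> ?I" "j \<noteq> ?k" for z j
            using g_eq[of z] that by (metis Pdef fun_upd_other)
          show "pi_bijective n (product_topology X ?I) (restrict x ?I) (product_topology X ?I) (restrict x ?I) g"
          proof -
            have "pi_bijective n ?P ?p ?P ?p g" using gA \<open>enat n \<le> N\<close> by (simp add: A_sharp_iff[OF g])
            then show ?thesis unfolding Pdef pdef .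
          qed
        qed
      qed
      moreover have "g (incl ?I x ?k u) ?k = f (restrict (x(?k := u)) ?I) ?k" for u
        using True by (simp add: g_def incl_def)
      ultimately have eqk: "based_homotopy_equivalence (X ?k) (x ?k) (X ?k) (x ?k) (\<lambda>u. f (restrict (x(?k := u)) ?I) ?k)"
        by simp
      \<comment> \<open>The index set is written in the form that
        \<open>component_equivalence\<close> expects, with the distinguished index split
        off.\<close>
      have ins: "insert ?k (?I - {?k}) = ?I" using True by blast
      have "based_homotopy_equivalence ?P ?p ?P ?p (\<lambda>z. z(?k := f z ?k))"
        unfolding Pdef pdef
      proof (subst (1 2 3 4) ins[symmetric], rule component_equivalence[where Y = Y and y = y])
        show "continuous_map (product_topology X (insert ?k (?I - {?k}))) (X ?k) (\<lambda>z. f z ?k)"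
          unfolding ins by (rule cm_coord[OF based_mapsD(1)[OF f, unfolded Pdef] True])
        show "based_homotopy_equivalence (X ?k) (x ?k) (X ?k) (x ?k) (\<lambda>u. f (restrict (x(?k := u)) (insert ?k (?I - {?k}))) ?k)"
          unfolding ins by (rule eqk)
      qed (use True assms(2,3,4) in auto)
      then have eqg: "based_homotopy_equivalence ?P ?p ?P ?p g"
        by (rule based_homotopy_equivalence_eq[OF _ p]) (rule g_eq)
      then obtain g' where g': "g' \<in> based_maps ?P ?p ?P ?p" "based_homotopic ?P ?p ?P ?p (g' \<circ> g) id"
        "based_homotopic ?P ?p ?P ?p (g \<circ> g') id" "based_homotopy_equivalence ?P ?p ?P ?p g'"
        by (rule based_homotopy_equivalenceE)
      have fg': "f \<circ> g' \<in> based_maps ?P ?p ?P ?p" by (rule based_maps_comp[OF g'(1) f])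
      \<comment> \<open>Beyond \<open>c\<close> the components of \<open>f\<close> are those of
        \<open>g\<close>, so those of \<open>f \<circ> g'\<close> are only homotopic to projections.
        \<open>f3\<close> has exact projections there, as the induction hypothesis requires.\<close>
      define f3 where "f3 z = (\<lambda>j\<in>?I. if c < j then z j else f (g' z) j)" for z
      obtain R where R: "continuous_map (prod_topology unit_interval ?P) ?P R"
        "\<And>z. R (0, z) = (g \<circ> g') z" "\<And>z. R (1, z) = id z" "\<And>t. 0 \<le> t \<Longrightarrow> t \<le> 1 \<Longrightarrow> R (t, ?p) = ?p"
        using g'(3) by (rule based_homotopicE) auto
      \<comment> \<open>Only the components beyond \<open>c\<close> move, along the homotopy
        \<open>R\<close> from \<open>g \<circ> g'\<close> to the identity.\<close>
      have hom: "based_homotopic ?P ?p ?P ?p (f \<circ> g') f3"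
      proof (rule based_homotopicI[OF p, where h = "\<lambda>z. \<lambda>j\<in>?I. if c < j then R z j else f (g' (snd z)) j"])
        show "continuous_map (prod_topology unit_interval ?P) ?P (\<lambda>z. \<lambda>j\<in>?I. if c < j then R z j else f (g' (snd z)) j)"
          unfolding Pdef
        proof (rule cm_product)
          show "continuous_map (prod_topology unit_interval (product_topology X ?I)) (X i)
              (\<lambda>z. (\<lambda>j\<in>?I. if c < j then R z j else f (g' (snd z)) j) i)" if "i \<in> ?I" for i
            using cm_coord[OF R(1)[unfolded Pdef] that]
              cm_coord[OF cm_comp[OF based_mapsD(1)[OF fg', unfolded Pdef o_def] continuous_map_snd] that] that
            by (cases "c < i") simp_all
        qed simp
        fix z assume z: "z \<in> topspace ?P"
        have g'z: "g' z \<in> topspace ?P" by (rule cm_range[OF based_mapsD(1)[OF g'(1)] z])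
        have fg'z: "f (g' z) \<in> topspace ?P" by (rule cm_range[OF based_mapsD(1)[OF f] g'z])
        have "g (g' z) j = f (g' z) j" if "j \<in> ?I" "c < j" for j
          using that by (simp add: g_def)
        then have "(\<lambda>j\<in>?I. if c < j then R (0, z) j else f (g' z) j) = restrict (f (g' z)) ?I"
          by (intro restrict_ext) (simp add: R)
        also have "\<dots> = f (g' z)" using fg'z by (simp add: Pdef PiE_def extensional_restrict)
        finally show "(\<lambda>j\<in>?I. if c < j then R (0, z) j else f (g' (snd (0, z))) j) = (f \<circ> g') z"
          by (simp only: snd_conv comp_apply)
        show "(\<lambda>j\<in>?I. if c < j then R (1, z) j else f (g' (snd (1, z))) j) = f3 z"
          unfolding f3_def R(3) by (simp only: id_apply snd_conv)
      next
        show "(\<lambda>j\<in>?I. if c < j then R (t, ?p) j else f (g' (snd (t, ?p))) j) = ?p" if "0 \<le> t" "t \<le> 1" for t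
        proof -
          have "f (g' ?p) = ?p" using based_mapsD(2)[OF f] based_mapsD(2)[OF g'(1)] by simp
          then show ?thesis
            by (simp only: snd_conv R(4)[OF that] if_cancel) (simp add: pdef fun_eq_iff)
        qed
      qed
      have f3: "f3 \<in> based_maps ?P ?p ?P ?p" using based_homotopic_imp_maps[OF hom] by blast
      have "based_homotopy_equivalence ?P ?p ?P ?p f3"
      proof (rule Suc.IH[OF f3])
        show "based_class ?P ?p ?P ?p f3 \<in> A_sharp N ?P ?p"
          unfolding A_sharp_iff[OF f3]
        proof (intro allI impI)
          fix n assume "enat n \<le> N"
          then have "pi_bijective n ?P ?p ?P ?p f" using Suc.prems(2) unfolding A_sharp_iff[OF f] by blast
          then show "pi_bijective n ?P ?p ?P ?p f3"
            using pi_bijective_homotopic[OF pi_bijective_comp[OF pi_bijective_equivalence[OF g'(4)] _ g'(1) f] hom] by blast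
        qed
        show "f3 z j = z j" if "j \<in> ?I" "c < j" for z j using that by (simp add: f3_def)
      qed
      then have "based_homotopy_equivalence ?P ?p ?P ?p (f \<circ> g')"
        by (rule based_homotopy_equivalence_homotopic[OF _ based_homotopic_sym[OF hom]])
      \<comment> \<open>Composing with \<open>g\<close> recovers \<open>f\<close> up to homotopy,
        \<open>g'\<close> being also a left inverse of \<open>g\<close>.\<close>
      then have "based_homotopy_equivalence ?P ?p ?P ?p ((f \<circ> g') \<circ> g)"
        by (rule based_homotopy_equivalence_comp[OF eqg])
      moreover have "based_homotopic ?P ?p ?P ?p ((f \<circ> g') \<circ> g) f"
        using based_homotopic_comp_left[OF g'(2) f] by (simp add: o_assoc)
      ultimately show ?thesis by (rule based_homotopy_equivalence_homotopic)
    qed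
  qed
  have main: "A_sharp N ?P ?p = self_equivalences ?P ?p"
    unfolding A_sharp_eq_iff
  proof (intro ballI impI)
    fix f assume f: "f \<in> based_maps ?P ?p ?P ?p" and "\<forall>k. enat k \<le> N \<longrightarrow> pi_bijective k ?P ?p ?P ?p f"
    then have "based_class ?P ?p ?P ?p f \<in> A_sharp N ?P ?p" by (simp add: A_sharp_iff)
    \<comment> \<open>At \<open>c = m\<close> no component is required to be a projection.\<close>
    then show "based_homotopy_equivalence ?P ?p ?P ?p f"
      by (rule triangular[OF f, where c = m]) auto
  qed
  let ?n = "self_closeness ?P ?p"
  have "?n \<le> N" unfolding self_closeness_def using main by (rule Least_le)
  \<comment> \<open>For the product the minimum is attained because \<open>main\<close> exhibits
    \<open>N\<close> as a candidate.\<close>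
  moreover have "A_sharp ?n ?P ?p = self_equivalences ?P ?p"
    unfolding self_closeness_def using main by (rule LeastI)
  then have n: "based_homotopy_equivalence ?P ?p ?P ?p f"
    if "f \<in> based_maps ?P ?p ?P ?p" "\<And>k. enat k \<le> ?n \<Longrightarrow> pi_bijective k ?P ?p ?P ?p f" for f
    using that unfolding A_sharp_eq_iff by blast
  have "self_closeness (X k) (x k) \<le> ?n" if k: "k \<in> ?I" for k
  proof -
    have "A_sharp ?n (X k) (x k) = self_equivalences (X k) (x k)"
      unfolding A_sharp_eq_iff
    proof (intro ballI impI)
      fix f assume f: "f \<in> based_maps (X k) (x k) (X k) (x k)"
        and bij: "\<forall>i. enat i \<le> ?n \<longrightarrow> pi_bijective i (X k) (x k) (X k) (x k) f"
      have eqv: "based_homotopy_equivalence ?P ?p ?P ?p (\<lambda>z. z(k := f (z k)))"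
      proof (rule n)
        show "(\<lambda>z. z(k := f (z k))) \<in> based_maps ?P ?p ?P ?p"
          unfolding Pdef pdef by (rule product_with_identity_based[where I = ?I and X = X and x = x and k = k and f = f, OF assms(2) k f])
        show "pi_bijective i ?P ?p ?P ?p (\<lambda>z. z(k := f (z k)))" if "enat i \<le> ?n" for i
          unfolding Pdef pdef
          by (rule pi_bijective_product_with_identity[where I = ?I and X = X and x = x and k = k and f = f, OF assms(2) k f]) (assumption, rule bij[rule_format, OF that])
      qed
      show "based_homotopy_equivalence (X k) (x k) (X k) (x k) f"
        by (rule factor_equivalence[where I = ?I and X = X and x = x and k = k and f = f,
              OF assms(2) k f eqv[unfolded Pdef pdef]])
    qed
    then show ?thesis unfolding self_closeness_def[of "X k"] by (rule Least_le)
  qed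
  then have "N \<le> ?n" unfolding assms(5) using Max.boundedI[OF fin ne] by blast
  ultimately show ?thesis using main by simp
qed

end
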